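(* For any $\mathscr{B}\subset\mathbb{N}$, the subshift $(S,\widetilde{X}_\eta)$ is intrinsically ergodic.
   Context: $\mathbb{N}=\{1,2,\dots\}$. For $\mathscr{B}\subset\mathbb{N}$ let $\mathcal{F}_{\mathscr{B}}:=\mathbb{Z}\setminus\bigcup_{b\in\mathscr{B}}b\mathbb{Z}$; $\eta\in\{0,1\}^{\mathbb{Z}}$ is the characteristic function of $\mathcal{F}_{\mathscr{B}}$. $S$ is the left shift on $\{0,1\}^{\mathbb{Z}}$ (product topology), and $X_\eta$ is the closure of $\{S^m\eta : m\in\mathbb{Z}\}$. A subshift $X\subset\{0,1\}^{\mathbb{Z}}$ (closed, $S$-invariant set) is hereditary if $x\in X$ and $y\le x$ coordinatewise imply $y\in X$; $\widetilde{X}_\eta$ is the smallest hereditary subshift containing $X_\eta$. A topological dynamical system $(T,X)$ is intrinsically ergodic if there is exactly one $T$-invariant Borel probability measure $\mu$ on $X$ whose Kolmogorov entropy $h(T,X,\mu)$ equals the topological entropy $h_{top}(T,X)$. *)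

theory Defs
  imports "HOL-Probability.Probability"
begin

section \<open>Entropy of a dynamical system\<close>

definition join :: "'a set set \<Rightarrow> 'a set set \<Rightarrow> 'a set set" where
  "join P Q = {A \<inter> B | A B. A \<in> P \<and> B \<in> Q}"

definition pullback :: "('a \<Rightarrow> 'a) \<Rightarrow> 'a set \<Rightarrow> 'a set set \<Rightarrow> 'a set set" where
  "pullback f X P = (\<lambda>A. f -` A \<inter> X) ` P"

text \<open>The \<open>n\<close>-th iterated join is the join of the families \<open>T\<^sup>-\<^sup>iP\<close> for \<open>0 \<le> i < n\<close>.\<close>

primrec iterated_join :: "('a \<Rightarrow> 'a) \<Rightarrow> 'a set \<Rightarrow> 'a set set \<Rightarrow> nat \<Rightarrow> 'a set set" where
  "iterated_join T X P 0 = {X}"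
| "iterated_join T X P (Suc n) = join (iterated_join T X P n) (pullback (T ^^ n) X P)"


subsection \<open>Topological entropy\<close>

text \<open>
  Topological entropy is defined by open covers (Adler, Konheim and McAndrew); the phase space
  is a compact set \<open>X\<close>, and open sets are those of its subspace topology.
  All logarithms are natural.
\<close>

definition open_cover :: "'a::topological_space set \<Rightarrow> 'a set set \<Rightarrow> bool" where
  "open_cover X C \<longleftrightarrow> (\<forall>U\<in>C. openin (top_of_set X) U) \<and> \<Union>C = X"

definition min_subcover :: "'a set \<Rightarrow> 'a set set \<Rightarrow> nat" where
  "min_subcover X C = (LEAST k. \<exists>D\<subseteq>C. finite D \<and> card D = k \<and> X \<subseteq> \<Union>D)"

definition cover_entropy :: "('a \<Rightarrow> 'a) \<Rightarrow> 'a set \<Rightarrow> 'a set set \<Rightarrow> real" where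
  "cover_entropy T X C = lim (\<lambda>n. ln (real (min_subcover X (iterated_join T X C n))) / real n)"

definition topological_entropy :: "('a::topological_space \<Rightarrow> 'a) \<Rightarrow> 'a set \<Rightarrow> ereal" where
  "topological_entropy T X = (SUP C \<in> {C. open_cover X C}. ereal (cover_entropy T X C))"


subsection \<open>Invariant measures and Kolmogorov entropy\<close>

definition invariant_prob :: "('a::topological_space \<Rightarrow> 'a) \<Rightarrow> 'a set \<Rightarrow> 'a measure \<Rightarrow> bool" where
  "invariant_prob T X \<mu> \<longleftrightarrow>
     sets \<mu> = sets (restrict_space borel X) \<and> prob_space \<mu> \<and>
     T \<in> measurable \<mu> \<mu> \<and> distr \<mu> \<mu> T = \<mu>"

definition measurable_partition :: "'a measure \<Rightarrow> 'a set set \<Rightarrow> bool" where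
  "measurable_partition \<mu> P \<longleftrightarrow> finite P \<and> P \<subseteq> sets \<mu> \<and> partition_on (space \<mu>) P"

text \<open>
  Joins of partitions may contain the empty set. It contributes nothing below, because
  \<open>0 * ln 0 = 0\<close>.
\<close>

definition shannon_entropy :: "'a measure \<Rightarrow> 'a set set \<Rightarrow> real" where
  "shannon_entropy \<mu> P = - (\<Sum>A\<in>P. measure \<mu> A * ln (measure \<mu> A))"

definition partition_entropy :: "('a \<Rightarrow> 'a) \<Rightarrow> 'a measure \<Rightarrow> 'a set set \<Rightarrow> real" where
  "partition_entropy T \<mu> P =
     lim (\<lambda>n. shannon_entropy \<mu> (iterated_join T (space \<mu>) P n) / real n)"

definition kolmogorov_entropy :: "('a \<Rightarrow> 'a) \<Rightarrow> 'a measure \<Rightarrow> ereal" where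
  "kolmogorov_entropy T \<mu> =
     (SUP P \<in> {P. measurable_partition \<mu> P}. ereal (partition_entropy T \<mu> P))"

definition intrinsically_ergodic :: "('a::topological_space \<Rightarrow> 'a) \<Rightarrow> 'a set \<Rightarrow> bool" where
  "intrinsically_ergodic T X \<longleftrightarrow>
     (\<exists>!\<mu>. invariant_prob T X \<mu> \<and> kolmogorov_entropy T \<mu> = topological_entropy T X)"


section \<open>Subshifts\<close>

text \<open>
  Points of \<open>{0,1}\<^sup>\<int>\<close> are functions of type \<open>int \<Rightarrow> bool\<close>, with \<open>True\<close> for 1. The topology on
  this type is the product topology of the discrete space \<open>bool\<close>, and its order \<open>\<le>\<close> is the
  coordinatewise order with \<open>False < True\<close>.
\<close>

text \<open>\<open>shift_by m\<close> is the \<open>m\<close>-th power of the left shift, for every integer \<open>m\<close>.\<close>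

definition shift_by :: "int \<Rightarrow> (int \<Rightarrow> bool) \<Rightarrow> (int \<Rightarrow> bool)" where
  "shift_by m x = (\<lambda>n. x (n + m))"

definition shift :: "(int \<Rightarrow> bool) \<Rightarrow> (int \<Rightarrow> bool)" where
  "shift = shift_by 1"

definition subshift :: "(int \<Rightarrow> bool) set \<Rightarrow> bool" where
  "subshift X \<longleftrightarrow> closed X \<and> shift ` X = X"

definition hereditary :: "(int \<Rightarrow> bool) set \<Rightarrow> bool" where
  "hereditary X \<longleftrightarrow> (\<forall>x\<in>X. \<forall>y\<le>x. y \<in> X)"

definition hereditary_closure :: "(int \<Rightarrow> bool) set \<Rightarrow> (int \<Rightarrow> bool) set" where
  "hereditary_closure X = \<Inter>{Y. subshift Y \<and> hereditary Y \<and> X \<subseteq> Y}"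

lemma shift_by_add: "shift_by m (shift_by k x) = shift_by (m + k) x"
  by (simp add: shift_by_def add.assoc)

lemma shift_by_0: "shift_by 0 x = x"
  by (simp add: shift_by_def)

lemma shift_funpow: "shift ^^ n = shift_by (int n)"
proof (induction n)
  case 0
  show ?case by (simp add: shift_by_def fun_eq_iff)
next
  case (Suc n)
  have "(shift ^^ Suc n) x = shift_by (int (Suc n)) x" for x
    by (simp add: Suc.IH shift_by_add) (simp add: shift_def shift_by_add)
  then show ?case by blast
qed

lemma shift_image_iff: "y \<in> shift ` X \<longleftrightarrow> shift_by (- 1) y \<in> X"
proof
  assume "y \<in> shift ` X"
  then show "shift_by (- 1) y \<in> X"
    by (auto simp: shift_def shift_by_add shift_by_0)
next
  assume "shift_by (- 1) y \<in> X"
  moreover have "y = shift (shift_by (- 1) y)"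
    by (simp add: shift_def shift_by_add shift_by_0)
  ultimately show "y \<in> shift ` X" by blast
qed

text \<open>The intersection above is itself a hereditary subshift, hence the smallest one.\<close>

lemma hereditary_closure_least:
  shows "subshift (hereditary_closure X)" "hereditary (hereditary_closure X)"
    "X \<subseteq> hereditary_closure X"
    "\<And>Y. subshift Y \<Longrightarrow> hereditary Y \<Longrightarrow> X \<subseteq> Y \<Longrightarrow> hereditary_closure X \<subseteq> Y"
proof -
  have "closed (hereditary_closure X)"
    unfolding hereditary_closure_def by (rule closed_Inter) (auto simp: subshift_def)
  moreover have "shift ` hereditary_closure X = hereditary_closure X"
  proof (intro set_eqI)
    fix y
    have "shift_by (- 1) y \<in> Y \<longleftrightarrow> y \<in> Y" if "subshift Y" for Y
      using that shift_image_iff[of y Y] by (simp add: subshift_def)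
    then show "y \<in> shift ` hereditary_closure X \<longleftrightarrow> y \<in> hereditary_closure X"
      unfolding shift_image_iff by (auto simp: hereditary_closure_def)
  qed
  ultimately show "subshift (hereditary_closure X)"
    by (simp add: subshift_def)
  show "hereditary (hereditary_closure X)"
    unfolding hereditary_def hereditary_closure_def by blast
  show "X \<subseteq> hereditary_closure X"
    unfolding hereditary_closure_def by blast
  show "\<And>Y. subshift Y \<Longrightarrow> hereditary Y \<Longrightarrow> X \<subseteq> Y \<Longrightarrow> hereditary_closure X \<subseteq> Y"
    unfolding hereditary_closure_def by blast
qed


section \<open>\<open>\<B>\<close>-free systems\<close>

definition B_free :: "nat set \<Rightarrow> int set" where
  "B_free B = UNIV - (\<Union>b\<in>B. {int b * k | k. True})"

definition eta :: "nat set \<Rightarrow> int \<Rightarrow> bool" where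
  "eta B = (\<lambda>n. n \<in> B_free B)"

definition X_eta :: "nat set \<Rightarrow> (int \<Rightarrow> bool) set" where
  "X_eta B = closure {shift_by m (eta B) | m. True}"

definition X_tilde :: "nat set \<Rightarrow> (int \<Rightarrow> bool) set" where
  "X_tilde B = hereditary_closure (X_eta B)"

end

theory Submission
  imports Defs
begin

text \<open>
  Let \<open>F\<^sub>K\<close> be the set of integers that no \<open>b \<in> B\<close> with \<open>b \<le> K\<close> divides. It has period \<open>K!\<close>, and its
  density decreases with \<open>K\<close> to a limit \<open>d\<close>. Both the topological entropy of \<open>X_tilde B\<close> and
  the largest Kolmogorov entropy equal \<open>d \<cdot> ln 2\<close>.

  For every \<open>K\<close>, each point of \<open>X_tilde B\<close> is coordinatewise below a translate of \<open>F\<^sub>K\<close> (\<open>X_tilde_le_sieve\<close>), so that there are at most \<open>K! \<cdot> 2\<^sup>N\<^sup>d\<close> words of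
  length \<open>N\<close>, up to an error in the exponent that is negligible as \<open>N\<close> and then \<open>K\<close> grow. For
  uniqueness the words are weighted by \<open>exp\<close> of \<open>t\<close> times the number of occurrences of a finite
  pattern \<open>A\<close> of ones. Gibbs' inequality bounds \<open>h(\<mu>) + t \<cdot> \<mu>(A)\<close> by the growth rate of the
  weighted count. Below a fixed translate of \<open>F\<^sub>K\<close> a word is an arbitrary subset, occurrences of
  \<open>A\<close> at distant places are independent in a uniformly random subset, and an estimate of the
  moment generating function to second order gives the rate
  \<open>d \<cdot> ln 2 + t \<cdot> p\<^sub>A + O(t\<^sup>2)\<close>, where \<open>p\<^sub>A\<close> is \<open>2\<^sup>-\<^sup>|\<^sup>A\<^sup>|\<close> times the limiting density of the places
  where \<open>A\<close> fits into \<open>F\<^sub>K\<close>. If \<open>h(\<mu>) = d \<cdot> ln 2\<close>, then \<open>t \<cdot> (p\<^sub>A - \<mu>(A)) + O(t\<^sup>2) \<ge> 0\<close> for small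
  \<open>t\<close> of either sign, hence \<open>\<mu>(A) = p\<^sub>A\<close> (\<open>maximal_entropy_pattern\<close>), and these values
  determine \<open>\<mu>\<close> (\<open>patterns_determine_measure\<close>). The same use of Gibbs' inequality takes care of
  arbitrary measurable partitions: they are approximated by partitions into cylinders, and the
  weights charge a small price for the disagreement (\<open>itinerary_entropy_le_pressure\<close>).

  To obtain a measure of this entropy, translate the \<open>B\<close>-free set by a random profinite integer
  and delete each of its elements with probability one half. The law of the result (\<open>max_measure\<close>) has the pattern
  probabilities \<open>p\<^sub>A\<close>; it is therefore invariant, and its entropy is at least \<open>d \<cdot> ln 2\<close>,
  because its words are fair coin tosses on a random set of density \<open>d\<close>
  (\<open>max_measure_word_entropy\<close>). It is carried by \<open>X_tilde B\<close> because a random translate of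
  \<open>F\<^sub>K\<close> mostly looks like a piece of the sequence \<open>eta B\<close> itself. This is the one place where
  arithmetic enters: by the Davenport--Erdos theorem (\<open>davenport_erdos\<close>) the \<open>B\<close>-free set has
  upper density \<open>d\<close>, so that along suitable intervals it differs from \<open>F\<^sub>K\<close> in a proportion of
  places that tends to \<open>0\<close> as \<open>K\<close> grows.

  The Davenport--Erdos theorem holds for the following reason. For \<open>s > 1\<close> the function \<open>1/n\<close>
  is the Dirichlet convolution of \<open>n\<^sup>-\<^sup>s\<close> with a non-negative function, and \<open>F\<^sub>K\<close> is closed under divisors. Hence \<open>F\<^sub>K\<close> has at least
  as large a share of the sum of all \<open>n\<^sup>-\<^sup>s\<close> as of the sum of all \<open>1/n\<close>, where its share is its
  density. This bound is uniform in \<open>K\<close>, so it passes to the \<open>B\<close>-free set, and \<open>s \<rightarrow> 1\<close> yields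
  the claim about densities.
\<close>

section \<open>Convergence and entropy inequalities\<close>

text \<open>
  Fekete's lemma: division with remainder by a fixed \<open>m\<close> shows that \<open>a n / n\<close> exceeds
  \<open>a m / m\<close> by at most \<open>O(1/n)\<close>.
\<close>

lemma subadditive_convergent:
  fixes a :: "nat \<Rightarrow> real"
  assumes sub: "\<And>m n. a (m + n) \<le> a m + a n" and nonneg: "\<And>n. 0 \<le> a n"
  shows "convergent (\<lambda>n. a n / real n)"
proof -
  define l where "l = (INF n\<in>{1..}. a n / real n)"
  have bdd: "bdd_below ((\<lambda>n. a n / real n) ` {1..})"
    by (rule bdd_belowI[of _ 0]) (use nonneg in auto)
  have lower: "l \<le> a n / real n" if "n \<ge> 1" for n
    unfolding l_def using that by (intro cINF_lower bdd) auto
  have mult: "a (q * m) \<le> real q * a m" if "q \<ge> 1" for q m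
    using that
  proof (induction q rule: nat_induct_at_least)
    case (Suc q)
    have "a (Suc q * m) \<le> a m + a (q * m)" using sub[of m "q * m"] by simp
    with Suc show ?case by (simp add: algebra_simps)
  qed simp
  have "(\<lambda>n. a n / real n) \<longlonglongrightarrow> l"
  proof (rule LIMSEQ_I)
    fix e :: real assume e: "0 < e"
    have "\<exists>m\<in>{1..}. a m / real m < l + e / 2"
      using cINF_less_iff[OF _ bdd, of "l + e/2"] e by (auto simp: l_def)
    then obtain m where m: "m \<ge> 1" "a m / real m < l + e / 2" by auto
    define C where "C = Max (a ` {..m})"
    have C: "a r \<le> C" if "r \<le> m" for r unfolding C_def using that by auto
    have C0: "0 \<le> C" using C[of 0] nonneg[of 0] by simp
    define N where "N = max m (Suc (nat \<lceil>2 * C / e\<rceil>))"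
    have "norm (a n / real n - l) < e" if n: "n \<ge> N" for n
    proof -
      have n1: "n \<ge> m" "n \<ge> 1" using n m by (auto simp: N_def)
      have "2 * C / e < real n" using n unfolding N_def by linarith
      then have Cn: "C / real n < e / 2" using e n1 by (simp add: field_simps)
      have q1: "n div m \<ge> 1" using n1 m by (simp add: div_greater_zero_iff Suc_le_eq)
      have "a n = a (n div m * m + n mod m)" by simp
      also have "\<dots> \<le> real (n div m) * a m + C"
        using sub[of "n div m * m" "n mod m"] mult[OF q1, of m] C[of "n mod m"] m
        by (auto intro: order.trans less_imp_le)
      also have "real (n div m) \<le> real n / real m"
        by (rule of_nat_div_le_of_nat)
      then have "real (n div m) * a m + C \<le> real n / real m * a m + C"
        using nonneg by (intro add_right_mono mult_right_mono)
      finally have "a n / real n \<le> (real n / real m * a m + C) / real n"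
        by (simp add: divide_right_mono)
      also have "\<dots> = a m / real m + C / real n" using n1 by (simp add: field_simps)
      finally have "a n / real n < l + e" using m Cn by linarith
      then show ?thesis using lower[OF n1(2)] e by simp
    qed
    then show "\<exists>N. \<forall>n\<ge>N. norm (a n / real n - l) < e" by blast
  qed
  then show ?thesis by (rule convergentI)
qed

text \<open>
  Concavity of the logarithm, in the form \<open>ln x \<le> x - 1\<close>. Three different choices of the weights
  \<open>q\<close> give the subadditivity of entropy, the bound of entropy by weighted counts, and the lower
  bound for the entropy of a mixture.
\<close>

lemma gibbs_inequality:
  fixes p q :: "'i \<Rightarrow> real"
  assumes fin: "finite I" and p: "\<And>i. i \<in> I \<Longrightarrow> 0 \<le> p i" and p1: "sum p I = 1"
    and q: "\<And>i. i \<in> I \<Longrightarrow> 0 \<le> q i" and pq: "\<And>i. i \<in> I \<Longrightarrow> 0 < p i \<Longrightarrow> 0 < q i"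
    and qQ: "sum q I \<le> Q"
  shows "(\<Sum>i\<in>I. p i * ln (q i)) - (\<Sum>i\<in>I. p i * ln (p i)) \<le> ln Q"
proof -
  obtain i0 where i0: "i0 \<in> I" "0 < p i0"
    using p1 p by (metis less_eq_real_def sum.neutral zero_neq_one)
  have Q: "0 < Q"
  proof -
    have "0 < sum q I"
      by (rule sum_pos2[of I i0]) (use fin i0 q pq in auto)
    then show ?thesis using qQ by simp
  qed
  have "p i * ln (q i) - p i * ln (p i) - p i * ln Q \<le> q i / Q - p i" if i: "i \<in> I" for i
  proof (cases "p i = 0")
    case True
    then show ?thesis using q[OF i] Q by simp
  next
    case False
    then have pi: "0 < p i" using p[OF i] by simp
    have qi: "0 < q i" using pq[OF i pi] .
    have "p i * ln (q i) - p i * ln (p i) - p i * ln Q = p i * ln (q i / (p i * Q))"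
      using pi qi Q by (simp add: ln_div ln_mult algebra_simps)
    also have "\<dots> \<le> p i * (q i / (p i * Q) - 1)"
      using pi qi Q by (intro mult_left_mono ln_le_minus_one) auto
    also have "\<dots> = q i / Q - p i" using pi by (simp add: field_simps)
    finally show ?thesis .
  qed
  then have "(\<Sum>i\<in>I. p i * ln (q i) - p i * ln (p i) - p i * ln Q) \<le> (\<Sum>i\<in>I. q i / Q - p i)"
    by (rule sum_mono)
  then have "(\<Sum>i\<in>I. p i * ln (q i)) - (\<Sum>i\<in>I. p i * ln (p i)) - ln Q \<le> sum q I / Q - 1"
    using p1 by (simp add: sum_subtractf sum_divide_distrib flip: sum_distrib_right)
  moreover have "sum q I / Q \<le> 1" using qQ Q by simp
  ultimately show ?thesis by linarith
qed

text \<open>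
  Entropy is handled for random variables rather than for partitions: the values of a variable
  index exactly the non-empty atoms, whereas joins of partitions may contain the empty set.
\<close>

definition point_prob :: "'a measure \<Rightarrow> ('a \<Rightarrow> 'c) \<Rightarrow> 'c \<Rightarrow> real" where
  "point_prob \<mu> V v = measure \<mu> (V -` {v} \<inter> space \<mu>)"

definition rv_entropy :: "'a measure \<Rightarrow> ('a \<Rightarrow> 'c) \<Rightarrow> real" where
  "rv_entropy \<mu> V = - (\<Sum>v\<in>V ` space \<mu>. point_prob \<mu> V v * ln (point_prob \<mu> V v))"

lemma point_prob_nonneg: "0 \<le> point_prob \<mu> V v"
  by (simp add: point_prob_def)

lemma point_prob_outside: "v \<notin> V ` space \<mu> \<Longrightarrow> point_prob \<mu> V v = 0"
proof -
  assume "v \<notin> V ` space \<mu>"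
  then have "V -` {v} \<inter> space \<mu> = {}" by auto
  then show ?thesis by (simp add: point_prob_def)
qed

lemma rv_entropy_eq_sum:
  assumes "finite I" "V ` space \<mu> \<subseteq> I"
  shows "rv_entropy \<mu> V = - (\<Sum>v\<in>I. point_prob \<mu> V v * ln (point_prob \<mu> V v))"
  unfolding rv_entropy_def using assms by (auto intro!: sum.mono_neutral_left simp: point_prob_outside)

context prob_space
begin

lemma point_prob_le_1: "point_prob M V v \<le> 1"
  by (simp add: point_prob_def)

lemma simple_image_fibre:
  assumes V: "simple_function M V" 
  shows "V -` {v} \<inter> space M \<in> sets M"
  using simple_functionD(2)[OF V] by auto

lemma expectation_simple:
  fixes g :: "'c \<Rightarrow> real"
  assumes V: "simple_function M V" and I: "finite I" "V ` space M \<subseteq> I"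
  shows "expectation (\<lambda>x. g (V x)) = (\<Sum>v\<in>I. point_prob M V v * g v)"
    "integrable M (\<lambda>x. g (V x))"
proof -
  have eq: "g (V x) = (\<Sum>v\<in>I. g v * indicator (V -` {v} \<inter> space M) x)" if "x \<in> space M" for x
  proof -
    have "(\<Sum>v\<in>I. g v * indicator (V -` {v} \<inter> space M) x) = (\<Sum>v\<in>I. if v = V x then g v else 0)"
      using that by (intro sum.cong) (auto simp: indicator_def)
    then show ?thesis using that I by auto
  qed
  have int: "integrable M (\<lambda>x. g v * indicator (V -` {v} \<inter> space M) x)" for v
    using simple_image_fibre[OF V, of v] by (intro integrable_mult_right) (auto simp: emeasure_eq_measure)
  have "expectation (\<lambda>x. g (V x)) = expectation (\<lambda>x. \<Sum>v\<in>I. g v * indicator (V -` {v} \<inter> space M) x)"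
    using eq by (intro Bochner_Integration.integral_cong) auto
  also have "\<dots> = (\<Sum>v\<in>I. expectation (\<lambda>x. g v * indicator (V -` {v} \<inter> space M) x))"
    using int by (intro Bochner_Integration.integral_sum) auto
  also have "\<dots> = (\<Sum>v\<in>I. point_prob M V v * g v)"
    using simple_image_fibre[OF V] by (intro sum.cong) (auto simp: point_prob_def)
  finally show "expectation (\<lambda>x. g (V x)) = (\<Sum>v\<in>I. point_prob M V v * g v)" .
  have "integrable M (\<lambda>x. \<Sum>v\<in>I. g v * indicator (V -` {v} \<inter> space M) x)"
    using int by auto
  then show "integrable M (\<lambda>x. g (V x))"
    by (rule Bochner_Integration.integrable_cong[THEN iffD1, rotated -1]) (use eq in auto)
qed

lemma sum_point_prob:
  assumes V: "simple_function M V" and I: "finite I" "V ` space M \<subseteq> I"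
  shows "(\<Sum>v\<in>I. point_prob M V v) = 1"
  using expectation_simple(1)[OF assms, of "\<lambda>_. 1"] by (simp add: prob_space)

lemma rv_entropy_nonneg:
  shows "0 \<le> rv_entropy M V"
proof -
  have "point_prob M V v * ln (point_prob M V v) \<le> 0" for v
    using point_prob_le_1[of V v] point_prob_nonneg[of M V v]
    by (cases "point_prob M V v = 0") (auto simp: mult_le_0_iff)
  then show ?thesis unfolding rv_entropy_def by (simp add: sum_nonpos)
qed

text \<open>
  The variational inequality between entropy and pressure. For \<open>f = 0\<close> it bounds the entropy by
  the logarithm of the number of values.
\<close>

lemma rv_entropy_le_ln_weights:
  fixes f :: "'c \<Rightarrow> real"
  assumes V: "simple_function M V" and I: "finite I" "V ` space M \<subseteq> I"
    and Q: "(\<Sum>v\<in>I. exp (f v)) \<le> Q"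
  shows "rv_entropy M V + expectation (\<lambda>x. f (V x)) \<le> ln Q"
  using gibbs_inequality[of I "point_prob M V" "\<lambda>v. exp (f v)" Q] I Q sum_point_prob[OF V I] point_prob_nonneg[of M V]
  by (simp add: rv_entropy_eq_sum[OF I] expectation_simple(1)[OF V I])

lemma rv_entropy_le_ln_card:
  assumes V: "simple_function M V"
  shows "rv_entropy M V \<le> ln (real (card (V ` space M)))"
  using rv_entropy_le_ln_weights[OF V, of "V ` space M" "\<lambda>_. 0"] simple_functionD(1)[OF V] by simp

lemma point_prob_marginal:
  assumes V: "simple_function M V" and I: "finite I" "V ` space M \<subseteq> I"
  shows "point_prob M (\<lambda>x. h (V x)) w = (\<Sum>v\<in>{v\<in>I. h v = w}. point_prob M V v)"
proof -
  have "expectation (\<lambda>x. of_bool (h (V x) = w)) = (\<Sum>v\<in>I. point_prob M V v * of_bool (h v = w))"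
    by (rule expectation_simple(1)[OF assms, of "\<lambda>v. of_bool (h v = w)"])
  also have "\<dots> = (\<Sum>v\<in>{v\<in>I. h v = w}. point_prob M V v)"
    using I by (intro sum.mono_neutral_cong_right) auto
  finally have "expectation (\<lambda>x. of_bool (h (V x) = w)) = (\<Sum>v\<in>{v\<in>I. h v = w}. point_prob M V v)" .
  moreover have "expectation (\<lambda>x. of_bool (h (V x) = w))
      = expectation (indicat_real ((\<lambda>x. h (V x)) -` {w} \<inter> space M))"
    by (intro Bochner_Integration.integral_cong) (auto simp: indicator_def)
  moreover have "simple_function M (\<lambda>x. h (V x))"
    by (rule simple_function_compose1[OF V])
  then have "(\<lambda>x. h (V x)) -` {w} \<inter> space M \<in> sets M"
    by (rule simple_image_fibre)
  ultimately show ?thesis by (simp add: point_prob_def)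
qed

lemma rv_entropy_mono:
  assumes V: "simple_function M V"
  shows "rv_entropy M (\<lambda>x. h (V x)) \<le> rv_entropy M V"
proof -
  define I where "I = V ` space M"
  have I: "finite I" "V ` space M \<subseteq> I" using simple_functionD(1)[OF V] by (auto simp: I_def)
  have hI: "finite (h ` I)" "(\<lambda>x. h (V x)) ` space M \<subseteq> h ` I" using I by (auto simp: I_def)
  let ?W = "\<lambda>x. h (V x)"
  have "(\<Sum>w\<in>h ` I. point_prob M ?W w * ln (point_prob M ?W w))
      = (\<Sum>w\<in>h ` I. \<Sum>v\<in>{v\<in>I. h v = w}. point_prob M V v * ln (point_prob M ?W (h v)))"
    by (intro sum.cong refl) (subst point_prob_marginal[OF V I], simp add: sum_distrib_right)
  also have "\<dots> = (\<Sum>v\<in>I. point_prob M V v * ln (point_prob M ?W (h v)))"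
    using I by (intro sum.group) auto
  also have "\<dots> \<ge> (\<Sum>v\<in>I. point_prob M V v * ln (point_prob M V v))"
  proof (rule sum_mono)
    fix v assume v: "v \<in> I"
    have "point_prob M V v \<le> point_prob M ?W (h v)"
      unfolding point_prob_marginal[OF V I] using v I by (intro member_le_sum) (auto simp: point_prob_nonneg)
    then show "point_prob M V v * ln (point_prob M V v) \<le> point_prob M V v * ln (point_prob M ?W (h v))"
      using point_prob_nonneg[of M V v] by (cases "point_prob M V v = 0") (auto intro!: mult_left_mono)
  qed
  finally show ?thesis by (simp add: rv_entropy_eq_sum[OF I] rv_entropy_eq_sum[OF hI])
qed

text \<open>
  Gibbs' inequality, with the product of the two marginal distributions as weights.
\<close>

lemma rv_entropy_Pair_le:
  assumes V: "simple_function M V" and W: "simple_function M W"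
  shows "rv_entropy M (\<lambda>x. (V x, W x)) \<le> rv_entropy M V + rv_entropy M W"
proof -
  define I J where "I = V ` space M" and "J = W ` space M"
  have I: "finite I" "V ` space M \<subseteq> I" using simple_functionD(1)[OF V] by (auto simp: I_def)
  have J: "finite J" "W ` space M \<subseteq> J" using simple_functionD(1)[OF W] by (auto simp: J_def)
  let ?Z = "\<lambda>x. (V x, W x)"
  have Z: "simple_function M ?Z" by (rule simple_function_Pair[OF V W])
  have IJ: "finite (I \<times> J)" "?Z ` space M \<subseteq> I \<times> J" using I J by auto
  define q where "q = (\<lambda>(v, w). point_prob M V v * point_prob M W w)"
  have margV: "point_prob M V v = (\<Sum>z\<in>{z\<in>I \<times> J. fst z = v}. point_prob M ?Z z)" for v
    using point_prob_marginal[OF Z IJ, of fst v] by simp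
  have margW: "point_prob M W w = (\<Sum>z\<in>{z\<in>I \<times> J. snd z = w}. point_prob M ?Z z)" for w
    using point_prob_marginal[OF Z IJ, of snd w] by simp
  have le: "point_prob M ?Z z \<le> point_prob M V (fst z)" "point_prob M ?Z z \<le> point_prob M W (snd z)" if "z \<in> I \<times> J" for z
    unfolding margV margW using that IJ by (auto intro!: member_le_sum simp: point_prob_nonneg)
  have "(\<Sum>z\<in>I \<times> J. point_prob M ?Z z * ln (q z)) - (\<Sum>z\<in>I \<times> J. point_prob M ?Z z * ln (point_prob M ?Z z)) \<le> ln 1"
  proof (rule gibbs_inequality)
    show "sum q (I \<times> J) \<le> 1"
      using sum_point_prob[OF V I] sum_point_prob[OF W J] by (simp add: q_def sum.cartesian_product[symmetric] flip: sum_distrib_left)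
    show "0 < q z" if "z \<in> I \<times> J" "0 < point_prob M ?Z z" for z
      using le[OF that(1)] that(2) by (auto simp: q_def split_beta)
  qed (use IJ sum_point_prob[OF Z IJ] in \<open>auto simp: point_prob_nonneg q_def\<close>)
  moreover have "(\<Sum>z\<in>I \<times> J. point_prob M ?Z z * ln (q z))
      = (\<Sum>z\<in>I \<times> J. point_prob M ?Z z * (ln (point_prob M V (fst z)) + ln (point_prob M W (snd z))))"
  proof (rule sum.cong[OF refl])
    fix z assume z: "z \<in> I \<times> J"
    show "point_prob M ?Z z * ln (q z) = point_prob M ?Z z * (ln (point_prob M V (fst z)) + ln (point_prob M W (snd z)))"
      using le[OF z] point_prob_nonneg[of M ?Z z]
      by (cases "point_prob M ?Z z = 0") (auto simp: q_def split_beta ln_mult)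
  qed
  moreover have "(\<Sum>z\<in>I \<times> J. point_prob M ?Z z * (ln (point_prob M V (fst z)) + ln (point_prob M W (snd z))))
      = expectation (\<lambda>x. ln (point_prob M V (V x)) + ln (point_prob M W (W x)))"
    using expectation_simple(1)[OF Z IJ, of "\<lambda>z. ln (point_prob M V (fst z)) + ln (point_prob M W (snd z))"] by simp
  moreover have "expectation (\<lambda>x. ln (point_prob M V (V x)) + ln (point_prob M W (W x)))
      = expectation (\<lambda>x. ln (point_prob M V (V x))) + expectation (\<lambda>x. ln (point_prob M W (W x)))"
    by (intro Bochner_Integration.integral_add expectation_simple(2)[OF V I, of "\<lambda>v. ln (point_prob M V v)"] 
        expectation_simple(2)[OF W J, of "\<lambda>v. ln (point_prob M W v)"])
  ultimately show ?thesis
    using expectation_simple(1)[OF V I, of "\<lambda>v. ln (point_prob M V v)"]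
      expectation_simple(1)[OF W J, of "\<lambda>v. ln (point_prob M W v)"]
    by (simp add: rv_entropy_eq_sum[OF I] rv_entropy_eq_sum[OF J] rv_entropy_eq_sum[OF IJ])
qed

end

section \<open>Truncated sieves and their densities\<close>

lemma sum_lessThan_add:
  fixes f :: "nat \<Rightarrow> 'a :: comm_monoid_add"
  shows "(\<Sum>j<m + n. f j) = (\<Sum>j<m. f j) + (\<Sum>j<n. f (m + j))"
  by (induction n) (auto simp: add.assoc)

lemma periodic_sum_shift:
  fixes f :: "int \<Rightarrow> real"
  assumes per: "\<And>n. f (n + int L) = f n"
  shows "(\<Sum>j<L. f (a + int j)) = (\<Sum>j<L. f (int j))"
proof -
  have step: "(\<Sum>j<L. f (a + 1 + int j)) = (\<Sum>j<L. f (a + int j))" for a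
  proof -
    have "f a + (\<Sum>j<L. f (a + 1 + int j)) = (\<Sum>j<Suc L. f (a + int j))"
      by (subst sum.lessThan_Suc_shift) (simp add: add.assoc)
    also have "\<dots> = (\<Sum>j<L. f (a + int j)) + f a"
      using per[of a] by simp
    finally show ?thesis by simp
  qed
  show ?thesis
  proof (induction a rule: int_induct[of _ 0])
    case (step1 i)
    then show ?case using step[of i] by simp
  next
    case (step2 i)
    then show ?case using step[of "i - 1"] by simp
  qed simp
qed

lemma periodic_sum_mult:
  fixes f :: "int \<Rightarrow> real"
  assumes per: "\<And>n. f (n + int L) = f n"
  shows "(\<Sum>j<k * L. f (a + int j)) = real k * (\<Sum>j<L. f (int j))"
proof (induction k)
  case (Suc k)
  have "(\<Sum>j<Suc k * L. f (a + int j))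
      = (\<Sum>j<k * L. f (a + int j)) + (\<Sum>j<L. f (a + int (k * L) + int j))"
    using sum_lessThan_add[of "\<lambda>j. f (a + int j)" "k * L" L] by (simp add: ac_simps)
  also have "\<dots> = real (Suc k) * (\<Sum>j<L. f (int j))"
    using Suc periodic_sum_shift[where f = f and L = L and a = "a + int (k * L)", OF per] by (simp add: algebra_simps)
  finally show ?case .
qed simp

text \<open>
  Only the last, incomplete period contributes an error.
\<close>

lemma periodic_sum_bounds:
  fixes f :: "int \<Rightarrow> real"
  assumes per: "\<And>n. f (n + int L) = f n" and L: "L > 0"
    and f: "\<And>n. 0 \<le> f n" "\<And>n. f n \<le> 1"
  shows "\<bar>(\<Sum>j<N. f (a + int j)) - real N * ((\<Sum>j<L. f (int j)) / real L)\<bar> \<le> real L"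
proof -
  define q r where "q = N div L" and "r = N mod L"
  have N: "N = q * L + r" "r < L" using L by (auto simp: q_def r_def)
  define c where "c = (\<Sum>j<L. f (int j))"
  define R where "R = (\<Sum>j<r. f (a + int (q * L) + int j))"
  have R: "0 \<le> R" "R \<le> real r"
    unfolding R_def using f sum_bounded_above[of "{..<r}" "\<lambda>j. f (a + int (q * L) + int j)" 1]
    by (auto intro: sum_nonneg)
  have c: "0 \<le> c" "c \<le> real L"
    unfolding c_def using f sum_bounded_above[of "{..<L}" "\<lambda>j. f (int j)" 1]
    by (auto intro: sum_nonneg)
  have "(\<Sum>j<N. f (a + int j)) = real q * c + R"
    unfolding N(1) R_def c_def using periodic_sum_mult[where f = f and L = L and k = q and a = a, OF per]
    by (subst sum_lessThan_add) (simp add: ac_simps)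
  moreover have "real N * (c / real L) = real q * c + real r * (c / real L)"
    using L by (simp add: N(1) field_simps)
  moreover have "0 \<le> real r * (c / real L)" "real r * (c / real L) \<le> real r"
  proof -
    have "0 \<le> c / real L" "c / real L \<le> 1" using c L by auto
    then show "0 \<le> real r * (c / real L)" "real r * (c / real L) \<le> real r"
      by (blast intro: mult_nonneg_nonneg mult_left_le of_nat_0_le_iff)+
  qed
  ultimately show ?thesis using R N(2) unfolding c_def by linarith
qed

definition sieve :: "nat set \<Rightarrow> nat \<Rightarrow> int \<Rightarrow> bool" where
  "sieve B K n \<longleftrightarrow> (\<forall>b\<in>B. b \<le> K \<longrightarrow> \<not> int b dvd n)"

text \<open>
  The density of the \<open>n\<close> for which \<open>A + n\<close> avoids all multiples of the \<open>b \<in> B\<close> with \<open>b \<le> K\<close>,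
  taken over one period. Its limit as \<open>K\<close> grows is the probability of the pattern \<open>A\<close> under the
  Mirsky measure.
\<close>

definition sieve_density :: "nat set \<Rightarrow> nat \<Rightarrow> int set \<Rightarrow> real" where
  "sieve_density B K A = (\<Sum>r<fact K. of_bool (\<forall>i\<in>A. sieve B K (i + int r))) / fact K"

definition limit_density :: "nat set \<Rightarrow> int set \<Rightarrow> real" where
  "limit_density B A = lim (\<lambda>K. sieve_density B K A)"

lemma sieve_density_nonneg: "0 \<le> sieve_density B K A"
  by (auto simp: sieve_density_def intro!: divide_nonneg_pos sum_nonneg)

lemma eta_iff: "eta B n \<longleftrightarrow> (\<forall>b\<in>B. \<not> int b dvd n)"
  by (auto simp: eta_def B_free_def dvd_def)

lemma eta_imp_sieve: "eta B n \<Longrightarrow> sieve B K n"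
  by (auto simp: eta_iff sieve_def)

lemma sieve_antimono: "K \<le> K' \<Longrightarrow> sieve B K' n \<Longrightarrow> sieve B K n"
  by (auto simp: sieve_def)

text \<open>
  A divisor of a positive integer \<open>n\<close> is at most \<open>n\<close>, so the later elements of \<open>B\<close> do not
  matter for \<open>n \<le> K\<close>.
\<close>

lemma eta_iff_sieve:
  assumes "n > 0" "n \<le> int K"
  shows "eta B n \<longleftrightarrow> sieve B K n"
  using assms zdvd_imp_le[of _ n] by (fastforce simp: eta_iff sieve_def)

context
  fixes B :: "nat set"
  assumes B: "B \<subseteq> {1..}"
begin

lemma sieve_cong_mod:
  assumes "m mod fact K = n mod fact K"
  shows "sieve B K m \<longleftrightarrow> sieve B K n"
proof -
  have "int b dvd m \<longleftrightarrow> int b dvd n" if "b \<in> B" "b \<le> K" for b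
  proof -
    have "b dvd fact K" using that B by (intro dvd_fact) auto
    then have "int b dvd fact K" by (metis of_nat_dvd_iff of_nat_fact)
    then have "m mod int b = n mod int b" using assms by (metis mod_mod_cancel)
    then show ?thesis by (simp add: dvd_eq_mod_eq_0)
  qed
  then show ?thesis by (auto simp: sieve_def)
qed

lemma sieve_periodic: "sieve B K (n + int (fact K)) \<longleftrightarrow> sieve B K n"
  by (rule sieve_cong_mod) simp

lemma sieve_all_periodic:
  "(\<forall>i\<in>A. sieve B K (i + (n + int (fact K)))) \<longleftrightarrow> (\<forall>i\<in>A. sieve B K (i + n))"
  using sieve_periodic[of K "_ + n"] by (simp add: add.assoc)

lemma sieve_count:
  "\<bar>(\<Sum>j<N. of_bool (\<forall>i\<in>A. sieve B K (i + (a + int j)))) - real N * sieve_density B K A\<bar> \<le> fact K"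
  using periodic_sum_bounds[where f = "\<lambda>n. of_bool (\<forall>i\<in>A. sieve B K (i + n))" and L = "fact K" and N = N and a = a]
    sieve_all_periodic[of A K]
  by (simp add: sieve_density_def)

lemma sieve_density_eq:
  assumes "fact K dvd L" "L > 0"
  shows "sieve_density B K A = (\<Sum>j<L. of_bool (\<forall>i\<in>A. sieve B K (i + (a + int j)))) / real L"
proof -
  obtain m where m: "L = m * fact K" using assms(1) by (metis dvd_def mult.commute)
  have "(\<Sum>j<m * fact K. of_bool (\<forall>i\<in>A. sieve B K (i + (a + int j))))
      = real m * (\<Sum>j<fact K. of_bool (\<forall>i\<in>A. sieve B K (i + int j)))"
    using sieve_all_periodic[of A K]
    by (intro periodic_sum_mult[where f = "\<lambda>n. of_bool (\<forall>i\<in>A. sieve B K (i + n))"]) simp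
  then show ?thesis using assms(2) by (simp add: m sieve_density_def)
qed

text \<open>
  Over the common period \<open>(K+1)!\<close> the sieve at level \<open>K + 1\<close> keeps fewer elements.
\<close>

lemma sieve_density_decseq: "decseq (\<lambda>K. sieve_density B K A)"
proof (rule decseq_SucI)
  fix K
  have "sieve_density B (Suc K) A \<le> (\<Sum>j<fact (Suc K). of_bool (\<forall>i\<in>A. sieve B K (i + (0 + int j)))) / real (fact (Suc K))"
    unfolding sieve_density_def of_nat_fact using sieve_antimono[of K "Suc K" B]
    by (intro divide_right_mono sum_mono) auto
  also have "\<dots> = sieve_density B K A"
    by (rule sieve_density_eq[symmetric]) auto
  finally show "sieve_density B (Suc K) A \<le> sieve_density B K A" .
qed

lemma sieve_density_tendsto: "(\<lambda>K. sieve_density B K A) \<longlonglongrightarrow> limit_density B A"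
proof -
  have "convergent (\<lambda>K. sieve_density B K A)"
    using decseq_convergent[OF sieve_density_decseq, of 0] sieve_density_nonneg convergentI by metis
  then show ?thesis unfolding limit_density_def convergent_LIMSEQ_iff .
qed

lemma limit_density_le: "limit_density B A \<le> sieve_density B K A"
  by (rule decseq_ge[OF sieve_density_decseq sieve_density_tendsto])

lemma limit_density_nonneg: "0 \<le> limit_density B A"
  by (rule LIMSEQ_le_const[OF sieve_density_tendsto]) (auto simp: sieve_density_nonneg)

lemma sieve_density_translate:
  "sieve_density B K ((\<lambda>i. i + m) ` A) = sieve_density B K A"
  using sieve_density_eq[of K "fact K" "(\<lambda>i. i + m) ` A" 0] sieve_density_eq[of K "fact K" A m]
  by (simp add: add.assoc)

lemma limit_density_translate:
  "limit_density B ((\<lambda>i. i + m) ` A) = limit_density B A"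
  unfolding limit_density_def sieve_density_translate ..

end

section \<open>The Davenport--Erdos theorem\<close>

text \<open>
  Jordan's totient function with a real exponent; \<open>t = 1\<close> gives Euler's function.
\<close>

definition jordan :: "real \<Rightarrow> nat \<Rightarrow> real" where
  "jordan t n = real n powr t * (\<Prod>p\<in>prime_factors n. 1 - real p powr (- t))"

lemma jordan_nonneg:
  assumes "t \<ge> 0"
  shows "0 \<le> jordan t n"
proof -
  have "real p powr (- t) \<le> 1" if "p \<in> prime_factors n" for p
  proof -
    have "p \<ge> 1" using that by (intro prime_ge_1_nat in_prime_factors_imp_prime)
    then have "real p powr (- t) \<le> real p powr 0" using assms by (intro powr_mono) auto
    then show ?thesis using \<open>p \<ge> 1\<close> by simp
  qed
  then show ?thesis unfolding jordan_def by (intro mult_nonneg_nonneg prod_nonneg) auto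
qed

lemma jordan_prime_power_mult:
  assumes p: "prime p" and k: "k \<ge> 1" and e: "\<not> p dvd e"
  shows "jordan t (p ^ k * e) = real (p ^ k) powr t * (1 - real p powr (- t)) * jordan t e"
proof -
  have e0: "e \<noteq> 0" using e by (metis dvd_0_right)
  have "prime_factors (p ^ k * e) = insert p (prime_factors e)"
    using p k e0
    by (auto simp: prime_factors_dvd prime_dvd_mult_iff prime_dvd_power_iff intro: primes_dvd_imp_eq)
  moreover have "p \<notin> prime_factors e" using e by (auto simp: prime_factors_dvd)
  ultimately show ?thesis
    by (simp add: jordan_def powr_mult)
qed

lemma divisors_prime_power_mult:
  assumes p: "prime (p::nat)" and m: "\<not> p dvd m"
  shows "{d. d dvd p ^ Suc k * m} = {d. d dvd p ^ k * m} \<union> (\<lambda>e. p ^ Suc k * e) ` {e. e dvd m}"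
    and "{d. d dvd p ^ k * m} \<inter> (\<lambda>e. p ^ Suc k * e) ` {e. e dvd m} = {}"
proof -
  have p0: "p > 0" using p by (rule prime_gt_0_nat)
  show "{d. d dvd p ^ Suc k * m} = {d. d dvd p ^ k * m} \<union> (\<lambda>e. p ^ Suc k * e) ` {e. e dvd m}"
  proof (intro equalityI subsetI)
    fix d assume "d \<in> {d. d dvd p ^ Suc k * m}"
    then have d: "d dvd p ^ Suc k * m" by simp
    then obtain u v where uv: "d = u * v" "u dvd p ^ Suc k" "v dvd m"
      by (rule dvd_productE)
    obtain j where j: "j \<le> Suc k" "u = p ^ j"
      using uv(2) divides_primepow_nat[OF p] by blast
    show "d \<in> {d. d dvd p ^ k * m} \<union> (\<lambda>e. p ^ Suc k * e) ` {e. e dvd m}"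
    proof (cases "j = Suc k")
      case True
      then show ?thesis using uv j by auto
    next
      case False
      then have "p ^ j dvd p ^ k" using j by (intro le_imp_power_dvd) auto
      then show ?thesis using uv j by (auto intro: mult_dvd_mono)
    qed
  next
    fix d assume "d \<in> {d. d dvd p ^ k * m} \<union> (\<lambda>e. p ^ Suc k * e) ` {e. e dvd m}"
    moreover have "p ^ k * m dvd p ^ Suc k * m" by (simp add: mult.assoc)
    ultimately show "d \<in> {d. d dvd p ^ Suc k * m}"
      by (auto intro: dvd_trans)
  qed
  show "{d. d dvd p ^ k * m} \<inter> (\<lambda>e. p ^ Suc k * e) ` {e. e dvd m} = {}"
  proof -
    have False if "p ^ Suc k * e dvd p ^ k * m" for e
    proof -
      have "p ^ k * (p * e) dvd p ^ k * m" using that by (simp add: ac_simps)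
      then have "p * e dvd m" using p0 by simp
      then show False using m by (metis dvd_mult_left)
    qed
    then show ?thesis by blast
  qed
qed

text \<open>
  Remove one prime factor \<open>p\<close>. With \<open>n = p\<^sup>k\<^sup>+\<^sup>1 m\<close> and \<open>p\<close> not dividing \<open>m\<close>, the divisors of \<open>n\<close> that
  do not divide \<open>n / p\<close> are the \<open>p\<^sup>k\<^sup>+\<^sup>1 e\<close> with \<open>e\<close> dividing \<open>m\<close>, and multiplicativity of \<open>jordan\<close>
  reduces the sum over them to the sum for \<open>m\<close>.
\<close>

lemma jordan_divisor_sum:
  assumes "n > 0"
  shows "(\<Sum>d | d dvd n. jordan t d) = real n powr t"
  using assms
proof (induction n rule: less_induct)
  case (less n)
  show ?case
  proof (cases "n = 1")
    case True
    then show ?thesis by (simp add: jordan_def)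
  next
    case False
    then obtain p where p: "prime p" "p dvd n" using prime_factor_nat by blast
    have p1: "p > 1" using p(1) by (rule prime_gt_1_nat)
    obtain m where m: "n = p ^ multiplicity p n * m" "\<not> p dvd m"
      using less.prems p(1) multiplicity_decompose'[of n p] by (metis not_gr_zero not_prime_unit)
    define k where "k = multiplicity p n - 1"
    have "multiplicity p n > 0"
      using p less.prems by (simp add: prime_multiplicity_gt_zero_iff)
    then have n: "n = p ^ Suc k * m" using m by (simp add: k_def)
    have m0: "m > 0" using n less.prems by (cases m) auto
    have lt: "p ^ k * m < n" "m < n"
    proof -
      show 1: "p ^ k * m < n" using n p1 m0 by simp
      have "m \<le> p ^ k * m" using p1 by simp
      then show "m < n" using 1 by linarith
    qed
    have e: "\<not> p dvd e" if "e dvd m" for e using that m(2) by (metis dvd_trans)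
    have "(\<Sum>d | d dvd n. jordan t d)
        = (\<Sum>d | d dvd p ^ k * m. jordan t d) + (\<Sum>d\<in>(\<lambda>e. p ^ Suc k * e) ` {e. e dvd m}. jordan t d)"
      unfolding n divisors_prime_power_mult(1)[OF p(1) m(2)]
      using divisors_prime_power_mult(2)[OF p(1) m(2), of k] m0 p1
      by (intro sum.union_disjoint) (auto intro!: finite_divisors_nat)
    also have "(\<Sum>d\<in>(\<lambda>e. p ^ Suc k * e) ` {e. e dvd m}. jordan t d)
        = (\<Sum>e | e dvd m. jordan t (p ^ Suc k * e))"
      using p1 by (intro sum.reindex_cong[of "\<lambda>e. p ^ Suc k * e"]) (auto simp: inj_on_def)
    also have "\<dots> = (\<Sum>e | e dvd m. real (p ^ Suc k) powr t * (1 - real p powr (- t)) * jordan t e)"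
      by (intro sum.cong refl jordan_prime_power_mult p(1)) (use e in auto)
    also have "\<dots> = real (p ^ Suc k) powr t * (1 - real p powr (- t)) * real m powr t"
      using less.IH[OF lt(2) m0] by (simp flip: sum_distrib_left)
    also have "(\<Sum>d | d dvd p ^ k * m. jordan t d) = real (p ^ k * m) powr t"
      using less.IH[OF lt(1)] m0 p1 by simp
    also have "real (p ^ k * m) powr t + real (p ^ Suc k) powr t * (1 - real p powr (- t)) * real m powr t
        = real n powr t"
    proof -
      have 1: "real p powr t * real p powr (- t) = 1" using p1 by (simp flip: powr_add)
      have 2: "real (p ^ Suc k) powr t = real p powr t * real (p ^ k) powr t"
        by (simp add: powr_mult)
      have "real (p ^ Suc k) powr t * (1 - real p powr (- t)) = real (p ^ Suc k) powr t - real (p ^ k) powr t"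
        unfolding 2 using 1 by (simp add: algebra_simps)
      then show ?thesis unfolding n of_nat_mult by (simp add: powr_mult algebra_simps)
    qed
    finally show ?thesis .
  qed
qed

text \<open>
  By \<open>jordan_divisor_sum\<close>, \<open>1/n\<close> is the sum of \<open>a\<^sup>-\<^sup>s g(b)\<close> over all factorizations \<open>n = a b\<close>, with
  \<open>g(b) = b\<^sup>-\<^sup>s jordan (s - 1) b \<ge> 0\<close>. If \<open>P\<close> holds at \<open>a b\<close>, then it holds at \<open>a\<close>; therefore \<open>P\<close> has
  a larger share of the weights \<open>a\<^sup>-\<^sup>s\<close> than of the weights \<open>1/n\<close>. Both the sum over \<open>n\<close> and the
  sum of the \<open>a\<^sup>-\<^sup>s\<close> are compared with the sum \<open>G\<close> of the \<open>g(b)\<close>, which then cancels.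
\<close>

lemma divisor_closed_log_sum_le:
  fixes P :: "nat \<Rightarrow> bool" and s :: real
  assumes s: "s > 1" and P: "\<And>a b. P (a * b) \<Longrightarrow> P a"
  shows "(\<Sum>n=1..x. of_bool (P n) / real n) * (\<Sum>a=1..y. real a powr - s)
    \<le> (\<Sum>a=1..x. of_bool (P a) * real a powr - s) * (\<Sum>n=1..x * y. 1 / real n)"
proof -
  define J where "J = jordan (s - 1)"
  have J: "0 \<le> J b" for b unfolding J_def using s by (intro jordan_nonneg) auto
  have J_sum: "(\<Sum>b | b dvd n. J b * real n powr - s) = 1 / real n" if "n \<ge> 1" for n
  proof -
    have "(\<Sum>b | b dvd n. J b * real n powr - s) = real n powr (s - 1) * real n powr - s"
      using jordan_divisor_sum[of n "s - 1"] that by (simp add: J_def flip: sum_distrib_right)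
    also have "\<dots> = real n powr - 1" by (simp flip: powr_add)
    also have "\<dots> = 1 / real n" using that by (simp add: powr_neg_one)
    finally show ?thesis .
  qed
  define G where "G = (\<Sum>b=1..x. J b * real b powr - s)"
  have G: "0 \<le> G" unfolding G_def using J by (intro sum_nonneg) auto
  let ?Z = "\<Sum>a=1..x. of_bool (P a) * real a powr - s"
  have Z: "0 \<le> ?Z" by (intro sum_nonneg) auto
  have fin: "finite (Sigma {1..z} (\<lambda>n. {b. b dvd n}))" for z :: nat
    by (intro finite_SigmaI) (auto intro!: finite_divisors_nat)
  have "(\<Sum>n=1..x. of_bool (P n) / real n)
      = (\<Sum>n=1..x. \<Sum>b | b dvd n. of_bool (P n) * (J b * real n powr - s))"
    using J_sum by (intro sum.cong refl) (simp flip: sum_distrib_left)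
  also have "\<dots> = (\<Sum>(n, b)\<in>Sigma {1..x} (\<lambda>n. {b. b dvd n}). of_bool (P n) * (J b * real n powr - s))"
    by (subst sum.Sigma) (auto intro!: finite_divisors_nat)
  also have "\<dots> \<le> (\<Sum>(a, b)\<in>{1..x} \<times> {1..x}. (of_bool (P a) * real a powr - s) * (J b * real b powr - s))"
  proof (rule sum_le_included[where i = "\<lambda>(a, b). (a * b, b)"])
    show "\<forall>z\<in>Sigma {1..x} (\<lambda>n. {b. b dvd n}). \<exists>w\<in>{1..x} \<times> {1..x}. (case w of (a, b) \<Rightarrow> (a * b, b)) = z \<and>
        (case z of (n, b) \<Rightarrow> of_bool (P n) * (J b * real n powr - s))
        \<le> (case w of (a, b) \<Rightarrow> (of_bool (P a) * real a powr - s) * (J b * real b powr - s))"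
    proof
      fix z assume "z \<in> Sigma {1..x} (\<lambda>n. {b. b dvd n})"
      then obtain n b where z: "z = (n, b)" and n: "n \<in> {1..x}" and "b dvd n" by auto
      then obtain a where a: "n = a * b" by (metis dvd_def mult.commute)
      have ab: "a \<ge> 1" "b \<ge> 1" using a n by (auto simp: Suc_le_eq intro!: Nat.gr0I)
      have le: "a \<le> x" "b \<le> x"
        using ab a n by (auto intro: order.trans[of a "a * b"] order.trans[of b "a * b"])
      have "real n powr - s = real a powr - s * real b powr - s" by (simp add: a powr_mult)
      moreover have "P n \<Longrightarrow> P a" using P a by simp
      ultimately have "of_bool (P n) * (J b * real n powr - s)
          \<le> (of_bool (P a) * real a powr - s) * (J b * real b powr - s)"
        using J[of b] by (auto simp: mult.assoc mult.left_commute)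
      then show "\<exists>w\<in>{1..x} \<times> {1..x}. (case w of (a, b) \<Rightarrow> (a * b, b)) = z \<and>
        (case z of (n, b) \<Rightarrow> of_bool (P n) * (J b * real n powr - s))
        \<le> (case w of (a, b) \<Rightarrow> (of_bool (P a) * real a powr - s) * (J b * real b powr - s))"
        using ab le a z by (intro bexI[of _ "(a, b)"]) auto
    qed
  qed (use fin J in auto)
  also have "\<dots> = ?Z * G"
    by (simp only: G_def sum_product sum.cartesian_product)
  finally have 1: "(\<Sum>n=1..x. of_bool (P n) / real n) \<le> ?Z * G" .
  have "G * (\<Sum>a=1..y. real a powr - s)
      = (\<Sum>(b, a)\<in>{1..x} \<times> {1..y}. (J b * real b powr - s) * real a powr - s)"
    unfolding G_def by (simp add: sum_product sum.cartesian_product)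
  also have "\<dots> \<le> (\<Sum>(n, b)\<in>Sigma {1..x * y} (\<lambda>n. {b. b dvd n}). J b * real n powr - s)"
  proof (rule sum_le_included[where i = "\<lambda>(n, b). (b, n div b)"])
    show "\<forall>w\<in>{1..x} \<times> {1..y}. \<exists>z\<in>Sigma {1..x * y} (\<lambda>n. {b. b dvd n}). (case z of (n, b) \<Rightarrow> (b, n div b)) = w \<and>
        (case w of (b, a) \<Rightarrow> (J b * real b powr - s) * real a powr - s)
        \<le> (case z of (n, b) \<Rightarrow> J b * real n powr - s)"
    proof
      fix w assume "w \<in> {1..x} \<times> {1..y}"
      then obtain b a where w: "w = (b, a)" and ab: "b \<in> {1..x}" "a \<in> {1..y}" by auto
      have "b * a \<in> {1..x * y}" using ab by (auto intro: mult_le_mono)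
      moreover have "real (b * a) powr - s = real a powr - s * real b powr - s" by (simp add: powr_mult)
      ultimately show "\<exists>z\<in>Sigma {1..x * y} (\<lambda>n. {b. b dvd n}). (case z of (n, b) \<Rightarrow> (b, n div b)) = w \<and>
        (case w of (b, a) \<Rightarrow> (J b * real b powr - s) * real a powr - s)
        \<le> (case z of (n, b) \<Rightarrow> J b * real n powr - s)"
        using ab w by (intro bexI[of _ "(b * a, b)"]) auto
    qed
  qed (use fin J in auto)
  also have "\<dots> = (\<Sum>n=1..x * y. \<Sum>b | b dvd n. J b * real n powr - s)"
    by (subst sum.Sigma) (auto intro!: finite_divisors_nat)
  also have "\<dots> = (\<Sum>n=1..x * y. 1 / real n)"
    using J_sum by (intro sum.cong) auto
  finally have 2: "G * (\<Sum>a=1..y. real a powr - s) \<le> (\<Sum>n=1..x * y. 1 / real n)" .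
  have "(\<Sum>n=1..x. of_bool (P n) / real n) * (\<Sum>a=1..y. real a powr - s)
      \<le> ?Z * G * (\<Sum>a=1..y. real a powr - s)"
    using 1 by (intro mult_right_mono sum_nonneg) auto
  also have "\<dots> \<le> ?Z * (\<Sum>n=1..x * y. 1 / real n)"
    using 2 Z by (simp add: mult.assoc mult_left_mono)
  finally show ?thesis .
qed


lemma harmonic_unbounded: "\<exists>x\<ge>1. C < (\<Sum>n=1..x. 1 / real n)"
proof (rule ccontr)
  assume "\<not> ?thesis"
  then have le: "(\<Sum>n=1..x. 1 / real n) \<le> max C 0" for x
    by (cases "x \<ge> 1") (auto simp: not_less max.coboundedI1)
  have "(\<Sum>n<x. 1 / real (Suc n)) \<le> max C 0" for x
    using le[of x] by (simp add: sum.atLeast1_atMost_eq)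
  then have "summable (\<lambda>n. 1 / real (Suc n))"
    by (intro summableI_nonneg_bounded) auto
  then have "summable (\<lambda>n. inverse (of_nat (Suc n)) :: real)"
    by (simp add: inverse_eq_divide)
  then show False
    using not_summable_harmonic[where 'a = real] summable_Suc_iff[of "\<lambda>n. inverse (of_nat n) :: real"] by simp
qed

text \<open>
  Enlarging the range of a harmonic sum by a constant factor adds a bounded amount, which is
  negligible against the divergent sum.
\<close>

lemma harmonic_mult_le: "c \<ge> 1 \<Longrightarrow> x \<ge> 1 \<Longrightarrow> (\<Sum>n=1..x * c. 1 / real n) \<le> (\<Sum>n=1..x. 1 / real n) + real c"
proof -
  assume c: "c \<ge> 1" and x: "x \<ge> (1::nat)"
  have "{1..z} = {1..x} \<union> {x<..z}" if "x \<le> z" for z using that by auto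
  from this[of "x * c"] have "{1..x * c} = {1..x} \<union> {x<..x * c}" using c by simp
  then have "(\<Sum>n=1..x * c. 1 / real n) = (\<Sum>n=1..x. 1 / real n) + (\<Sum>n\<in>{x<..x * c}. 1 / real n)"
    by (simp only:) (intro sum.union_disjoint; auto)
  also have "(\<Sum>n\<in>{x<..x * c}. 1 / real n) \<le> (\<Sum>n\<in>{x<..x * c}. 1 / real x)"
    using x by (intro sum_mono divide_left_mono) auto
  also have "\<dots> = real (x * c - x) / real x" by simp
  also have "\<dots> \<le> real c"
    using x by (simp add: divide_le_eq mult.commute flip: of_nat_mult)
  finally show ?thesis by simp
qed

lemma powr_summable:
  assumes "s > 1"
  shows "summable (\<lambda>n. real n powr - s)"
  using assms by (simp add: summable_real_powr_iff)

lemma sum_le_suminf_powr: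
  assumes s: "s > 1"
  shows "summable (\<lambda>n. of_bool (P n) * real n powr - s)"
    and "(\<Sum>n=1..x. of_bool (P n) * real n powr - s) \<le> (\<Sum>n. of_bool (P n) * real n powr - s)"
proof -
  show *: "summable (\<lambda>n. of_bool (P n) * real n powr - s)"
    by (rule summable_comparison_test'[OF powr_summable[OF s], of 0]) auto
  then show "(\<Sum>n=1..x. of_bool (P n) * real n powr - s) \<le> (\<Sum>n. of_bool (P n) * real n powr - s)"
    by (intro sum_le_suminf) auto
qed

text \<open>
  Summation by parts.
\<close>

lemma abel_sum_le:
  fixes a w :: "nat \<Rightarrow> real"
  assumes S: "\<And>N. (\<Sum>n=1..N. a n) \<le> C" and C: "0 \<le> C"
    and w: "\<And>n. n \<ge> 1 \<Longrightarrow> w (Suc n) \<le> w n" "\<And>n. 0 \<le> w n" and w1: "w 1 \<le> 1"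
  shows "(\<Sum>n=1..N. a n * w n) \<le> C"
proof (cases "N = 0")
  case False
  then have N: "N \<ge> 1" by simp
  have "(\<Sum>n=1..N. a n * w n) \<le> C * (w 1 - w N) + (\<Sum>n=1..N. a n) * w N"
    using N
  proof (induction N rule: nat_induct_at_least)
    case (Suc N)
    have "(\<Sum>n=1..N. a n) * (w N - w (Suc N)) \<le> C * (w N - w (Suc N))"
      using S[of N] w(1)[OF Suc(1)] by (intro mult_right_mono) auto
    with Suc show ?case by (simp add: algebra_simps)
  qed simp
  also have "\<dots> \<le> C * (w 1 - w N) + C * w N"
    using S[of N] w(2)[of N] by (intro add_left_mono mult_right_mono) auto
  also have "\<dots> = C * w 1" by (simp add: algebra_simps)
  also have "\<dots> \<le> C" using C w1 by (rule mult_left_le[rotated])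
  finally show ?thesis .
qed (use C in simp)

context
  fixes B :: "nat set"
  assumes B: "B \<subseteq> {1..}"
begin

text \<open>
  In each period, \<open>1/n\<close> is at least the reciprocal of the last element of the period.
\<close>

lemma sieve_log_sum_ge:
  "sieve_density B K {0} * (\<Sum>n=1..x. 1 / real n) \<le> (\<Sum>n=1..x * fact K. of_bool (sieve B K (int n)) / real n)"
proof -
  define L :: nat where "L = fact K"
  have L: "L > 0" by (simp add: L_def)
  define c where "c = sieve_density B K {0} * real L"
  have c: "(\<Sum>j<L. of_bool (sieve B K (a + int j))) = c" for a
    using sieve_density_eq[OF B, of K L "{0}" a] L by (simp add: L_def c_def)
  have "sieve_density B K {0} * (\<Sum>n<x. 1 / real (Suc n))
      \<le> (\<Sum>n<x * L. of_bool (sieve B K (int (Suc n))) / real (Suc n))"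
  proof (induction x)
    case (Suc x)
    have "sieve_density B K {0} * (1 / real (Suc x)) = c / real (Suc x * L)"
      using L unfolding c_def of_nat_mult by simp
    also have "\<dots> = (\<Sum>j<L. of_bool (sieve B K (1 + int (x * L) + int j)) / real (Suc x * L))"
      by (simp only: c flip: sum_divide_distrib)
    also have "\<dots> \<le> (\<Sum>j<L. of_bool (sieve B K (int (Suc (x * L + j)))) / real (Suc (x * L + j)))"
    proof (rule sum_mono)
      fix j assume "j \<in> {..<L}"
      then have "Suc (x * L + j) \<le> Suc x * L" by simp
      then have "real (Suc (x * L + j)) \<le> real (Suc x * L)" by (rule of_nat_mono)
      moreover have eq: "1 + int (x * L) + int j = int (Suc (x * L + j))" by simp
      moreover have "0 < real (Suc (x * L + j))" by (simp only: of_nat_0_less_iff)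
      ultimately show "of_bool (sieve B K (1 + int (x * L) + int j)) / real (Suc x * L)
          \<le> of_bool (sieve B K (int (Suc (x * L + j)))) / real (Suc (x * L + j))"
        unfolding eq by (intro frac_le) auto
    qed
    finally have "sieve_density B K {0} * (\<Sum>n<Suc x. 1 / real (Suc n))
      \<le> (\<Sum>n<x * L. of_bool (sieve B K (int (Suc n))) / real (Suc n))
         + (\<Sum>j<L. of_bool (sieve B K (int (Suc (x * L + j)))) / real (Suc (x * L + j)))"
      using Suc by (simp add: algebra_simps)
    also have "\<dots> = (\<Sum>n<x * L + L. of_bool (sieve B K (int (Suc n))) / real (Suc n))"
      by (rule sum_lessThan_add[symmetric])
    finally show ?case by (simp add: add.commute)
  qed simp
  then show ?thesis unfolding L_def sum.atLeast1_atMost_eq One_nat_def .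
qed

text \<open>
  Divide the inequality \<open>divisor_closed_log_sum_le\<close> by the harmonic sum and let it diverge.
\<close>

lemma sieve_density_zeta_le:
  assumes s: "s > 1"
  shows "sieve_density B K {0} * (\<Sum>a=1..y. real a powr - s)
    \<le> (\<Sum>n. of_bool (sieve B K (int n)) * real n powr - s)" (is "?d * ?z \<le> ?Z")
proof (rule ccontr)
  assume "\<not> ?thesis"
  then have gap: "0 < ?d * ?z - ?Z" by simp
  have z: "0 \<le> ?z" by (intro sum_nonneg) auto
  have y: "y \<ge> 1"
  proof (rule ccontr)
    assume "\<not> y \<ge> 1"
    then have "y = 0" by simp
    then have "?Z < 0" using gap by simp
    moreover have "0 \<le> ?Z" by (intro suminf_nonneg sum_le_suminf_powr(1)[OF s]) auto
    ultimately show False by simp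
  qed
  define c :: nat where "c = fact K * y"
  have c: "c \<ge> 1" using y by (simp add: c_def Suc_le_eq)
  have Z: "0 \<le> ?Z" by (intro suminf_nonneg sum_le_suminf_powr(1)[OF s]) auto
  obtain x where x: "x \<ge> 1" "?Z * real c / (?d * ?z - ?Z) < (\<Sum>n=1..x. 1 / real n)"
    using harmonic_unbounded by blast
  let ?H = "\<Sum>n=1..x. 1 / real n"
  have "?d * ?H * ?z \<le> (\<Sum>n=1..x * fact K. of_bool (sieve B K (int n)) / real n) * ?z"
    by (intro mult_right_mono sieve_log_sum_ge z)
  also have "\<dots> \<le> (\<Sum>a=1..x * fact K. of_bool (sieve B K (int a)) * real a powr - s) * (\<Sum>n=1..x * fact K * y. 1 / real n)"
    by (rule divisor_closed_log_sum_le[OF s]) (auto simp: sieve_def)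
  also have "\<dots> \<le> ?Z * (\<Sum>n=1..x * fact K * y. 1 / real n)"
    by (intro mult_right_mono sum_le_suminf_powr(2)[OF s] sum_nonneg) auto
  also have "\<dots> \<le> ?Z * (?H + real c)"
    using harmonic_mult_le[OF c x(1)] Z by (intro mult_left_mono) (auto simp: c_def mult.assoc)
  finally have "(?d * ?z - ?Z) * ?H \<le> ?Z * real c" by (simp add: algebra_simps)
  moreover have "?Z * real c < (?d * ?z - ?Z) * ?H"
    using x(2) gap by (simp add: divide_less_eq mult.commute)
  ultimately show False by simp
qed

text \<open>
  The constant \<open>limit_density B {0}\<close> bounds the share of every truncated sieve, and up to \<open>K\<close> the
  \<open>B\<close>-free numbers are those of the sieve at level \<open>K\<close>. Hence the two sums differ by at most the
  tail of the zeta series.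
\<close>

lemma limit_density_zeta_le:
  assumes s: "s > 1"
  shows "limit_density B {0} * (\<Sum>a=1..y. real a powr - s)
    \<le> (\<Sum>n. of_bool (eta B (int n)) * real n powr - s)" (is "?d * ?z \<le> ?Z")
proof -
  define T where "T = (\<lambda>K. (\<Sum>n. real n powr - s) - (\<Sum>n\<le>K. real n powr - s))"
  have z: "0 \<le> ?z" by (intro sum_nonneg) auto
  have le: "?d * ?z \<le> ?Z + T K" for K
  proof -
    have "?d * ?z \<le> sieve_density B K {0} * ?z"
      using limit_density_le[OF B] z by (rule mult_right_mono)
    also have "\<dots> \<le> (\<Sum>n. of_bool (sieve B K (int n)) * real n powr - s)"
      by (rule sieve_density_zeta_le[OF s])
    also have "\<dots> \<le> (\<Sum>n. of_bool (eta B (int n)) * real n powr - s + of_bool (\<not> n \<le> K) * real n powr - s)"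
    proof (intro suminf_le summable_add sum_le_suminf_powr(1)[OF s])
      fix n
      show "of_bool (sieve B K (int n)) * real n powr - s
          \<le> of_bool (eta B (int n)) * real n powr - s + of_bool (\<not> n \<le> K) * real n powr - s"
        using eta_iff_sieve[of "int n" K B] by (cases "n = 0") auto
    qed
    also have "\<dots> = ?Z + (\<Sum>n. of_bool (\<not> n \<le> K) * real n powr - s)"
      by (intro suminf_add[symmetric] sum_le_suminf_powr(1)[OF s])
    also have "(\<Sum>n. of_bool (\<not> n \<le> K) * real n powr - s)
        = (\<Sum>n. real n powr - s - of_bool (n \<le> K) * real n powr - s)"
      by (intro suminf_cong) auto
    also have "\<dots> = (\<Sum>n. real n powr - s) - (\<Sum>n. of_bool (n \<le> K) * real n powr - s)"
      by (intro suminf_diff[symmetric] sum_le_suminf_powr(1)[OF s] powr_summable s)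
    also have "(\<Sum>n. of_bool (n \<le> K) * real n powr - s) = (\<Sum>n\<le>K. of_bool (n \<le> K) * real n powr - s)"
      by (intro suminf_finite) auto
    also have "\<dots> = (\<Sum>n\<le>K. real n powr - s)" by (intro sum.cong) auto
    finally show ?thesis by (simp add: T_def)
  qed
  have "(\<lambda>K. \<Sum>n\<le>K. real n powr - s) \<longlonglongrightarrow> (\<Sum>n. real n powr - s)"
    using powr_summable[OF s] by (rule summable_LIMSEQ')
  then have "(\<lambda>K. ?Z + T K) \<longlonglongrightarrow> ?Z + ((\<Sum>n. real n powr - s) - (\<Sum>n. real n powr - s))"
    unfolding T_def by (intro tendsto_intros)
  then show ?thesis
    using le by (intro LIMSEQ_le_const[of _ ?Z]) auto
qed

text \<open>
  If the counting function stayed below \<open>c N\<close> from \<open>N0\<close> on, then summation by parts would give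
  \<open>Z(s) \<le> N0 + c \<cdot> \<zeta>(s)\<close>, where \<open>Z(s)\<close> is the sum of \<open>n\<^sup>-\<^sup>s\<close> over the \<open>B\<close>-free numbers. Since
  \<open>Z(s) \<ge> d \<cdot> \<zeta>(s)\<close> with \<open>d > c\<close>, this is impossible: \<open>\<zeta>(s)\<close> is unbounded as \<open>s\<close> decreases to \<open>1\<close>.
\<close>

theorem davenport_erdos:
  assumes c: "c < limit_density B {0}"
  shows "\<exists>N\<ge>N0. c * real N \<le> (\<Sum>n=1..N. of_bool (eta B (int n)))"
proof (rule ccontr)
  assume contra: "\<not> ?thesis"
  let ?d = "limit_density B {0}"
  \<comment> \<open>Summation by parts needs a non-negative constant; a negative \<open>c\<close> is dealt with at the end.\<close>
  define c' where "c' = max c 0"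
  have N: "(\<Sum>n=1..N. of_bool (eta B (int n))) \<le> c' * real N" if "N \<ge> N0" for N
  proof -
    have "(\<Sum>n=1..N. of_bool (eta B (int n))) < c * real N" using contra that by force
    also have "\<dots> \<le> c' * real N" unfolding c'_def by (intro mult_right_mono) auto
    finally show ?thesis by simp
  qed
  have le_N: "(\<Sum>n=1..N. of_bool (eta B (int n))) \<le> real N" for N
    using sum_bounded_above[of "{1..N}" "\<lambda>n. of_bool (eta B (int n))" "1::real"] by auto
  have S: "(\<Sum>n=1..N. of_bool (eta B (int n)) - c') \<le> real N0" for N
  proof -
    have "(\<Sum>n=1..N. of_bool (eta B (int n)) - c') = (\<Sum>n=1..N. of_bool (eta B (int n))) - c' * real N"
      by (simp only: sum_subtractf) simp
    moreover have "0 \<le> c' * real N" by (simp add: c'_def)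
    ultimately show ?thesis using N[of N] le_N[of N] by (cases "N \<ge> N0") auto
  qed
  have partial: "(?d - c') * (\<Sum>n=1..y. real n powr - s) \<le> real N0" if s: "s > 1" for s y
  proof -
    let ?\<zeta> = "\<Sum>n. real n powr - s" and ?Z = "\<Sum>n. of_bool (eta B (int n)) * real n powr - s"
    have "(\<Sum>n<Y. of_bool (eta B (int n)) * real n powr - s) \<le> real N0 + c' * ?\<zeta>" for Y
    proof -
      have "(\<Sum>n=1..Y. (of_bool (eta B (int n)) - c') * real n powr - s) \<le> real N0"
        using S s by (intro abel_sum_le) (auto intro!: powr_mono2')
      then have "(\<Sum>n=1..Y. of_bool (eta B (int n)) * real n powr - s)
          \<le> real N0 + c' * (\<Sum>n=1..Y. real n powr - s)"
        by (simp add: left_diff_distrib sum_subtractf sum_distrib_left)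
      also have "\<dots> \<le> real N0 + c' * ?\<zeta>"
        using sum_le_suminf[OF powr_summable[OF s], of "{1..Y}"]
        by (intro add_left_mono mult_left_mono) (auto simp: c'_def)
      finally have "(\<Sum>n=1..Y. of_bool (eta B (int n)) * real n powr - s) \<le> real N0 + c' * ?\<zeta>" .
      moreover have "(\<Sum>n<Y. of_bool (eta B (int n)) * real n powr - s)
          \<le> (\<Sum>n=0..Y. of_bool (eta B (int n)) * real n powr - s)"
        by (intro sum_mono2) auto
      moreover have "(\<Sum>n=0..Y. of_bool (eta B (int n)) * real n powr - s)
          = (\<Sum>n=1..Y. of_bool (eta B (int n)) * real n powr - s)"
        by (subst sum.atLeast_Suc_atMost) auto
      ultimately show ?thesis by linarith
    qed
    then have Z: "?Z \<le> real N0 + c' * ?\<zeta>"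
      by (intro suminf_le_const sum_le_suminf_powr(1)[OF s])
    have "?d * (\<Sum>n=1..y. real n powr - s) \<le> ?Z" for y
      by (rule limit_density_zeta_le[OF s])
    have "?d * ?\<zeta> \<le> ?Z"
    proof (rule LIMSEQ_le_const2)
      show "(\<lambda>y. ?d * (\<Sum>n\<le>y. real n powr - s)) \<longlonglongrightarrow> ?d * ?\<zeta>"
        by (intro tendsto_intros summable_LIMSEQ' powr_summable s)
      have "(\<Sum>n\<le>y. real n powr - s) = (\<Sum>n=1..y. real n powr - s)" for y
        by (simp add: atMost_atLeast0 sum.atLeast_Suc_atMost)
      then show "\<exists>N. \<forall>n\<ge>N. ?d * (\<Sum>n\<le>n. real n powr - s) \<le> ?Z"
        using limit_density_zeta_le[OF s] by simp
    qed
    then have "(?d - c') * ?\<zeta> \<le> real N0" using Z by (simp add: algebra_simps)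
    moreover have "?d - c' \<ge> 0" using c limit_density_nonneg[OF B, of "{0}"] by (simp add: c'_def)
    moreover have "(\<Sum>n=1..y. real n powr - s) \<le> ?\<zeta>"
      using powr_summable[OF s] by (intro sum_le_suminf) auto
    ultimately show ?thesis using mult_left_mono[of _ ?\<zeta> "?d - c'"] by fastforce
  qed
  have harm: "(?d - c') * (\<Sum>n=1..y. 1 / real n) \<le> real N0" for y
  proof (rule LIMSEQ_le_const2)
    have "(\<lambda>m. real n powr - (1 + 1 / real (Suc m))) \<longlonglongrightarrow> real n powr - (1 + 0)" if "n \<in> {1..y}" for n
      by (intro tendsto_intros LIMSEQ_inverse_real_of_nat[unfolded inverse_eq_divide]) (use that in auto)
    then have "(\<lambda>m. real n powr - (1 + 1 / real (Suc m))) \<longlonglongrightarrow> 1 / real n" if "n \<in> {1..y}" for n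
      using that by (simp add: powr_neg_one)
    then show "(\<lambda>m. (?d - c') * (\<Sum>n=1..y. real n powr - (1 + 1 / real (Suc m))))
        \<longlonglongrightarrow> (?d - c') * (\<Sum>n=1..y. 1 / real n)"
      by (intro tendsto_intros)
    show "\<exists>N. \<forall>m\<ge>N. (?d - c') * (\<Sum>n=1..y. real n powr - (1 + 1 / real (Suc m))) \<le> real N0"
      by (intro exI allI impI partial) auto
  qed
  show False
  proof (cases "c \<ge> 0")
    case True
    then have pos: "?d - c' > 0" using c by (simp add: c'_def)
    obtain x where "real N0 / (?d - c') < (\<Sum>n=1..x. 1 / real n)"
      using harmonic_unbounded by blast
    then show False using harm[of x] pos by (simp add: divide_less_eq mult.commute)
  next
    case False
    then have "c * real N0 \<le> 0" by (simp add: mult_nonpos_nonneg)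
    also have "0 \<le> (\<Sum>n=1..N0. of_bool (eta B (int n)) :: real)" by (intro sum_nonneg) auto
    finally show False using contra by blast
  qed
qed

end

section \<open>Pattern counts in random subsets\<close>

lemma exp_le_quadratic:
  fixes v :: real
  assumes "\<bar>v\<bar> \<le> 1"
  shows "exp v \<le> 1 + v + v\<^sup>2"
proof (cases "v \<ge> 0")
  case True
  then show ?thesis using assms by (intro exp_bound) auto
next
  case False
  define u where "u = - v"
  have u: "0 \<le> u" "u \<le> 1" using False assms by (auto simp: u_def)
  have pos: "0 < 1 - u + u\<^sup>2" using u by (cases "u = 1") (auto intro: add_pos_nonneg)
  have "1 \<le> 1 + u\<^sup>2 / 2 + u ^ 3 / 2 + u ^ 4 / 2" using u by simp
  also have "\<dots> = (1 - u + u\<^sup>2) * (1 + u + u\<^sup>2 / 2)"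
    by (simp add: field_simps power2_eq_square power3_eq_cube power4_eq_xxxx)
  also have "\<dots> \<le> (1 - u + u\<^sup>2) * exp u"
    using exp_lower_Taylor_quadratic[OF u(1)] pos by (intro mult_left_mono) auto
  finally have "exp (- u) \<le> 1 - u + u\<^sup>2" by (simp add: exp_minus field_simps)
  then show ?thesis by (simp add: u_def)
qed

text \<open>
  The exponent has mean zero over \<open>Pow A\<close>, so only its square contributes.
\<close>

lemma block_mgf:
  fixes u :: real
  assumes A: "finite A" and u: "\<bar>u\<bar> \<le> 1"
  shows "(\<Sum>w\<in>Pow A. exp (u * (of_bool (A \<subseteq> w) - 1 / 2 ^ card A))) \<le> 2 ^ card A * exp (u\<^sup>2)"
proof -
  define v where "v = (\<lambda>w. u * (of_bool (A \<subseteq> w) - 1 / 2 ^ card A))"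
  have v: "\<bar>v w\<bar> \<le> \<bar>u\<bar>" for w
  proof -
    have "\<bar>of_bool (A \<subseteq> w) - 1 / 2 ^ card A :: real\<bar> \<le> 1" by auto
    then show ?thesis unfolding v_def abs_mult by (rule mult_left_le) simp
  qed
  have "(\<Sum>w\<in>Pow A. of_bool (A \<subseteq> w) :: real) = (\<Sum>w\<in>Pow A. if w = A then 1 else 0)"
    by (intro sum.cong) auto
  then have "sum v (Pow A) = 0"
    using A unfolding v_def by (simp add: sum_subtractf card_Pow flip: sum_distrib_left)
  have "(\<Sum>w\<in>Pow A. exp (v w)) \<le> (\<Sum>w\<in>Pow A. 1 + v w + u\<^sup>2)"
  proof (rule sum_mono)
    fix w
    have "(v w)\<^sup>2 \<le> u\<^sup>2" using v[of w] by (simp add: abs_le_square_iff)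
    then show "exp (v w) \<le> 1 + v w + u\<^sup>2"
      using exp_le_quadratic[of "v w"] v[of w] u by linarith
  qed
  also have "\<dots> = 2 ^ card A * (1 + u\<^sup>2)"
    using \<open>sum v (Pow A) = 0\<close> A by (simp add: sum.distrib card_Pow algebra_simps)
  also have "\<dots> \<le> 2 ^ card A * exp (u\<^sup>2)" by (intro mult_left_mono exp_ge_add_one_self) auto
  finally show ?thesis by (simp add: v_def)
qed

text \<open>
  In a uniformly random subset of \<open>E\<close> the traces on disjoint sets are independent, so the sum
  factorizes over the blocks inside \<open>E\<close>. A block that is not contained in \<open>E\<close> is not contained
  in any subset of \<open>E\<close> either and contributes the factor \<open>1\<close>.
\<close>

lemma disjoint_blocks_mgf:
  fixes u :: real
  assumes J: "finite J" and A: "\<And>j. j \<in> J \<Longrightarrow> finite (A j)" and disj: "disjoint_family_on A J"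
    and E: "finite E" and u: "\<bar>u\<bar> \<le> 1"
  shows "(\<Sum>w\<in>Pow E. exp (u * (\<Sum>j\<in>J. of_bool (A j \<subseteq> w) - of_bool (A j \<subseteq> E) / 2 ^ card (A j))))
    \<le> 2 ^ card E * exp (u\<^sup>2 * real (card J))"
  using J A disj E
proof (induction J arbitrary: E rule: finite_induct)
  case empty
  then show ?case by (simp add: card_Pow)
next
  case (insert j J)
  let ?f = "\<lambda>E w. (\<Sum>k\<in>J. of_bool (A k \<subseteq> w) - of_bool (A k \<subseteq> E) / 2 ^ card (A k)) :: real"
  let ?g = "\<lambda>E w. of_bool (A j \<subseteq> w) - of_bool (A j \<subseteq> E) / 2 ^ card (A j) :: real"
  have disj: "disjoint_family_on A J" "\<And>k. k \<in> J \<Longrightarrow> A k \<inter> A j = {}"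
    using insert.prems(2) insert.hyps(2) by (auto simp: disjoint_family_on_def)
  have IH: "(\<Sum>w\<in>Pow E. exp (u * ?f E w)) \<le> 2 ^ card E * exp (u\<^sup>2 * real (card J))" if "finite E" for E
    by (rule insert.IH) (use insert.prems disj that in auto)
  have split: "(\<Sum>k\<in>insert j J. of_bool (A k \<subseteq> w) - of_bool (A k \<subseteq> E) / 2 ^ card (A k)) = ?g E w + ?f E w" for w
    using insert.hyps by (rule sum.insert)
  show ?case
  proof (cases "A j \<subseteq> E")
    case False
    have "(\<Sum>w\<in>Pow E. exp (u * (?g E w + ?f E w))) = (\<Sum>w\<in>Pow E. exp (u * ?f E w))"
      using False by (intro sum.cong) (auto intro!: arg_cong[where f = exp])
    also have "\<dots> \<le> 2 ^ card E * exp (u\<^sup>2 * real (card J))" by (rule IH[OF insert.prems(3)])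
    also have "\<dots> \<le> 2 ^ card E * exp (u\<^sup>2 * real (card (insert j J)))"
      using insert.hyps by (intro mult_left_mono) (auto simp: algebra_simps)
    finally show ?thesis unfolding split .
  next
    case True
    define E' where "E' = E - A j"
    have E': "finite E'" "E = A j \<union> E'" "A j \<inter> E' = {}" "finite (A j)"
      using True insert.prems by (auto simp: E'_def)
    have inj: "inj_on (\<lambda>(w1, w2). w1 \<union> w2) (Pow (A j) \<times> Pow E')"
      unfolding inj_on_def using E'(3) by (auto; blast)
    have im: "Pow E = (\<lambda>(w1, w2). w1 \<union> w2) ` (Pow (A j) \<times> Pow E')"
    proof (intro equalityI subsetI)
      fix w assume "w \<in> Pow E"
      then show "w \<in> (\<lambda>(w1, w2). w1 \<union> w2) ` (Pow (A j) \<times> Pow E')"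
        unfolding E'(2) by (intro image_eqI[of _ _ "(w \<inter> A j, w \<inter> E')"]) auto
    qed (use E' in auto)
    have "(\<Sum>w\<in>Pow E. exp (u * (?g E w + ?f E w)))
        = (\<Sum>(w1, w2)\<in>Pow (A j) \<times> Pow E'. exp (u * (of_bool (A j \<subseteq> w1) - 1 / 2 ^ card (A j))) * exp (u * ?f E' w2))"
      unfolding im
    proof (rule sum.reindex_cong[OF inj refl], clarify)
      fix w1 w2 assume w: "w1 \<subseteq> A j" "w2 \<subseteq> E'"
      have "A j \<subseteq> w1 \<union> w2 \<longleftrightarrow> A j \<subseteq> w1" using w E'(3) by blast
      moreover have "A k \<subseteq> w1 \<union> w2 \<longleftrightarrow> A k \<subseteq> w2" "A k \<subseteq> E \<longleftrightarrow> A k \<subseteq> E'" if "k \<in> J" for k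
        using disj(2)[OF that] w E'(2) by blast+
      ultimately have "?g E (w1 \<union> w2) = of_bool (A j \<subseteq> w1) - 1 / 2 ^ card (A j)"
        "?f E (w1 \<union> w2) = ?f E' w2"
        using True by auto
      then show "exp (u * (?g E (w1 \<union> w2) + ?f E (w1 \<union> w2)))
        = exp (u * (of_bool (A j \<subseteq> w1) - 1 / 2 ^ card (A j))) * exp (u * ?f E' w2)"
        by (simp add: distrib_left exp_add)
    qed
    also have "\<dots> = (\<Sum>w\<in>Pow (A j). exp (u * (of_bool (A j \<subseteq> w) - 1 / 2 ^ card (A j))))
        * (\<Sum>w\<in>Pow E'. exp (u * ?f E' w))"
      by (simp only: sum_product sum.cartesian_product)
    also have "\<dots> \<le> (2 ^ card (A j) * exp (u\<^sup>2)) * (2 ^ card E' * exp (u\<^sup>2 * real (card J)))"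
      by (intro mult_mono block_mgf IH E' u sum_nonneg) auto
    also have "\<dots> = 2 ^ card E * exp (u\<^sup>2 * real (card (insert j J)))"
    proof -
      have "card E = card (A j) + card E'" unfolding E'(2) using E' by (intro card_Un_disjoint) auto
      then show ?thesis using insert.hyps by (simp add: power_add exp_add algebra_simps)
    qed
    finally show ?thesis unfolding split .
  qed
qed

abbreviation translate :: "int set \<Rightarrow> nat \<Rightarrow> int set" where
  "translate A j \<equiv> (\<lambda>i. i + int j) ` A"

text \<open>
  Translates of \<open>A\<close> by numbers in the same residue class modulo \<open>n\<close> are disjoint, since \<open>A\<close> has
  diameter less than \<open>n\<close>; so \<open>disjoint_blocks_mgf\<close> applies to each of the \<open>n\<close> classes. The classes
  depend on each other, but convexity of \<open>exp\<close> bounds the exponential of their sum by the average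
  of exponentials that involve a single class each, at the price of a factor \<open>n\<close> in the exponent.
  It is essential that the counts are centred: the averaged terms then obey one common bound,
  although the classes may meet \<open>E\<close> very differently.
\<close>

lemma pattern_count_mgf:
  fixes t :: real
  assumes A: "finite A" "\<And>i i'. i \<in> A \<Longrightarrow> i' \<in> A \<Longrightarrow> i' - i < int n" and n: "n > 0"
    and E: "finite E" and t: "\<bar>t\<bar> * real n \<le> 1"
  shows "(\<Sum>w\<in>Pow E. exp (t * (\<Sum>j<N. of_bool (translate A j \<subseteq> w) - of_bool (translate A j \<subseteq> E) / 2 ^ card A)))
    \<le> 2 ^ card E * exp ((t * real n)\<^sup>2 * real N)"
proof -
  define Z where "Z = (\<lambda>w j. of_bool (translate A j \<subseteq> w) - of_bool (translate A j \<subseteq> E) / 2 ^ card A :: real)"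
  define J where "J = (\<lambda>c. {j\<in>{..<N}. j mod n = c})"
  have fJ: "finite (J c)" for c by (simp add: J_def)
  have card: "card (translate A j) = card A" for j by (intro card_image) (auto simp: inj_on_def)
  have disj: "disjoint_family_on (translate A) (J c)" for c
    unfolding disjoint_family_on_def
  proof (intro ballI impI, rule ccontr)
    fix j k assume "j \<in> J c" "k \<in> J c" "j \<noteq> k" "translate A j \<inter> translate A k \<noteq> {}"
    then have jk: "j mod n = k mod n" "j \<noteq> k" "translate A j \<inter> translate A k \<noteq> {}"
      by (auto simp: J_def)
    then obtain i i' where ii: "i \<in> A" "i' \<in> A" "i + int j = i' + int k" by auto
    then have "\<bar>int j - int k\<bar> < int n" using A(2)[of i i'] A(2)[of i' i] by linarith
    moreover have "int n dvd int j - int k"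
      using jk(1) by (metis mod_eq_dvd_iff of_nat_mod)
    ultimately have "int j - int k = 0" by (metis dvd_imp_le_int leD abs_of_nat)
    then show False using jk(2) by simp
  qed
  have "(\<Sum>w\<in>Pow E. exp (t * (\<Sum>j<N. Z w j)))
      \<le> (\<Sum>w\<in>Pow E. \<Sum>c<n. (1 / real n) * exp (t * real n * (\<Sum>j\<in>J c. Z w j)))"
  proof (rule sum_mono)
    fix w
    have "(\<Sum>j<N. Z w j) = (\<Sum>c<n. \<Sum>j\<in>J c. Z w j)"
      unfolding J_def using n by (intro sum.group[symmetric]) auto
    then have "exp (t * (\<Sum>j<N. Z w j)) = exp (\<Sum>c<n. (1 / real n) *\<^sub>R (t * real n * (\<Sum>j\<in>J c. Z w j)))"
      using n by (simp add: sum_distrib_left)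
    also have "\<dots> \<le> (\<Sum>c<n. (1 / real n) * exp (t * real n * (\<Sum>j\<in>J c. Z w j)))"
      by (rule convex_on_sum[OF _ _ exp_convex]) (use n in auto)
    finally show "exp (t * (\<Sum>j<N. Z w j)) \<le> (\<Sum>c<n. (1 / real n) * exp (t * real n * (\<Sum>j\<in>J c. Z w j)))" .
  qed
  also have "\<dots> = (\<Sum>c<n. (1 / real n) * (\<Sum>w\<in>Pow E. exp (t * real n * (\<Sum>j\<in>J c. Z w j))))"
    by (subst sum.swap) (simp add: sum_distrib_left)
  also have "\<dots> \<le> (\<Sum>c<n. (1 / real n) * (2 ^ card E * exp ((t * real n)\<^sup>2 * real N)))"
  proof (intro sum_mono mult_left_mono)
    fix c
    have "(\<Sum>w\<in>Pow E. exp (t * real n * (\<Sum>j\<in>J c. Z w j))) \<le> 2 ^ card E * exp ((t * real n)\<^sup>2 * real (card (J c)))"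
      using disjoint_blocks_mgf[where u = "t * real n", OF fJ _ disj E] A t by (simp add: Z_def card abs_mult)
    also have "card (J c) \<le> card {..<N}" unfolding J_def by (intro card_mono) auto
    then have "(2 ^ card E :: real) * exp ((t * real n)\<^sup>2 * real (card (J c))) \<le> 2 ^ card E * exp ((t * real n)\<^sup>2 * real N)"
      by (intro mult_left_mono) (auto intro: mult_left_mono)
    finally show "(\<Sum>w\<in>Pow E. exp (t * real n * (\<Sum>j\<in>J c. Z w j))) \<le> 2 ^ card E * exp ((t * real n)\<^sup>2 * real N)" .
  qed auto
  also have "\<dots> = 2 ^ card E * exp ((t * real n)\<^sup>2 * real N)" using n by simp
  finally show ?thesis by (simp add: Z_def)
qed

section \<open>Itineraries and iterated joins\<close>

text \<open>
  Restricting to \<open>{..<n}\<close> keeps the range finite when \<open>l\<close> takes finitely many values.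
\<close>

definition itinerary :: "('a \<Rightarrow> 'a) \<Rightarrow> ('a \<Rightarrow> 'l) \<Rightarrow> nat \<Rightarrow> 'a \<Rightarrow> nat \<Rightarrow> 'l" where
  "itinerary T l n x = (\<lambda>i\<in>{..<n}. l ((T ^^ i) x))"

definition fibres :: "'a set \<Rightarrow> ('a \<Rightarrow> 'l) \<Rightarrow> 'a set set" where
  "fibres X l = (\<lambda>c. l -` {c} \<inter> X) ` l ` X"

lemma itinerary_eq_iff:
  "itinerary T l n x = itinerary T l n y \<longleftrightarrow> (\<forall>i<n. l ((T ^^ i) x) = l ((T ^^ i) y))"
  by (auto simp: itinerary_def restrict_def fun_eq_iff)

lemma iterated_join_eq:
  "iterated_join T X P n = {{x\<in>X. \<forall>i<n. (T ^^ i) x \<in> A i} | A. \<forall>i<n. A i \<in> P}"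
proof (induction n)
  case 0
  show ?case by auto
next
  case (Suc n)
  have "iterated_join T X P (Suc n)
      = {{x\<in>X. \<forall>i<n. (T ^^ i) x \<in> A i} \<inter> ((T ^^ n) -` C \<inter> X) | A C. (\<forall>i<n. A i \<in> P) \<and> C \<in> P}"
    unfolding iterated_join.simps Suc join_def pullback_def by blast
  also have "\<dots> = {{x\<in>X. \<forall>i<Suc n. (T ^^ i) x \<in> A i} | A. \<forall>i<Suc n. A i \<in> P}"
  proof (intro equalityI subsetI)
    fix S assume "S \<in> {{x\<in>X. \<forall>i<n. (T ^^ i) x \<in> A i} \<inter> ((T ^^ n) -` C \<inter> X) | A C. (\<forall>i<n. A i \<in> P) \<and> C \<in> P}"
    then obtain A C where S: "S = {x\<in>X. \<forall>i<n. (T ^^ i) x \<in> A i} \<inter> ((T ^^ n) -` C \<inter> X)"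
      and AC: "\<forall>i<n. A i \<in> P" "C \<in> P" by blast
    have "S = {x\<in>X. \<forall>i<Suc n. (T ^^ i) x \<in> (A(n := C)) i}"
      unfolding S by (auto simp: less_Suc_eq)
    moreover have "\<forall>i<Suc n. (A(n := C)) i \<in> P" using AC by (auto simp: less_Suc_eq)
    ultimately show "S \<in> {{x\<in>X. \<forall>i<Suc n. (T ^^ i) x \<in> A i} | A. \<forall>i<Suc n. A i \<in> P}"
      by (intro CollectI exI[of _ "A(n := C)"] conjI)
  next
    fix S assume "S \<in> {{x\<in>X. \<forall>i<Suc n. (T ^^ i) x \<in> A i} | A. \<forall>i<Suc n. A i \<in> P}"
    then obtain A where S: "S = {x\<in>X. \<forall>i<Suc n. (T ^^ i) x \<in> A i}" and A: "\<forall>i<Suc n. A i \<in> P" by blast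
    have "S = {x\<in>X. \<forall>i<n. (T ^^ i) x \<in> A i} \<inter> ((T ^^ n) -` A n \<inter> X)"
      unfolding S by (auto simp: less_Suc_eq)
    then show "S \<in> {{x\<in>X. \<forall>i<n. (T ^^ i) x \<in> A i} \<inter> ((T ^^ n) -` C \<inter> X) | A C. (\<forall>i<n. A i \<in> P) \<and> C \<in> P}"
      using A by (intro CollectI exI[of _ A] exI[of _ "A n"] conjI) auto
  qed
  finally show ?case .
qed

lemma funpow_in:
  assumes "\<And>x. x \<in> X \<Longrightarrow> T x \<in> X" "x \<in> X"
  shows "(T ^^ n) x \<in> X"
  using assms by (induction n) auto

text \<open>
  A non-empty set of the iterated join consists of the points whose labels agree with those of
  any one of its members for \<open>n\<close> steps.
\<close>

lemma iterated_join_fibres: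
  assumes T: "\<And>x. x \<in> X \<Longrightarrow> T x \<in> X"
  shows "iterated_join T X (fibres X l) n - {{}} = fibres X (itinerary T l n)"
proof (intro equalityI subsetI)
  fix S assume "S \<in> iterated_join T X (fibres X l) n - {{}}"
  then obtain A x where S: "S = {x\<in>X. \<forall>i<n. (T ^^ i) x \<in> A i}" and A: "\<forall>i<n. A i \<in> fibres X l" and x: "x \<in> S"
    unfolding iterated_join_eq by blast
  have mem: "y \<in> A i \<longleftrightarrow> l y = l ((T ^^ i) x)" if "i < n" "y \<in> X" for i y
    using A x that unfolding S fibres_def by fastforce
  have "S = itinerary T l n -` {itinerary T l n x} \<inter> X"
    unfolding S using mem funpow_in[where T=T and X=X, OF T] by (auto simp: itinerary_eq_iff)
  then show "S \<in> fibres X (itinerary T l n)" using x S by (auto simp: fibres_def)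
next
  fix S assume "S \<in> fibres X (itinerary T l n)"
  then obtain x where x: "x \<in> X" and S: "S = itinerary T l n -` {itinerary T l n x} \<inter> X"
    by (auto simp: fibres_def)
  have "S = {y\<in>X. \<forall>i<n. (T ^^ i) y \<in> l -` {l ((T ^^ i) x)} \<inter> X}"
    unfolding S using funpow_in[where T=T and X=X, OF T] by (auto simp: itinerary_eq_iff)
  moreover have "\<forall>i<n. l -` {l ((T ^^ i) x)} \<inter> X \<in> fibres X l"
    using funpow_in[where T=T and X=X, OF T x] by (auto simp: fibres_def)
  moreover have "x \<in> S" using x by (auto simp: S)
  ultimately show "S \<in> iterated_join T X (fibres X l) n - {{}}"
    unfolding iterated_join_eq
    by (intro DiffI CollectI exI[of _ "\<lambda>i. l -` {l ((T ^^ i) x)} \<inter> X"] conjI) auto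
qed

lemma inj_on_fibre: "inj_on (\<lambda>c. l -` {c} \<inter> X) (l ` X)"
  by (auto simp: inj_on_def)

lemma finite_iterated_join: "finite P \<Longrightarrow> finite (iterated_join T X P n)"
proof (induction n)
  case (Suc n)
  have "iterated_join T X P (Suc n) = (\<lambda>(A, C). A \<inter> C) ` (iterated_join T X P n \<times> pullback (T ^^ n) X P)"
    by (auto simp: join_def)
  then show ?case using Suc by (simp add: pullback_def)
qed simp

lemma partition_on_fibres:
  assumes "partition_on X P"
  obtains l where "P = fibres X l" "\<And>x. x \<in> X \<Longrightarrow> l x \<in> P \<and> x \<in> l x"
proof -
  have "\<exists>A. A \<in> P \<and> x \<in> A" if "x \<in> X" for x using assms that by (auto simp: partition_on_def)
  then obtain l where l: "\<And>x. x \<in> X \<Longrightarrow> l x \<in> P \<and> x \<in> l x" by metis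
  have eq: "l x = A" if "x \<in> A" "A \<in> P" for x A
  proof -
    have "x \<in> X" using assms that by (auto simp: partition_on_def)
    then show ?thesis using l[of x] that assms by (auto simp: partition_on_def disjoint_def)
  qed
  have sub: "A \<subseteq> X" if "A \<in> P" for A using assms that by (auto simp: partition_on_def)
  have fib: "l -` {A} \<inter> X = A" if "A \<in> P" for A
  proof (intro equalityI subsetI)
    fix x assume "x \<in> l -` {A} \<inter> X"
    then show "x \<in> A" using l[of x] by blast
  next
    fix x assume x: "x \<in> A"
    then show "x \<in> l -` {A} \<inter> X" using eq[OF x that] sub[OF that] by blast
  qed
  have "P = l ` X"
  proof (intro equalityI subsetI)
    fix A assume A: "A \<in> P"
    then have "A \<noteq> {}" using assms by (auto simp: partition_on_def)
    then obtain x where x: "x \<in> A" by blast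
    then show "A \<in> l ` X" using eq[OF x A] sub[OF A] by blast
  next
    fix A assume "A \<in> l ` X"
    then show "A \<in> P" using l by blast
  qed
  moreover have "fibres X l = (\<lambda>A. A) ` (l ` X)"
    unfolding fibres_def using l by (intro image_cong refl fib) blast
  ultimately have "P = fibres X l" by simp
  then show thesis using that l by blast
qed

section \<open>Partition entropy of measure-preserving maps\<close>

locale measure_preserving = prob_space +
  fixes T :: "'a \<Rightarrow> 'a"
  assumes measurable_T: "T \<in> measurable M M" and distr_T: "distr M M T = M"
begin

lemma T_space: "x \<in> space M \<Longrightarrow> T x \<in> space M"
  using measurable_T by (rule measurable_space)

lemma funpow_space: "x \<in> space M \<Longrightarrow> (T ^^ n) x \<in> space M"
  by (rule funpow_in[where X = "space M"]) (auto simp: T_space)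

lemma measurable_funpow: "T ^^ n \<in> measurable M M"
proof (induction n)
  case 0
  show ?case by (simp add: id_def)
next
  case (Suc n)
  show ?case unfolding funpow.simps by (rule measurable_comp[OF Suc measurable_T])
qed

lemma distr_funpow: "distr M M (T ^^ n) = M"
proof (induction n)
  case 0
  then show ?case by (simp add: id_def)
next
  case (Suc n)
  have "distr M M (T ^^ Suc n) = distr (distr M M (T ^^ n)) M T"
    by (simp add: distr_distr[OF measurable_T measurable_funpow])
  then show ?case by (simp only: Suc distr_T)
qed

lemma expectation_funpow:
  fixes f :: "'a \<Rightarrow> real"
  assumes "f \<in> borel_measurable M"
  shows "expectation (\<lambda>x. f ((T ^^ n) x)) = expectation f"
  using integral_distr[OF measurable_funpow[of n] assms] by (simp add: distr_funpow)

lemma simple_function_funpow: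
  assumes "simple_function M V"
  shows "simple_function M (\<lambda>x. V ((T ^^ n) x))"
  unfolding simple_function_def
proof (intro conjI ballI)
  show "finite ((\<lambda>x. V ((T ^^ n) x)) ` space M)"
    by (rule finite_subset[OF _ simple_functionD(1)[OF assms]]) (auto simp: funpow_space)
  fix v
  show "(\<lambda>x. V ((T ^^ n) x)) -` {v} \<inter> space M \<in> sets M"
    using measurable_sets[OF measurable_funpow[of n] simple_image_fibre[OF assms, of v]]
    by (rule back_subst[where P = "\<lambda>S. S \<in> sets M"]) (auto simp: funpow_space)
qed

lemma point_prob_funpow:
  assumes "simple_function M V"
  shows "point_prob M (\<lambda>x. V ((T ^^ n) x)) v = point_prob M V v"
proof -
  have "point_prob M V v = measure (distr M M (T ^^ n)) (V -` {v} \<inter> space M)"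
    by (simp add: point_prob_def distr_funpow)
  also have "\<dots> = measure M ((T ^^ n) -` (V -` {v} \<inter> space M) \<inter> space M)"
    by (rule measure_distr[OF measurable_funpow simple_image_fibre[OF assms]])
  also have "(T ^^ n) -` (V -` {v} \<inter> space M) \<inter> space M = (\<lambda>x. V ((T ^^ n) x)) -` {v} \<inter> space M"
    by (auto simp: funpow_space)
  finally show ?thesis by (simp add: point_prob_def)
qed

lemma rv_entropy_funpow:
  assumes "simple_function M V"
  shows "rv_entropy M (\<lambda>x. V ((T ^^ n) x)) = rv_entropy M V"
proof -
  have "rv_entropy M (\<lambda>x. V ((T ^^ n) x)) = - (\<Sum>v\<in>V ` space M. point_prob M V v * ln (point_prob M V v))"
    using simple_functionD(1)[OF assms] funpow_space
    by (subst rv_entropy_eq_sum[of "V ` space M"]) (auto simp: point_prob_funpow[OF assms])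
  then show ?thesis by (simp add: rv_entropy_def)
qed

lemma simple_function_itinerary:
  assumes l: "simple_function M l"
  shows "simple_function M (itinerary T l n)"
  unfolding simple_function_def
proof (intro conjI ballI)
  have "itinerary T l n ` space M \<subseteq> PiE {..<n} (\<lambda>_. l ` space M)"
    by (auto simp: itinerary_def funpow_space split: if_splits)
  then show "finite (itinerary T l n ` space M)"
    by (rule finite_subset) (use simple_functionD(1)[OF l] in \<open>auto intro: finite_PiE\<close>)
next
  fix v
  show "itinerary T l n -` {v} \<inter> space M \<in> sets M"
  proof (cases "v \<in> extensional {..<n}")
    case True
    have "itinerary T l n -` {v} \<inter> space M = {x \<in> space M. \<forall>i\<in>{..<n}. l ((T ^^ i) x) = v i}"
      using True by (auto simp: itinerary_def restrict_def fun_eq_iff extensional_def)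
    also have "\<dots> \<in> sets M"
    proof (rule sets.sets_Collect_finite_All)
      fix i
      have "{x \<in> space M. l ((T ^^ i) x) = v i} = (\<lambda>x. l ((T ^^ i) x)) -` {v i} \<inter> space M" by auto
      then show "{x \<in> space M. l ((T ^^ i) x) = v i} \<in> sets M"
        using simple_image_fibre[OF simple_function_funpow[OF l]] by simp
    qed auto
    finally show ?thesis .
  next
    case False
    then have "itinerary T l n -` {v} \<inter> space M = {}" by (auto simp: itinerary_def)
    then show ?thesis by simp
  qed
qed

lemma shannon_iterated_join:
  assumes l: "simple_function M l"
  shows "shannon_entropy M (iterated_join T (space M) (fibres (space M) l) n) = rv_entropy M (itinerary T l n)"
proof -
  let ?J = "iterated_join T (space M) (fibres (space M) l) n"
  let ?h = "\<lambda>A. measure M A * ln (measure M A)"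
  have "finite ?J" using simple_functionD(1)[OF l] by (intro finite_iterated_join) (simp add: fibres_def)
  then have "(\<Sum>A\<in>?J. ?h A) = (\<Sum>A\<in>?J - {{}}. ?h A)"
    by (intro sum.mono_neutral_right) auto
  also have "\<dots> = (\<Sum>v\<in>itinerary T l n ` space M. ?h (itinerary T l n -` {v} \<inter> space M))"
    using iterated_join_fibres[OF T_space, where l = l and n = n]
    by (simp only: fibres_def sum.reindex[OF inj_on_fibre] o_def)
  finally show ?thesis by (simp add: shannon_entropy_def rv_entropy_def point_prob_def)
qed

text \<open>
  The itinerary of length \<open>m + n\<close> is a function of the itinerary of length \<open>m\<close> and of the itinerary
  of length \<open>n\<close> of the \<open>m\<close>-th iterate, which has the same distribution as that of the point.
\<close>

lemma rv_entropy_itinerary_add: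
  assumes l: "simple_function M l"
  shows "rv_entropy M (itinerary T l (m + n)) \<le> rv_entropy M (itinerary T l m) + rv_entropy M (itinerary T l n)"
proof -
  define h where "h = (\<lambda>(u, v) i. if i < m then u i else if i < m + n then v (i - m) else undefined :: 'b)"
  let ?V = "itinerary T l m" and ?W = "\<lambda>x. itinerary T l n ((T ^^ m) x)"
  have "itinerary T l (m + n) x = h (?V x, ?W x)" for x
  proof
    fix i
    have "(T ^^ (i - m)) ((T ^^ m) x) = (T ^^ i) x" if "\<not> i < m"
      using that by (metis add_diff_inverse_nat add.commute comp_apply funpow_add)
    then show "itinerary T l (m + n) x i = h (?V x, ?W x) i"
      by (auto simp: itinerary_def h_def)
  qed
  then have "rv_entropy M (itinerary T l (m + n)) = rv_entropy M (\<lambda>x. h (?V x, ?W x))" by presburger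
  also have "\<dots> \<le> rv_entropy M (\<lambda>x. (?V x, ?W x))"
    by (intro rv_entropy_mono simple_function_Pair simple_function_itinerary simple_function_funpow l)
  also have "\<dots> \<le> rv_entropy M ?V + rv_entropy M ?W"
    by (intro rv_entropy_Pair_le simple_function_itinerary simple_function_funpow l)
  also have "rv_entropy M ?W = rv_entropy M (itinerary T l n)"
    by (intro rv_entropy_funpow simple_function_itinerary l)
  finally show ?thesis .
qed

lemma partition_entropy_tendsto:
  assumes l: "simple_function M l"
  shows "(\<lambda>n. rv_entropy M (itinerary T l n) / real n) \<longlonglongrightarrow> partition_entropy T M (fibres (space M) l)"
proof -
  have "convergent (\<lambda>n. rv_entropy M (itinerary T l n) / real n)"
    by (intro subadditive_convergent rv_entropy_itinerary_add rv_entropy_nonneg l)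
  then show ?thesis
    unfolding partition_entropy_def shannon_iterated_join[OF l] convergent_LIMSEQ_iff .
qed

lemma measurable_partition_fibres:
  assumes "measurable_partition M P"
  obtains l where "P = fibres (space M) l" "simple_function M l" "\<And>x. x \<in> space M \<Longrightarrow> l x \<in> P \<and> x \<in> l x"
proof -
  have P: "finite P" "P \<subseteq> sets M" "partition_on (space M) P"
    using assms by (auto simp: measurable_partition_def)
  obtain l where l: "P = fibres (space M) l" "\<And>x. x \<in> space M \<Longrightarrow> l x \<in> P \<and> x \<in> l x"
    by (rule partition_on_fibres[OF P(3)]) blast
  have "simple_function M l"
    unfolding simple_function_def
  proof (intro conjI ballI)
    show "finite (l ` space M)" using P(1) l(2) by (auto intro: finite_subset[of _ P])
    fix c assume "c \<in> l ` space M"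
    then have "l -` {c} \<inter> space M \<in> P" unfolding l(1) fibres_def by blast
    then show "l -` {c} \<inter> space M \<in> sets M" using P(2) by blast
  qed
  then show thesis using that l by blast
qed

lemma simple_measurable_partition:
  assumes l: "simple_function M l"
  shows "measurable_partition M (fibres (space M) l)"
  using simple_functionD(1)[OF l] simple_image_fibre[OF l]
  by (auto simp: measurable_partition_def fibres_def partition_on_def disjoint_def)

end

section \<open>The space of bi-infinite binary sequences\<close>

definition window :: "nat \<Rightarrow> (int \<Rightarrow> bool) \<Rightarrow> (int \<Rightarrow> bool) set" where
  "window M x = {y. \<forall>i. \<bar>i\<bar> \<le> int M \<longrightarrow> y i = x i}"

text \<open>
  The sets that depend only on the coordinates in \<open>[-M, M]\<close>. They are clopen, and they approximate
  all Borel sets in measure.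
\<close>

definition windowed :: "nat \<Rightarrow> (int \<Rightarrow> bool) set \<Rightarrow> bool" where
  "windowed M G \<longleftrightarrow> (\<forall>x y. y \<in> window M x \<longrightarrow> (x \<in> G \<longleftrightarrow> y \<in> G))"

lemma window_refl: "x \<in> window M x"
  by (simp add: window_def)

lemma window_antimono: "M \<le> M' \<Longrightarrow> window M' x \<subseteq> window M x"
  by (auto simp: window_def)

lemma windowed_mono: "windowed M G \<Longrightarrow> M \<le> M' \<Longrightarrow> windowed M' G"
  using window_antimono unfolding windowed_def by blast

lemma open_coordinates:
  assumes "finite I"
  shows "open {x :: int \<Rightarrow> bool. \<forall>i\<in>I. x i = c i}"
proof -
  have "open {c i}" for i by (rule discrete_topology_class.open_discrete)
  then show ?thesis using product_topology_basis'[of I "\<lambda>i. {c i}" id] assms by simp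
qed

lemma window_eq: "window M x = {y. \<forall>i\<in>{- int M..int M}. y i = x i}"
proof -
  have "\<bar>i\<bar> \<le> int M \<longleftrightarrow> i \<in> {- int M..int M}" for i by auto
  then show ?thesis unfolding window_def Ball_def by simp
qed

lemma open_window: "open (window M x)"
  unfolding window_eq by (rule open_coordinates) simp

lemma windowed_open:
  assumes "windowed M G"
  shows "open G"
proof -
  have "G = (\<Union>x\<in>G. window M x)" using assms window_refl by (fastforce simp: windowed_def)
  then show ?thesis using open_window by (metis open_UN)
qed

text \<open>
  A basic open set of the product topology restricts finitely many coordinates.
\<close>

lemma open_contains_window:
  assumes "open U" "x \<in> U"
  obtains M where "window M x \<subseteq> U"
proof -
  have "openin (product_topology (\<lambda>i. euclidean) UNIV) U"
    using assms(1) by (simp add: open_fun_def)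
  from product_topology_open_contains_basis[OF this assms(2)]
  obtain X where X: "x \<in> (\<Pi>\<^sub>E i\<in>UNIV. X i)" "finite {i. X i \<noteq> UNIV}" "(\<Pi>\<^sub>E i\<in>UNIV. X i) \<subseteq> U" by auto
  define M where "M = Max (insert 0 ((\<lambda>i. nat \<bar>i\<bar>) ` {i. X i \<noteq> UNIV}))"
  have M: "\<bar>i\<bar> \<le> int M" if "X i \<noteq> UNIV" for i
  proof -
    have "nat \<bar>i\<bar> \<le> M" unfolding M_def using X(2) that by (intro Max_ge) auto
    then show ?thesis by simp
  qed
  have "y i \<in> X i" if y: "y \<in> window M x" for y i
  proof (cases "X i = UNIV")
    case False
    then have "y i = x i" using M y by (auto simp: window_def)
    then show ?thesis using X(1) by auto
  qed auto
  then have "window M x \<subseteq> U" using X(3) by (auto simp: PiE_iff)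
  then show thesis by (rule that)
qed

lemma compact_sequences: "compact (UNIV :: (int \<Rightarrow> bool) set)"
proof -
  have "compact (UNIV :: bool set)" by (rule finite_imp_compact) simp
  then have "compact_space (euclidean :: bool topology)" by (simp add: compact_space_def)
  then have "compact_space (product_topology (\<lambda>_ :: int. euclidean :: bool topology) UNIV)"
    by (simp add: compact_space_product_topology)
  then show ?thesis by (simp add: euclidean_product_topology compact_space_def)
qed

lemma continuous_shift: "continuous_on S shift"
proof -
  have "continuous_on UNIV (\<lambda>x n. x (n + 1) :: bool)"
    by (intro continuous_on_coordinatewise_then_product continuous_on_product_coordinates)
  then show ?thesis unfolding shift_def shift_by_def by (rule continuous_on_subset) simp
qed

lemma shift_funpow_apply: "(shift ^^ n) x i = x (i + int n)"
  by (simp add: shift_funpow shift_by_def)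

text \<open>
  An open set is the union of the windows inside it. There are countably many windows, because
  a window is given by its radius and by the finite set of its ones.
\<close>

lemma sets_borel_patterns:
  "sets (borel :: (int \<Rightarrow> bool) measure) = sigma_sets UNIV {{x. \<forall>i\<in>A. x i} | A. finite A}"
    (is "_ = sigma_sets UNIV ?E")
proof
  interpret sigma_algebra UNIV "sigma_sets UNIV ?E" by (rule sigma_algebra_sigma_sets) simp
  have coord: "{x. x i} \<in> sigma_sets UNIV ?E" for i
    by (intro sigma_sets.Basic CollectI exI[of _ "{i}"]) auto
  have coord': "{x. x i = c} \<in> sigma_sets UNIV ?E" for i c
    using coord[of i] compl_sets[OF coord[of i]] by (cases c) (simp_all add: Compl_eq_Diff_UNIV[symmetric] Collect_neg_eq)
  have win: "window M x \<in> sigma_sets UNIV ?E" for M x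
  proof -
    have "window M x = (\<Inter>i\<in>{- int M..int M}. {y. y i = x i})" by (auto simp: window_eq)
    also have "\<dots> \<in> sigma_sets UNIV ?E" using coord' by (intro finite_INT) auto
    finally show ?thesis .
  qed
  have "U \<in> sigma_sets UNIV ?E" if U: "open U" for U
  proof -
    define \<W> where "\<W> = {window M (\<lambda>i. i \<in> w) | M w. finite w \<and> window M (\<lambda>i. i \<in> w) \<subseteq> U}"
    have "\<W> \<subseteq> (\<lambda>(M, w). window M (\<lambda>i. i \<in> w)) ` (UNIV \<times> {w. finite w})" by (auto simp: \<W>_def)
    moreover have "countable ((\<lambda>(M, w). window M (\<lambda>i. i \<in> w)) ` (UNIV \<times> {w :: int set. finite w}))"
      using countable_Collect_finite by (intro countable_image countable_SIGMA) auto
    ultimately have "countable \<W>" by (rule countable_subset)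
    moreover have "\<W> \<subseteq> sigma_sets UNIV ?E" using win by (auto simp: \<W>_def)
    moreover have "U = \<Union>\<W>"
    proof (intro equalityI subsetI)
      fix x assume "x \<in> U"
      then obtain M where M: "window M x \<subseteq> U" using open_contains_window[OF U] by blast
      define w where "w = {i\<in>{- int M..int M}. x i}"
      have "window M (\<lambda>i. i \<in> w) = window M x" by (simp add: window_eq w_def)
      moreover have "finite w" by (rule finite_subset[of _ "{- int M..int M}"]) (auto simp: w_def)
      ultimately have "window M x \<in> \<W>" using M by (auto simp: \<W>_def)
      then show "x \<in> \<Union>\<W>" using window_refl[of x M] by (rule UnionI)
    qed (auto simp: \<W>_def)
    ultimately show ?thesis using countable_Union[of \<W>] by simp
  qed
  then have "sigma_sets UNIV {S :: (int \<Rightarrow> bool) set. open S} \<subseteq> sigma_sets UNIV ?E"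
    by (intro sigma_sets_mono) auto
  then show "sets borel \<subseteq> sigma_sets UNIV ?E" by (simp add: borel_def)
  show "sigma_sets UNIV ?E \<subseteq> sets borel"
  proof (rule sets.sigma_sets_subset')
    show "?E \<subseteq> sets borel"
      using open_coordinates[where c = "\<lambda>_. True"] by auto
  qed auto
qed

lemma invariant_probD:
  assumes "invariant_prob T X \<mu>"
  shows "space \<mu> = X" "\<And>C. C \<in> sets borel \<Longrightarrow> C \<inter> X \<in> sets \<mu>"
    "\<And>S. S \<in> sets \<mu> \<Longrightarrow> \<exists>C\<in>sets borel. S = C \<inter> X" "measure_preserving \<mu> T"
proof -
  have s: "sets \<mu> = sets (restrict_space borel X)" using assms by (simp add: invariant_prob_def)
  then show "space \<mu> = X" using sets_eq_imp_space_eq[OF s] by (simp add: space_restrict_space)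
  show "\<And>C. C \<in> sets borel \<Longrightarrow> C \<inter> X \<in> sets \<mu>" "\<And>S. S \<in> sets \<mu> \<Longrightarrow> \<exists>C\<in>sets borel. S = C \<inter> X"
    unfolding s sets_restrict_space by auto
  show "measure_preserving \<mu> T"
    using assms by (simp add: invariant_prob_def measure_preserving_def measure_preserving_axioms_def)
qed

text \<open>
  The sets that prescribe ones, but no zeros, are closed under intersection and generate the
  Borel sets.
\<close>

lemma patterns_determine_measure:
  fixes \<mu> \<nu> :: "(int \<Rightarrow> bool) measure"
  assumes \<mu>: "sets \<mu> = sets (restrict_space borel X)" "prob_space \<mu>"
    and \<nu>: "sets \<nu> = sets (restrict_space borel X)" "prob_space \<nu>"
    and eq: "\<And>A. finite A \<Longrightarrow> measure \<mu> {x\<in>X. \<forall>i\<in>A. x i} = measure \<nu> {x\<in>X. \<forall>i\<in>A. x i}"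
  shows "\<mu> = \<nu>"
proof -
  interpret \<mu>: prob_space \<mu> by fact
  interpret \<nu>: prob_space \<nu> by fact
  have sp: "space \<mu> = X" "space \<nu> = X"
    using sets_eq_imp_space_eq[OF \<mu>(1)] sets_eq_imp_space_eq[OF \<nu>(1)] by (auto simp: space_restrict_space)
  have meas: "(\<lambda>x. x) \<in> measurable \<mu> borel" "(\<lambda>x. x) \<in> measurable \<nu> borel"
    using \<mu>(1) \<nu>(1) by (auto simp: measurable_def sp sets_restrict_space)
  let ?E = "{{x :: int \<Rightarrow> bool. \<forall>i\<in>A. x i} | A. finite A}"
  have "distr \<mu> borel (\<lambda>x. x) = distr \<nu> borel (\<lambda>x. x)"
  proof (rule measure_eqI_generator_eq[where E = ?E and \<Omega> = UNIV and A = "\<lambda>_. UNIV"])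
    show "Int_stable ?E"
    proof (rule Int_stableI)
      fix a b assume "a \<in> ?E" "b \<in> ?E"
      then obtain A C where "finite A" "finite C" "a = {x. \<forall>i\<in>A. x i}" "b = {x. \<forall>i\<in>C. x i}" by blast
      then show "a \<inter> b \<in> ?E" by (intro CollectI exI[of _ "A \<union> C"]) auto
    qed
    fix S assume "S \<in> ?E"
    then obtain A where A: "finite A" "S = {x. \<forall>i\<in>A. x i}" by blast
    have S: "S \<in> sets borel" using open_coordinates[OF A(1), of "\<lambda>_. True"] by (simp add: A(2))
    have "S \<inter> X = {x\<in>X. \<forall>i\<in>A. x i}" by (auto simp: A(2))
    then show "emeasure (distr \<mu> borel (\<lambda>x. x)) S = emeasure (distr \<nu> borel (\<lambda>x. x)) S"
      using eq[OF A(1)] by (simp add: emeasure_distr[OF meas(1) S] emeasure_distr[OF meas(2) S] sp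
          \<mu>.emeasure_eq_measure \<nu>.emeasure_eq_measure)
  next
    show "range (\<lambda>_ :: nat. UNIV) \<subseteq> ?E" by (auto intro!: exI[of _ "{}"])
    show "emeasure (distr \<mu> borel (\<lambda>x. x)) UNIV \<noteq> \<infinity>" for i :: nat
      by (simp add: emeasure_distr[OF meas(1)] \<mu>.emeasure_eq_measure)
  qed (auto simp: sets_borel_patterns)
  then have E: "emeasure \<mu> (C \<inter> X) = emeasure \<nu> (C \<inter> X)" if "C \<in> sets borel" for C
    using emeasure_distr[OF meas(1) that] emeasure_distr[OF meas(2) that] by (simp add: sp)
  show ?thesis
  proof (rule measure_eqI)
    fix S assume "S \<in> sets \<mu>"
    then obtain C where "C \<in> sets borel" "S = C \<inter> X" by (auto simp: \<mu>(1) sets_restrict_space)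
    then show "emeasure \<mu> S = emeasure \<nu> S" using E by simp
  qed (simp add: \<mu>(1) \<nu>(1))
qed

text \<open>
  The sets that can be approximated form a sigma-algebra: for a countable union, approximate
  finitely many of its members that exhaust it up to a small measure.
\<close>

lemma windowed_approximation:
  fixes \<mu> :: "(int \<Rightarrow> bool) measure"
  assumes \<mu>: "sets \<mu> = sets (restrict_space borel X)" "prob_space \<mu>"
    and C: "C \<in> sets borel" and e: "e > 0"
  shows "\<exists>M G. windowed M G \<and> measure \<mu> {x\<in>X. (x \<in> C) \<noteq> (x \<in> G)} < e"
proof -
  interpret prob_space \<mu> by fact
  have sp: "space \<mu> = X"
    using sets_eq_imp_space_eq[OF \<mu>(1)] by (auto simp: space_restrict_space)
  have meas: "{x\<in>X. x \<in> D} \<in> sets \<mu>" if "D \<in> sets borel" for D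
  proof -
    have "{x\<in>X. x \<in> D} = X \<inter> D" by auto
    then show ?thesis using that by (auto simp: \<mu>(1) sets_restrict_space)
  qed
  have meas_ne: "{x\<in>X. (x \<in> D) \<noteq> (x \<in> G)} \<in> sets \<mu>" if "D \<in> sets borel" "G \<in> sets borel" for D G
  proof -
    have "{x\<in>X. (x \<in> D) \<noteq> (x \<in> G)} = {x\<in>X. x \<in> (D - G) \<union> (G - D)}" by auto
    then show ?thesis using that by (metis meas sets.Un sets.Diff)
  qed
  have wb: "G \<in> sets borel" if "windowed M G" for M G using windowed_open[OF that] by simp
  let ?E = "{{x :: int \<Rightarrow> bool. \<forall>i\<in>A. x i} | A. finite A}"
  have "C \<in> sigma_sets UNIV ?E" using C by (simp add: sets_borel_patterns)
  then have "\<forall>e>0. \<exists>M G. windowed M G \<and> measure \<mu> {x\<in>X. (x \<in> C) \<noteq> (x \<in> G)} < e"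
  proof (induction C rule: sigma_sets.induct)
    case (Basic C)
    then obtain A where A: "finite A" "C = {x. \<forall>i\<in>A. x i}" by blast
    define M where "M = Max (insert 0 ((\<lambda>i. nat \<bar>i\<bar>) ` A))"
    have "\<bar>i\<bar> \<le> int M" if "i \<in> A" for i
    proof -
      have "nat \<bar>i\<bar> \<le> M" unfolding M_def using A(1) that by (intro Max_ge) auto
      then show ?thesis by simp
    qed
    then have "windowed M C" by (auto simp: windowed_def window_def A(2))
    then show ?case by (intro allI impI exI[of _ M] exI[of _ C]) auto
  next
    case Empty
    have "windowed 0 {}" by (simp add: windowed_def)
    then show ?case by (intro allI impI exI[of _ 0] exI[of _ "{}"]) auto
  next
    case (Compl C)
    show ?case
    proof (intro allI impI)
      fix e :: real assume "0 < e"
      then obtain M G where "windowed M G" "measure \<mu> {x\<in>X. (x \<in> C) \<noteq> (x \<in> G)} < e" using Compl.IH by blast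
      moreover have "windowed M (- G)" using \<open>windowed M G\<close> by (auto simp: windowed_def)
      ultimately show "\<exists>M G. windowed M G \<and> measure \<mu> {x\<in>X. (x \<in> UNIV - C) \<noteq> (x \<in> G)} < e"
        by (intro exI[of _ M] exI[of _ "- G"]) simp
    qed
  next
    case (Union C)
    have Cb: "C i \<in> sets borel" for i using Union.hyps by (simp add: sets_borel_patterns)
    show ?case
    proof (intro allI impI)
      fix e :: real assume e: "0 < e"
      let ?U = "{x\<in>X. x \<in> (\<Union>i. C i)}" and ?V = "\<lambda>n. {x\<in>X. x \<in> (\<Union>i<n. C i)}"
      have "(\<lambda>n. measure \<mu> (?V n)) \<longlonglongrightarrow> measure \<mu> (\<Union>n. ?V n)"
      proof (rule finite_Lim_measure_incseq)
        show "range ?V \<subseteq> sets \<mu>" using Cb by (intro image_subsetI meas sets.finite_UN) auto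
      qed (auto simp: incseq_def)
      also have "(\<Union>n. ?V n) = ?U" by auto
      finally have "\<forall>\<^sub>F n in sequentially. measure \<mu> ?U - e / 2 < measure \<mu> (?V n)"
        using e by (intro order_tendstoD) auto
      then obtain n where n: "measure \<mu> ?U - e / 2 < measure \<mu> (?V n)"
        by (auto simp: eventually_sequentially)
      define Q where "Q = (\<lambda>i M G. windowed M G \<and> measure \<mu> {x\<in>X. (x \<in> C i) \<noteq> (x \<in> G)} < e / (2 * real (Suc n)))"
      have "\<forall>i. \<exists>M G. Q i M G"
        unfolding Q_def using Union.IH e by simp
      then obtain M G where "\<And>i. Q i (M i) (G i)" by metis
      then have MG: "\<And>i. windowed (M i) (G i)"
        "\<And>i. measure \<mu> {x\<in>X. (x \<in> C i) \<noteq> (x \<in> G i)} < e / (2 * real (Suc n))"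
        unfolding Q_def by blast+
      define M' where "M' = Max (insert 0 (M ` {..<n}))"
      have "windowed M' (G i)" if "i < n" for i
        using MG(1)[of i] by (rule windowed_mono) (use that in \<open>auto simp: M'_def\<close>)
      then have w: "windowed M' (\<Union>i<n. G i)" unfolding windowed_def by blast
      have "measure \<mu> {x\<in>X. (x \<in> (\<Union>i. C i)) \<noteq> (x \<in> (\<Union>i<n. G i))}
          \<le> measure \<mu> ((?U - ?V n) \<union> (\<Union>i\<in>{..<n}. {x\<in>X. (x \<in> C i) \<noteq> (x \<in> G i)}))"
      proof (rule finite_measure_mono)
        show "{x\<in>X. (x \<in> (\<Union>i. C i)) \<noteq> (x \<in> (\<Union>i<n. G i))}
          \<subseteq> (?U - ?V n) \<union> (\<Union>i\<in>{..<n}. {x\<in>X. (x \<in> C i) \<noteq> (x \<in> G i)})" by auto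
        have "?U \<in> sets \<mu>" by (intro meas sets.countable_UN) (use Cb in auto)
        moreover have "?V n \<in> sets \<mu>" by (intro meas sets.finite_UN) (use Cb in auto)
        moreover have "(\<Union>i\<in>{..<n}. {x\<in>X. (x \<in> C i) \<noteq> (x \<in> G i)}) \<in> sets \<mu>"
          using Cb wb[OF MG(1)] by (intro sets.finite_UN meas_ne) auto
        ultimately show "(?U - ?V n) \<union> (\<Union>i\<in>{..<n}. {x\<in>X. (x \<in> C i) \<noteq> (x \<in> G i)}) \<in> sets \<mu>"
          by blast
      qed
      also have "\<dots> \<le> measure \<mu> (?U - ?V n) + measure \<mu> (\<Union>i\<in>{..<n}. {x\<in>X. (x \<in> C i) \<noteq> (x \<in> G i)})"
        using Cb wb[OF MG(1)] by (intro measure_Un_le sets.Diff sets.finite_UN meas meas_ne sets.countable_UN) auto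
      also have "measure \<mu> (?U - ?V n) = measure \<mu> ?U - measure \<mu> (?V n)"
        using Cb by (intro finite_measure_Diff meas) auto
      also have "measure \<mu> (\<Union>i\<in>{..<n}. {x\<in>X. (x \<in> C i) \<noteq> (x \<in> G i)})
          \<le> (\<Sum>i<n. measure \<mu> {x\<in>X. (x \<in> C i) \<noteq> (x \<in> G i)})"
        using Cb wb[OF MG(1)] by (intro finite_measure_subadditive_finite image_subsetI meas_ne) auto
      also have "\<dots> \<le> (\<Sum>i<n. e / (2 * real (Suc n)))"
        by (intro sum_mono less_imp_le MG(2))
      also have "\<dots> = (e / 2) * (real n / real (Suc n))" by simp
      also have "\<dots> \<le> e / 2" using e by (intro mult_left_le) auto
      finally have "measure \<mu> {x\<in>X. (x \<in> (\<Union>i. C i)) \<noteq> (x \<in> (\<Union>i<n. G i))} < e" using n by linarith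
      then show "\<exists>M G. windowed M G \<and> measure \<mu> {x\<in>X. (x \<in> \<Union> (range C)) \<noteq> (x \<in> G)} < e"
        using w by blast
    qed
  qed
  then show ?thesis using e by blast
qed

section \<open>The hereditary closure\<close>

lemma X_tilde_closed: "closed (X_tilde B)"
  using hereditary_closure_least(1) unfolding X_tilde_def subshift_def by blast

lemma X_tilde_borel: "X_tilde B \<in> sets borel"
  using X_tilde_closed by simp

lemma X_tilde_compact: "compact (X_tilde B)"
  using closed_Int_compact[OF X_tilde_closed compact_sequences] by simp

lemma X_tilde_shift: "x \<in> X_tilde B \<Longrightarrow> shift x \<in> X_tilde B"
  using hereditary_closure_least(1) unfolding X_tilde_def subshift_def by blast

lemma shift_by_eta_in_X_tilde: "shift_by m (eta B) \<in> X_tilde B"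
proof -
  have "shift_by m (eta B) \<in> X_eta B"
    unfolding X_eta_def by (rule closure_subset[THEN subsetD]) auto
  then show ?thesis unfolding X_tilde_def by (rule hereditary_closure_least(3)[THEN subsetD])
qed

lemma X_tilde_hereditary: "x \<in> X_tilde B \<Longrightarrow> (\<And>i. y i \<Longrightarrow> x i) \<Longrightarrow> y \<in> X_tilde B"
  using hereditary_closure_least(2)[of "X_eta B"] unfolding X_tilde_def hereditary_def
  by (metis le_funI le_boolI)

text \<open>
  Replacing \<open>x\<close> by zeros outside \<open>[-M, M]\<close> gives points below translates of \<open>eta B\<close>, and these
  converge to \<open>x\<close>.
\<close>

lemma X_tilde_memI:
  assumes "\<And>M. \<exists>m. \<forall>i. \<bar>i\<bar> \<le> int M \<longrightarrow> x i \<longrightarrow> eta B (i + m)"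
  shows "x \<in> X_tilde B"
proof (rule ccontr)
  assume "x \<notin> X_tilde B"
  then obtain M where M: "window M x \<subseteq> - X_tilde B"
    using open_contains_window[of "- X_tilde B" x] X_tilde_closed by (auto simp: open_Compl)
  obtain m where m: "\<And>i. \<bar>i\<bar> \<le> int M \<Longrightarrow> x i \<Longrightarrow> eta B (i + m)" using assms by blast
  define y where "y = (\<lambda>i. \<bar>i\<bar> \<le> int M \<and> x i)"
  have "y \<in> X_tilde B"
    by (rule X_tilde_hereditary[OF shift_by_eta_in_X_tilde[of m]]) (auto simp: y_def shift_by_def m)
  moreover have "y \<in> window M x" by (auto simp: y_def window_def)
  ultimately show False using M by blast
qed

text \<open>
  The sequences below some translate of the sieve form a hereditary subshift. It is closed because
  there are only finitely many translates.
\<close>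

lemma X_tilde_le_sieve:
  assumes B: "B \<subseteq> {1..}" and x: "x \<in> X_tilde B"
  shows "\<exists>r<fact K. \<forall>i. x i \<longrightarrow> sieve B K (i + int r)"
proof -
  define Y where "Y = {x. \<exists>m. \<forall>i. x i \<longrightarrow> sieve B K (i + m)}"
  have Y: "Y = (\<Union>r<fact K. {x. \<forall>i. x i \<longrightarrow> sieve B K (i + int r)})"
  proof (intro equalityI subsetI)
    fix x assume "x \<in> Y"
    then obtain m where m: "\<And>i. x i \<Longrightarrow> sieve B K (i + m)" by (auto simp: Y_def)
    define r where "r = nat (m mod fact K)"
    have "int r = m mod fact K" by (simp add: r_def)
    then have "sieve B K (i + int r) \<longleftrightarrow> sieve B K (i + m)" for i
      by (intro sieve_cong_mod[OF B]) (simp add: mod_add_right_eq)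
    moreover have "r < fact K"
      unfolding r_def by (metis fact_gt_zero nat_less_iff of_nat_fact pos_mod_bound pos_mod_sign)
    ultimately show "x \<in> (\<Union>r<fact K. {x. \<forall>i. x i \<longrightarrow> sieve B K (i + int r)})" using m by auto
  qed (auto simp: Y_def)
  have "closed {x :: int \<Rightarrow> bool. x i \<longrightarrow> P}" for i P
  proof (cases P)
    case False
    have "open {x :: int \<Rightarrow> bool. x i}" using open_coordinates[of "{i}" "\<lambda>_. True"] by simp
    then show ?thesis using False by (simp add: closed_def Collect_neg_eq)
  qed simp
  then have "closed (\<Inter>i. {x :: int \<Rightarrow> bool. x i \<longrightarrow> sieve B K (i + int r)})" for r by blast
  then have "closed {x :: int \<Rightarrow> bool. \<forall>i. x i \<longrightarrow> sieve B K (i + int r)}" for r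
    by (simp only: Collect_all_eq)
  then have "closed Y" unfolding Y by (intro closed_UN) auto
  moreover have "shift ` Y = Y"
  proof (intro set_eqI)
    fix y
    have "shift_by (- 1) y \<in> Y \<longleftrightarrow> y \<in> Y"
    proof
      assume "shift_by (- 1) y \<in> Y"
      then obtain m where m: "\<And>i. y (i + - 1) \<Longrightarrow> sieve B K (i + m)"
        unfolding Y_def shift_by_def by blast
      have "sieve B K (i + (m + 1))" if "y i" for i using m[of "i + 1"] that by (simp add: ac_simps)
      then show "y \<in> Y" by (auto simp: Y_def)
    next
      assume "y \<in> Y"
      then obtain m where m: "\<And>i. y i \<Longrightarrow> sieve B K (i + m)" by (auto simp: Y_def)
      have "sieve B K (i + (m - 1))" if "y (i + - 1)" for i using m[OF that] by (simp add: algebra_simps)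
      then show "shift_by (- 1) y \<in> Y" by (auto simp: Y_def shift_by_def)
    qed
    then show "y \<in> shift ` Y \<longleftrightarrow> y \<in> Y" by (simp add: shift_image_iff)
  qed
  ultimately have "subshift Y" by (simp add: subshift_def)
  moreover have "hereditary Y"
    unfolding hereditary_def Y_def by (auto simp: le_fun_def)
  moreover have "X_eta B \<subseteq> Y"
    unfolding X_eta_def
    by (rule closure_minimal[OF _ \<open>closed Y\<close>]) (auto simp: Y_def shift_by_def intro!: eta_imp_sieve)
  ultimately have "X_tilde B \<subseteq> Y"
    unfolding X_tilde_def by (rule hereditary_closure_least(4))
  then show ?thesis using x unfolding Y by auto
qed

section \<open>Weighted word counts\<close>

text \<open>
  A word on the index set \<open>W\<close> is represented by the set of the places of its ones.
\<close>

definition sieve_words :: "nat set \<Rightarrow> nat \<Rightarrow> int set \<Rightarrow> int set set" where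
  "sieve_words B K W = (\<Union>r<fact K. Pow {i\<in>W. sieve B K (i + int r)})"

text \<open>
  The indices of the coordinates that the windows of radius \<open>M\<close> around \<open>0, \<dots>, N\<close> see.
\<close>

definition positions :: "nat \<Rightarrow> nat \<Rightarrow> int set" where
  "positions M N = {- int M..int N + int M}"

lemma finite_positions: "finite (positions M N)"
  by (simp add: positions_def)

lemma finite_sieve_words: "finite W \<Longrightarrow> finite (sieve_words B K W)"
  by (simp add: sieve_words_def)

lemma sum_positions:
  fixes f :: "int \<Rightarrow> real"
  shows "(\<Sum>i\<in>positions M N. f i) = (\<Sum>j<N + 2 * M + 1. f (int j - int M))"
proof (rule sum.reindex_bij_witness[of _ "\<lambda>j. int j - int M" "\<lambda>i. nat (i + int M)"])
qed (auto simp: positions_def)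

lemma sum_UN_le:
  fixes f :: "'b \<Rightarrow> real"
  assumes "finite I" "\<And>i. i \<in> I \<Longrightarrow> finite (F i)" "\<And>x. 0 \<le> f x"
  shows "(\<Sum>x\<in>(\<Union>i\<in>I. F i). f x) \<le> (\<Sum>i\<in>I. \<Sum>x\<in>F i. f x)"
proof -
  have "(\<Sum>x\<in>(\<Union>i\<in>I. F i). f x) \<le> (\<Sum>(i, x)\<in>Sigma I F. f x)"
    by (rule sum_le_included[where i = snd]) (use assms in \<open>auto intro: finite_SigmaI\<close>)
  also have "\<dots> = (\<Sum>i\<in>I. \<Sum>x\<in>F i. f x)"
    using assms by (intro sum.Sigma[symmetric]) auto
  finally show ?thesis .
qed

text \<open>
  For each of the \<open>K!\<close> residues \<open>r\<close> the words are the subsets of a fixed set \<open>E r\<close>, which has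
  about \<open>N d\<^sub>K\<close> elements and contains the pattern \<open>A\<close> at about \<open>N\<close> times \<open>sieve_density B K A\<close> places.
  The moment generating function of \<open>pattern_count_mgf\<close> then gives the bound. The errors in these
  two counts do not depend on \<open>N\<close>.
\<close>

lemma sieve_words_pressure:
  fixes t :: real
  assumes B: "B \<subseteq> {1..}" and A: "finite A" "\<And>i i'. i \<in> A \<Longrightarrow> i' \<in> A \<Longrightarrow> i' - i < int n"
    and n: "n > 0" and AM: "\<And>i. i \<in> A \<Longrightarrow> \<bar>i\<bar> \<le> int M" and t: "\<bar>t\<bar> * real n \<le> 1"
  shows "(\<Sum>w\<in>sieve_words B K (positions M N). exp (t * (\<Sum>j<N. of_bool (translate A j \<subseteq> w))))
    \<le> exp (ln (fact K) + ln 2 * (real (N + 2 * M + 1) * sieve_density B K {0} + fact K)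
        + t * (real N * sieve_density B K A / 2 ^ card A) + \<bar>t\<bar> * fact K + (t * real n)\<^sup>2 * real N)"
proof -
  define E where "E = (\<lambda>r. {i\<in>positions M N. sieve B K (i + int r)})"
  define c where "c = (\<lambda>r. (\<Sum>j<N. of_bool (translate A j \<subseteq> E r)) :: real)"
  have E: "finite (E r)" for r using finite_positions by (simp add: E_def)
  have card_E: "real (card (E r)) \<le> real (N + 2 * M + 1) * sieve_density B K {0} + fact K" for r
  proof -
    have "real (card (E r)) = (\<Sum>i\<in>positions M N. of_bool (sieve B K (i + int r)))"
      by (simp add: E_def finite_positions Int_def)
    also have "\<dots> = (\<Sum>j<N + 2 * M + 1. of_bool (\<forall>i\<in>{0}. sieve B K (i + (int r - int M + int j))))"
      unfolding sum_positions by (intro sum.cong) (auto simp: algebra_simps)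
    finally show ?thesis
      using sieve_count[OF B, of "{0}" K "int r - int M" "N + 2 * M + 1"] by linarith
  qed
  have c: "\<bar>c r - real N * sieve_density B K A\<bar> \<le> fact K" for r
  proof -
    have "translate A j \<subseteq> E r \<longleftrightarrow> (\<forall>i\<in>A. sieve B K (i + (int r + int j)))" if "j < N" for j
    proof -
      have "i + int j \<in> positions M N" if "i \<in> A" for i
        using AM[OF that] \<open>j < N\<close> by (auto simp: positions_def)
      then show ?thesis by (auto simp: E_def ac_simps)
    qed
    then have "c r = (\<Sum>j<N. of_bool (\<forall>i\<in>A. sieve B K (i + (int r + int j))))"
      unfolding c_def by (intro sum.cong) auto
    then show ?thesis using sieve_count[OF B, of A K "int r" N] by simp
  qed
  define Z where "Z = (\<lambda>r w. (\<Sum>j<N. of_bool (translate A j \<subseteq> w) - of_bool (translate A j \<subseteq> E r) / 2 ^ card A) :: real)"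
  define R where "R = ln 2 * (real (N + 2 * M + 1) * sieve_density B K {0} + fact K)
        + t * (real N * sieve_density B K A / 2 ^ card A) + \<bar>t\<bar> * fact K + (t * real n)\<^sup>2 * real N"
  have "(\<Sum>w\<in>Pow (E r). exp (t * (\<Sum>j<N. of_bool (translate A j \<subseteq> w)))) \<le> exp R" for r
  proof -
    have "t * (\<Sum>j<N. of_bool (translate A j \<subseteq> w)) = t * (c r / 2 ^ card A) + t * Z r w" for w
    proof -
      have "Z r w = (\<Sum>j<N. of_bool (translate A j \<subseteq> w)) - c r / 2 ^ card A"
        unfolding Z_def c_def sum_subtractf sum_divide_distrib ..
      then show ?thesis by (simp only: right_diff_distrib)
    qed
    then have "(\<Sum>w\<in>Pow (E r). exp (t * (\<Sum>j<N. of_bool (translate A j \<subseteq> w))))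
        = exp (t * (c r / 2 ^ card A)) * (\<Sum>w\<in>Pow (E r). exp (t * Z r w))"
      by (simp add: exp_add sum_distrib_left)
    also have "\<dots> \<le> exp (t * (c r / 2 ^ card A)) * (2 ^ card (E r) * exp ((t * real n)\<^sup>2 * real N))"
      unfolding Z_def by (intro mult_left_mono pattern_count_mgf A n E t) auto
    also have "(2 :: real) ^ card (E r) = exp (ln 2 * real (card (E r)))"
      by (simp add: exp_of_nat2_mult)
    also have "exp (t * (c r / 2 ^ card A)) * (exp (ln 2 * real (card (E r))) * exp ((t * real n)\<^sup>2 * real N))
        = exp (t * (c r / 2 ^ card A) + ln 2 * real (card (E r)) + (t * real n)\<^sup>2 * real N)"
      by (simp add: exp_add)
    also have "\<dots> \<le> exp R"
    proof -
      have "t * (c r / 2 ^ card A) - t * (real N * sieve_density B K A / 2 ^ card A)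
          = t * (c r - real N * sieve_density B K A) / 2 ^ card A"
        by (simp add: field_simps)
      also have "\<dots> \<le> \<bar>t * (c r - real N * sieve_density B K A)\<bar> / 2 ^ card A"
        by (intro divide_right_mono) auto
      also have "\<dots> \<le> \<bar>t * (c r - real N * sieve_density B K A)\<bar> / 1"
        by (intro divide_left_mono) auto
      also have "\<dots> \<le> \<bar>t\<bar> * fact K"
        using c[of r] by (simp add: abs_mult mult_left_mono)
      finally have 1: "t * (c r / 2 ^ card A) \<le> t * (real N * sieve_density B K A / 2 ^ card A) + \<bar>t\<bar> * fact K"
        by linarith
      have "ln 2 * real (card (E r)) \<le> ln 2 * (real (N + 2 * M + 1) * sieve_density B K {0} + fact K)"
        by (intro mult_left_mono card_E) auto
      then show ?thesis using 1 unfolding R_def exp_le_cancel_iff by linarith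
    qed
    finally show ?thesis .
  qed
  then have "(\<Sum>r<fact K. \<Sum>w\<in>Pow (E r). exp (t * (\<Sum>j<N. of_bool (translate A j \<subseteq> w)))) \<le> (\<Sum>r<(fact K :: nat). exp R)"
    by (intro sum_mono)
  then have "(\<Sum>w\<in>sieve_words B K (positions M N). exp (t * (\<Sum>j<N. of_bool (translate A j \<subseteq> w)))) \<le> (\<Sum>r<(fact K :: nat). exp R)"
    using sum_UN_le[of "{..<fact K}" "\<lambda>r. Pow (E r)" "\<lambda>w. exp (t * (\<Sum>j<N. of_bool (translate A j \<subseteq> w)))"] E
    unfolding sieve_words_def E_def by auto
  also have "\<dots> = exp (ln (fact K) + R)" by (simp add: exp_add)
  finally show ?thesis by (simp add: R_def ac_simps)
qed

lemma pressure_rate: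
  "(\<lambda>N. (ln (fact K) + ln 2 * (real (N + 2 * M + 1) * d + fact K)
        + t * (real N * g) + \<bar>t\<bar> * fact K + e * real N) / real N)
     \<longlonglongrightarrow> ln 2 * d + t * g + e"
proof -
  define C where "C = ln (fact K) + ln 2 * (real (2 * M + 1) * d + fact K) + \<bar>t\<bar> * fact K"
  have "(\<lambda>N. C * (1 / real N) + (ln 2 * d + t * g + e)) \<longlonglongrightarrow> C * 0 + (ln 2 * d + t * g + e)"
    by (intro tendsto_intros lim_1_over_n)
  moreover have "\<forall>\<^sub>F N in sequentially. C * (1 / real N) + (ln 2 * d + t * g + e)
      = (ln (fact K) + ln 2 * (real (N + 2 * M + 1) * d + fact K)
        + t * (real N * g) + \<bar>t\<bar> * fact K + e * real N) / real N"
    using eventually_gt_at_top[of 0]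
  proof eventually_elim
    case (elim N)
    then show ?case by (simp add: C_def field_simps)
  qed
  ultimately show ?thesis by (simp add: Lim_transform_eventually)
qed

lemma word_in_sieve_words:
  assumes "B \<subseteq> {1..}" "x \<in> X_tilde B"
  shows "{i\<in>W. x i} \<in> sieve_words B K W"
  using X_tilde_le_sieve[OF assms, of K] by (auto simp: sieve_words_def)

section \<open>The upper bound for Kolmogorov entropy\<close>

text \<open>
  Each atom of \<open>l\<close> is approximated by a windowed set \<open>G c\<close>, and \<open>lab\<close> picks some \<open>c\<close> with
  \<open>x \<in> G c\<close>. If the chosen label is wrong, then \<open>x\<close> is missing from the approximation of its own
  atom or lies in that of another atom. Either way an approximation fails at \<open>x\<close>.
\<close>

lemma windowed_labels:
  fixes \<mu> :: "(int \<Rightarrow> bool) measure"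
  assumes \<mu>: "invariant_prob T X \<mu>" and l: "simple_function \<mu> l" and \<delta>: "0 < \<delta>"
  obtains M lab where "\<And>x y. y \<in> window M x \<Longrightarrow> lab y = lab x" "\<And>x. lab x \<in> l ` X"
    "measure \<mu> {x\<in>X. l x \<noteq> lab x} \<le> \<delta>"
proof -
  interpret measure_preserving \<mu> T using invariant_probD(4)[OF \<mu>] .
  have sp: "space \<mu> = X" by (rule invariant_probD(1)[OF \<mu>])
  define L where "L = l ` X"
  have L: "finite L" using simple_functionD(1)[OF l] by (simp add: L_def sp)
  have "X \<noteq> {}" using not_empty by (simp add: sp)
  then have L0: "card L > 0" using L by (simp add: card_gt_0_iff L_def)
  define Q where "Q = (\<lambda>c C M G. C \<in> sets borel \<and> l -` {c} \<inter> X = C \<inter> X \<and> windowed M G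
      \<and> measure \<mu> {x\<in>X. (x \<in> C) \<noteq> (x \<in> G)} < \<delta> / real (card L))"
  have "\<exists>C M G. Q c C M G" for c
  proof -
    have "\<exists>C\<in>sets borel. l -` {c} \<inter> X = C \<inter> X"
      using invariant_probD(3)[OF \<mu> simple_image_fibre[OF l, of c]] by (simp add: sp)
    then obtain C where C: "C \<in> sets borel" "l -` {c} \<inter> X = C \<inter> X" by blast
    have "\<exists>M G. windowed M G \<and> measure \<mu> {x\<in>X. (x \<in> C) \<noteq> (x \<in> G)} < \<delta> / real (card L)"
      using \<mu> L0 \<delta> C(1) by (intro windowed_approximation) (auto simp: invariant_prob_def)
    then show ?thesis using C by (auto simp: Q_def)
  qed
  then obtain C M0 G where Q: "\<And>c. Q c (C c) (M0 c) (G c)" by metis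
  define M where "M = Max (M0 ` L)"
  have G: "windowed M (G c)" if "c \<in> L" for c
    using Q[of c] that L unfolding Q_def M_def by (blast intro: windowed_mono Max_ge finite_imageI imageI)
  obtain c0 where c0: "c0 \<in> L" using L0 by (metis all_not_in_conv card.empty less_numeral_extra(3))
  define lab where "lab = (\<lambda>x. if \<exists>c\<in>L. x \<in> G c then SOME c. c \<in> L \<and> x \<in> G c else c0)"
  have lab: "lab x \<in> L \<and> x \<in> G (lab x)" if "c \<in> L" "x \<in> G c" for x c
  proof -
    have "\<exists>c. c \<in> L \<and> x \<in> G c" using that by blast
    from someI_ex[OF this] show ?thesis using that by (auto simp: lab_def)
  qed
  show thesis
  proof (rule that)
    fix x y assume y: "y \<in> window M x"
    have "x \<in> G c \<longleftrightarrow> y \<in> G c" if "c \<in> L" for c using G[OF that] y unfolding windowed_def by blast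
    then have "(\<lambda>c. c \<in> L \<and> x \<in> G c) = (\<lambda>c. c \<in> L \<and> y \<in> G c)" by blast
    then show "lab y = lab x" unfolding lab_def Bex_def by presburger
  next
    fix x
    show "lab x \<in> l ` X"
    proof (cases "\<exists>c\<in>L. x \<in> G c")
      case True
      then show ?thesis using lab[of _ x] unfolding L_def by blast
    next
      case False
      then have "lab x = c0" by (simp add: lab_def)
      then show ?thesis using c0 by (simp add: L_def)
    qed
  next
    have sets: "{x\<in>X. (x \<in> C c) \<noteq> (x \<in> G c)} \<in> sets \<mu>" for c
    proof -
      have "(C c - G c \<union> (G c - C c)) \<inter> X \<in> sets \<mu>"
        using Q[of c] windowed_open[of "M0 c" "G c"]
        by (intro invariant_probD(2)[OF \<mu>] sets.Un sets.Diff) (auto simp: Q_def)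
      moreover have "(C c - G c \<union> (G c - C c)) \<inter> X = {x\<in>X. (x \<in> C c) \<noteq> (x \<in> G c)}" by auto
      ultimately show ?thesis by simp
    qed
    have iff: "x \<in> C c \<longleftrightarrow> l x = c" if "x \<in> X" for x c using Q[of c] that by (auto simp: Q_def)
    have "{x\<in>X. l x \<noteq> lab x} \<subseteq> (\<Union>c\<in>L. {x\<in>X. (x \<in> C c) \<noteq> (x \<in> G c)})"
    proof
      fix x assume x: "x \<in> {x\<in>X. l x \<noteq> lab x}"
      then have lx: "l x \<in> L" by (auto simp: L_def)
      show "x \<in> (\<Union>c\<in>L. {x\<in>X. (x \<in> C c) \<noteq> (x \<in> G c)})"
      proof (cases "x \<in> G (l x)")
        case True
        then show ?thesis using lab[OF lx] x iff by blast
      next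
        case False
        then show ?thesis using lx x iff by blast
      qed
    qed
    then have "measure \<mu> {x\<in>X. l x \<noteq> lab x} \<le> measure \<mu> (\<Union>c\<in>L. {x\<in>X. (x \<in> C c) \<noteq> (x \<in> G c)})"
      using sets L by (intro finite_measure_mono sets.finite_UN) auto
    also have "\<dots> \<le> (\<Sum>c\<in>L. measure \<mu> {x\<in>X. (x \<in> C c) \<noteq> (x \<in> G c)})"
      using sets L by (intro finite_measure_subadditive_finite) auto
    also have "\<dots> \<le> (\<Sum>c\<in>L. \<delta> / real (card L))"
      using Q by (intro sum_mono) (auto simp: Q_def intro: less_imp_le)
    also have "\<dots> = \<delta>" using L0 by simp
    finally show "measure \<mu> {x\<in>X. l x \<noteq> lab x} \<le> \<delta>" .
  qed
qed

lemma simple_function_windowed: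
  assumes \<mu>: "invariant_prob T X \<mu>" and V: "\<And>x y. y \<in> window M x \<Longrightarrow> V y = V x" and fin: "finite (V ` X)"
  shows "simple_function \<mu> V"
  unfolding simple_function_def
proof (intro conjI ballI)
  have sp: "space \<mu> = X" by (rule invariant_probD(1)[OF \<mu>])
  show "finite (V ` space \<mu>)" using fin by (simp add: sp)
  fix c
  have "windowed M (V -` {c})" using V by (auto simp: windowed_def)
  then have "V -` {c} \<in> sets borel" using windowed_open by simp
  then show "V -` {c} \<inter> space \<mu> \<in> sets \<mu>" unfolding sp by (rule invariant_probD(2)[OF \<mu>])
qed

text \<open>
  Gibbs' inequality for the pair of the itinerary and the word of \<open>x\<close>. The weight of a pair is
  \<open>exp\<close> of \<open>t\<close> times the number of occurrences of \<open>A\<close> in the word, times a factor \<open>\<kappa>\<close> for each step,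
  which compares the label of the itinerary with the label \<open>lab\<close> that is read off the word. For a
  given word the products of the factors \<open>\<kappa>\<close> have total at most \<open>1\<close>, so only the weighted count of
  the words remains. The expected logarithm of \<open>\<kappa>\<close> is close to \<open>0\<close> for small \<open>\<delta>\<close>. In this way an
  arbitrary partition is as good as one into cylinders, as in the theorem of Kolmogorov and
  Sinai.
\<close>

lemma itinerary_entropy_le_pressure:
  fixes t :: real and l :: "(int \<Rightarrow> bool) \<Rightarrow> 'l"
  assumes B: "B \<subseteq> {1..}" and \<mu>: "invariant_prob shift (X_tilde B) \<mu>" and l: "simple_function \<mu> l"
    and AM: "\<And>i. i \<in> A \<Longrightarrow> \<bar>i\<bar> \<le> int M" and \<delta>: "0 < \<delta>" "\<delta> < 1"
    and lab: "\<And>x y. y \<in> window M x \<Longrightarrow> lab y = lab x" "\<And>x. lab x \<in> l ` X_tilde B"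
    and dis: "measure \<mu> {x\<in>X_tilde B. l x \<noteq> lab x} \<le> \<delta>"
  shows "rv_entropy \<mu> (itinerary shift l N)
      + real N * (t * measure \<mu> {x\<in>X_tilde B. \<forall>i\<in>A. x i} + (ln (1 - \<delta>) + \<delta> * ln (\<delta> / real (card (l ` X_tilde B)))))
    \<le> ln (\<Sum>w\<in>sieve_words B K (positions M N). exp (t * (\<Sum>j<N. of_bool (translate A j \<subseteq> w))))"
proof -
  interpret measure_preserving \<mu> shift using invariant_probD(4)[OF \<mu>] .
  define X where "X = X_tilde B"
  have sp: "space \<mu> = X" unfolding X_def by (rule invariant_probD(1)[OF \<mu>])
  have \<mu>X: "invariant_prob shift X \<mu>" using \<mu> by (simp add: X_def)
  define L where "L = l ` X"
  have L: "finite L" using simple_functionD(1)[OF l] by (simp add: L_def sp)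
  have "X \<noteq> {}" using not_empty by (simp add: sp)
  then have L0: "card L > 0" using L by (simp add: card_gt_0_iff L_def)
  define \<kappa> where "\<kappa> = (\<lambda>u v :: 'l. if u = v then 1 - \<delta> else \<delta> / real (card L))"
  have \<kappa>_pos: "0 < \<kappa> u v" for u v using \<delta> L0 by (simp add: \<kappa>_def)
  have \<kappa>_sum: "(\<Sum>u\<in>L. \<kappa> u v) \<le> 1" for v
  proof -
    have "(\<Sum>u\<in>L. \<kappa> u v) \<le> (\<Sum>u\<in>L. (if u = v then 1 - \<delta> else 0) + \<delta> / real (card L))"
      using \<delta> by (intro sum_mono) (auto simp: \<kappa>_def)
    also have "\<dots> \<le> (1 - \<delta>) + \<delta>" using L L0 \<delta> by (simp add: sum.distrib)
    finally show ?thesis by simp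
  qed
  define word where "word = (\<lambda>x. {i\<in>positions M N. x i})"
  define W where "W = sieve_words B K (positions M N)"
  have W: "finite W" unfolding W_def by (intro finite_sieve_words finite_positions)
  define V where "V = (\<lambda>x. (itinerary shift l N x, word x))"
  define I where "I = PiE {..<N} (\<lambda>_. L) \<times> W"
  have I: "finite I" unfolding I_def using W L by (intro finite_cartesian_product finite_PiE) auto
  have word_window: "word y = word x" if "y \<in> window (M + N) x" for x y
    using that by (auto simp: word_def window_def positions_def)
  have "word ` X \<subseteq> W"
    using word_in_sieve_words[OF B] by (auto simp: word_def W_def X_def)
  then have word_simple: "simple_function \<mu> word"
    using W by (intro simple_function_windowed[OF \<mu>X word_window]) (auto intro: finite_subset)
  have V: "simple_function \<mu> V"
    unfolding V_def by (intro simple_function_Pair simple_function_itinerary l word_simple)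
  have VI: "V ` space \<mu> \<subseteq> I"
    using \<open>word ` X \<subseteq> W\<close> funpow_space
    by (auto simp: V_def I_def itinerary_def sp L_def split: if_splits)
  define lab' where "lab' = (\<lambda>w j. lab (\<lambda>i. i + int j \<in> w))"
  define f where "f = (\<lambda>(u, w). t * (\<Sum>j<N. of_bool (translate A j \<subseteq> w)) + (\<Sum>j<N. ln (\<kappa> (u j) (lab' w j))))"
  have exp_f: "(\<Sum>z\<in>I. exp (f z)) \<le> (\<Sum>w\<in>W. exp (t * (\<Sum>j<N. of_bool (translate A j \<subseteq> w))))"
  proof -
    have "(\<Sum>z\<in>I. exp (f z)) = (\<Sum>w\<in>W. \<Sum>u\<in>PiE {..<N} (\<lambda>_. L). exp (f (u, w)))"
      unfolding I_def by (subst sum.swap) (simp add: sum.cartesian_product)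
    also have "\<dots> = (\<Sum>w\<in>W. exp (t * (\<Sum>j<N. of_bool (translate A j \<subseteq> w))) * (\<Prod>j<N. \<Sum>u\<in>L. \<kappa> u (lab' w j)))"
    proof (rule sum.cong[OF refl])
      fix w
      have "(\<Sum>u\<in>PiE {..<N} (\<lambda>_. L). exp (f (u, w)))
          = (\<Sum>u\<in>PiE {..<N} (\<lambda>_. L). exp (t * (\<Sum>j<N. of_bool (translate A j \<subseteq> w))) * (\<Prod>j<N. \<kappa> (u j) (lab' w j)))"
        by (intro sum.cong refl) (simp add: f_def exp_add exp_sum \<kappa>_pos)
      also have "\<dots> = exp (t * (\<Sum>j<N. of_bool (translate A j \<subseteq> w))) * (\<Prod>j<N. \<Sum>u\<in>L. \<kappa> u (lab' w j))"
        using L by (subst prod_sum_PiE) (auto simp: sum_distrib_left)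
      finally show "(\<Sum>u\<in>PiE {..<N} (\<lambda>_. L). exp (f (u, w)))
        = exp (t * (\<Sum>j<N. of_bool (translate A j \<subseteq> w))) * (\<Prod>j<N. \<Sum>u\<in>L. \<kappa> u (lab' w j))" .
    qed
    also have "\<dots> \<le> (\<Sum>w\<in>W. exp (t * (\<Sum>j<N. of_bool (translate A j \<subseteq> w))))"
    proof (intro sum_mono mult_left_le)
      fix w
      have "0 \<le> (\<Sum>u\<in>L. \<kappa> u v)" for v by (intro sum_nonneg less_imp_le \<kappa>_pos)
      then show "(\<Prod>j<N. \<Sum>u\<in>L. \<kappa> u (lab' w j)) \<le> 1"
        using \<kappa>_sum by (intro prod_le_1) auto
    qed auto
    finally show ?thesis .
  qed
  define g where "g = (\<lambda>x. t * of_bool (\<forall>i\<in>A. x i) + ln (\<kappa> (l x) (lab x)))"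
  have f_V: "f (V x) = (\<Sum>j<N. g ((shift ^^ j) x))" if "x \<in> space \<mu>" for x
  proof -
    have "translate A j \<subseteq> word x \<longleftrightarrow> (\<forall>i\<in>A. (shift ^^ j) x i)" if "j < N" for j
    proof -
      have "i + int j \<in> positions M N" if "i \<in> A" for i
        using AM[OF that] \<open>j < N\<close> by (auto simp: positions_def)
      then show ?thesis by (auto simp: word_def shift_funpow_apply)
    qed
    moreover have "lab' (word x) j = lab ((shift ^^ j) x)" if "j < N" for j
      unfolding lab'_def
      by (rule lab(1)) (use that in \<open>auto simp: window_def word_def positions_def shift_funpow_apply\<close>)
    ultimately have "(\<Sum>j<N. g ((shift ^^ j) x))
        = (\<Sum>j<N. t * of_bool (translate A j \<subseteq> word x) + ln (\<kappa> (itinerary shift l N x j) (lab' (word x) j)))"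
      by (intro sum.cong) (auto simp: g_def itinerary_def)
    then show ?thesis
      by (simp only: f_def V_def prod.case sum.distrib sum_distrib_left)
  qed
  define D where "D = {x\<in>X. l x \<noteq> lab x}"
  define P where "P = {x\<in>X. \<forall>i\<in>A. x i}"
  have lab_simple: "simple_function \<mu> lab"
    using lab L by (intro simple_function_windowed[OF \<mu>X lab(1)]) (auto intro: finite_subset simp: X_def L_def)
  have "simple_function \<mu> (\<lambda>x. (l x, lab x))" by (intro simple_function_Pair l lab_simple)
  then have "simple_function \<mu> (\<lambda>x. (\<lambda>(a, b). ln (\<kappa> a b)) (l x, lab x))" by (rule simple_function_compose1)
  then have meas_\<kappa>: "(\<lambda>x. ln (\<kappa> (l x) (lab x))) \<in> borel_measurable \<mu>"
    by (auto dest: borel_measurable_simple_function)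
  have D: "D \<in> sets \<mu>"
  proof -
    have "simple_function \<mu> (\<lambda>x. (\<lambda>(a, b). a \<noteq> b) (l x, lab x))"
      by (rule simple_function_compose1) (intro simple_function_Pair l lab_simple)
    from simple_image_fibre[OF this, of True] show ?thesis
      by (rule back_subst[where P = "\<lambda>S. S \<in> sets \<mu>"]) (auto simp: D_def sp)
  qed
  have P: "P \<in> sets \<mu>"
  proof -
    have "windowed M {x. \<forall>i\<in>A. x i}" using AM by (auto simp: windowed_def window_def)
    then have "{x. \<forall>i\<in>A. x i} \<in> sets borel" using windowed_open by simp
    from invariant_probD(2)[OF \<mu>X this] show ?thesis
      by (rule back_subst[where P = "\<lambda>S. S \<in> sets \<mu>"]) (auto simp: P_def)
  qed
  have int_ind: "integrable \<mu> (\<lambda>x. c * indicat_real S x)" if "S \<in> sets \<mu>" for c S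
    using that by (intro integrable_mult_right) (auto simp: emeasure_eq_measure)
  have g_eq: "g x = t * indicator P x + ln (\<kappa> (l x) (lab x))" if "x \<in> space \<mu>" for x
    using that by (auto simp: g_def P_def sp)
  have int_\<kappa>: "integrable \<mu> (\<lambda>x. ln (\<kappa> (l x) (lab x)))"
  proof (rule integrable_const_bound[where B = "\<bar>ln (1 - \<delta>)\<bar> + \<bar>ln (\<delta> / real (card L))\<bar>"])
    show "AE x in \<mu>. norm (ln (\<kappa> (l x) (lab x))) \<le> \<bar>ln (1 - \<delta>)\<bar> + \<bar>ln (\<delta> / real (card L))\<bar>"
      by (auto simp: \<kappa>_def)
  qed (rule meas_\<kappa>)
  have int_g: "integrable \<mu> g"
    using int_ind[OF P, of t] int_\<kappa>
    by (subst Bochner_Integration.integrable_cong[OF refl g_eq]) (auto intro: Bochner_Integration.integrable_add)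
  have "expectation g = t * prob P + expectation (\<lambda>x. ln (\<kappa> (l x) (lab x)))"
    using int_ind[OF P, of t] int_\<kappa> P
    by (subst Bochner_Integration.integral_cong[OF refl g_eq]) (auto simp: Bochner_Integration.integral_add)
  moreover have "ln (1 - \<delta>) + \<delta> * ln (\<delta> / real (card L)) \<le> expectation (\<lambda>x. ln (\<kappa> (l x) (lab x)))"
  proof -
    have neg: "ln (1 - \<delta>) \<le> 0" "ln (\<delta> / real (card L)) \<le> 0"
      using \<delta> L0 by (auto simp: ln_le_zero_iff divide_le_eq)
    have "ln (1 - \<delta>) + \<delta> * ln (\<delta> / real (card L)) \<le> ln (1 - \<delta>) + prob D * ln (\<delta> / real (card L))"
      using dis neg(2) unfolding D_def X_def by (intro add_left_mono mult_right_mono_neg) auto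
    also have "\<dots> = expectation (\<lambda>x. ln (1 - \<delta>) + ln (\<delta> / real (card L)) * indicator D x)"
      using int_ind[OF D] D by (subst Bochner_Integration.integral_add) (auto simp: prob_space)
    also have "\<dots> \<le> expectation (\<lambda>x. ln (\<kappa> (l x) (lab x)))"
    proof (rule integral_mono[OF _ int_\<kappa>])
      show "integrable \<mu> (\<lambda>x. ln (1 - \<delta>) + ln (\<delta> / real (card L)) * indicator D x)"
        using int_ind[OF D] by (intro Bochner_Integration.integrable_add) auto
      show "ln (1 - \<delta>) + ln (\<delta> / real (card L)) * indicator D x \<le> ln (\<kappa> (l x) (lab x))" if "x \<in> space \<mu>" for x
        using that neg by (auto simp: D_def \<kappa>_def sp)
    qed
    finally show ?thesis .
  qed
  ultimately have g_ge: "t * prob P + (ln (1 - \<delta>) + \<delta> * ln (\<delta> / real (card L))) \<le> expectation g" by linarith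
  have "expectation (\<lambda>x. f (V x)) = expectation (\<lambda>x. \<Sum>j<N. g ((shift ^^ j) x))"
    using f_V by (intro Bochner_Integration.integral_cong) auto
  also have "\<dots> = (\<Sum>j<N. expectation (\<lambda>x. g ((shift ^^ j) x)))"
  proof (rule Bochner_Integration.integral_sum)
    fix j
    have "integrable (distr \<mu> \<mu> (shift ^^ j)) g" using int_g by (simp add: distr_funpow)
    then show "integrable \<mu> (\<lambda>x. g ((shift ^^ j) x))"
      using integrable_distr[OF measurable_funpow] by blast
  qed
  also have "\<dots> = real N * expectation g"
    using int_g by (subst expectation_funpow) auto
  finally have "real N * (t * prob P + (ln (1 - \<delta>) + \<delta> * ln (\<delta> / real (card L)))) \<le> expectation (\<lambda>x. f (V x))"
    using g_ge by (simp add: mult_left_mono)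
  moreover have "rv_entropy \<mu> V + expectation (\<lambda>x. f (V x)) \<le> ln (\<Sum>w\<in>W. exp (t * (\<Sum>j<N. of_bool (translate A j \<subseteq> w))))"
    by (rule rv_entropy_le_ln_weights[OF V I VI exp_f])
  moreover have "rv_entropy \<mu> (itinerary shift l N) \<le> rv_entropy \<mu> V"
    using rv_entropy_mono[OF V, of fst] by (simp add: V_def)
  ultimately show ?thesis unfolding P_def L_def X_def W_def by linarith
qed


text \<open>
  Divide \<open>itinerary_entropy_le_pressure\<close> by \<open>N\<close>, insert \<open>sieve_words_pressure\<close>, and let \<open>N\<close> and \<open>K\<close> tend to infinity and \<open>\<delta>\<close> to \<open>0\<close>, in
  this order.
\<close>

lemma partition_entropy_le_pressure:
  fixes t :: real
  assumes B: "B \<subseteq> {1..}" and \<mu>: "invariant_prob shift (X_tilde B) \<mu>" and P: "measurable_partition \<mu> P"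
    and A: "finite A" "\<And>i i'. i \<in> A \<Longrightarrow> i' \<in> A \<Longrightarrow> i' - i < int n"
    and n: "n > 0" and t: "\<bar>t\<bar> * real n \<le> 1"
  shows "partition_entropy shift \<mu> P \<le> ln 2 * limit_density B {0}
    + t * (limit_density B A / 2 ^ card A - measure \<mu> {x\<in>X_tilde B. \<forall>i\<in>A. x i}) + (t * real n)\<^sup>2"
proof -
  interpret measure_preserving \<mu> shift using invariant_probD(4)[OF \<mu>] .
  have sp: "space \<mu> = X_tilde B" by (rule invariant_probD(1)[OF \<mu>])
  obtain l :: "(int \<Rightarrow> bool) \<Rightarrow> (int \<Rightarrow> bool) set" where l: "P = fibres (space \<mu>) l" "simple_function \<mu> l"
    using measurable_partition_fibres[OF P] by blast
  define \<pi> where "\<pi> = measure \<mu> {x\<in>X_tilde B. \<forall>i\<in>A. x i}"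
  define c where "c = real (card (l ` X_tilde B))"
  have c: "c > 0"
    using simple_functionD(1)[OF l(2)] not_empty by (simp add: c_def sp card_gt_0_iff)
  have bound: "partition_entropy shift \<mu> P + (t * \<pi> + (ln (1 - \<delta>) + \<delta> * ln (\<delta> / c)))
      \<le> ln 2 * sieve_density B K {0} + t * (sieve_density B K A / 2 ^ card A) + (t * real n)\<^sup>2"
    if \<delta>: "0 < \<delta>" "\<delta> < 1" for \<delta> K
  proof -
    obtain M0 lab where lab: "\<And>x y. y \<in> window M0 x \<Longrightarrow> lab y = lab x" "\<And>x. lab x \<in> l ` X_tilde B"
      "measure \<mu> {x\<in>X_tilde B. l x \<noteq> lab x} \<le> \<delta>"
      using windowed_labels[OF \<mu> l(2) \<delta>(1)] by blast
    define M where "M = Max (insert M0 ((\<lambda>i. nat \<bar>i\<bar>) ` A))"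
    have M0: "M0 \<le> M" unfolding M_def using A(1) by (intro Max_ge) auto
    have AM: "\<bar>i\<bar> \<le> int M" if "i \<in> A" for i
    proof -
      have "nat \<bar>i\<bar> \<le> M" unfolding M_def using A(1) that by (intro Max_ge) auto
      then show ?thesis by simp
    qed
    have lab_M: "lab y = lab x" if "y \<in> window M x" for x y
      using that window_antimono[OF M0] lab(1) by blast
    define R where "R = (\<lambda>N. ln (fact K) + ln 2 * (real (N + 2 * M + 1) * sieve_density B K {0} + fact K)
        + t * (real N * (sieve_density B K A / 2 ^ card A)) + \<bar>t\<bar> * fact K + (t * real n)\<^sup>2 * real N)"
    have le: "rv_entropy \<mu> (itinerary shift l N) + real N * (t * \<pi> + (ln (1 - \<delta>) + \<delta> * ln (\<delta> / c))) \<le> R N" for N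
    proof -
      let ?S = "\<Sum>w\<in>sieve_words B K (positions M N). exp (t * (\<Sum>j<N. of_bool (translate A j \<subseteq> w)))"
      obtain x where x: "x \<in> X_tilde B" using not_empty by (auto simp: sp)
      have "0 < ?S"
        using word_in_sieve_words[OF B x, of "positions M N" K]
        by (intro sum_pos finite_sieve_words finite_positions) auto
      moreover have "?S \<le> exp (R N)"
        using sieve_words_pressure[where K = K and N = N, OF B A n AM t] by (simp add: R_def)
      ultimately have "ln ?S \<le> R N" by (metis ln_le_cancel_iff exp_gt_zero ln_exp)
      moreover have "rv_entropy \<mu> (itinerary shift l N) + real N * (t * \<pi> + (ln (1 - \<delta>) + \<delta> * ln (\<delta> / c))) \<le> ln ?S"
        unfolding \<pi>_def c_def by (rule itinerary_entropy_le_pressure[OF B \<mu> l(2) AM \<delta> lab_M lab(2,3)])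
      ultimately show ?thesis by linarith
    qed
    have "(\<lambda>N. rv_entropy \<mu> (itinerary shift l N) / real N + (t * \<pi> + (ln (1 - \<delta>) + \<delta> * ln (\<delta> / c))))
        \<longlonglongrightarrow> partition_entropy shift \<mu> P + (t * \<pi> + (ln (1 - \<delta>) + \<delta> * ln (\<delta> / c)))"
      unfolding l(1) by (intro tendsto_intros partition_entropy_tendsto l(2))
    moreover have "(\<lambda>N. R N / real N)
        \<longlonglongrightarrow> ln 2 * sieve_density B K {0} + t * (sieve_density B K A / 2 ^ card A) + (t * real n)\<^sup>2"
      unfolding R_def by (rule pressure_rate)
    moreover have "\<exists>N0. \<forall>N\<ge>N0. rv_entropy \<mu> (itinerary shift l N) / real N + (t * \<pi> + (ln (1 - \<delta>) + \<delta> * ln (\<delta> / c))) \<le> R N / real N"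
    proof (intro exI[of _ 1] allI impI)
      fix N :: nat assume "N \<ge> 1"
      then show "rv_entropy \<mu> (itinerary shift l N) / real N + (t * \<pi> + (ln (1 - \<delta>) + \<delta> * ln (\<delta> / c))) \<le> R N / real N"
        using divide_right_mono[OF le[of N], of "real N"] by (simp only: add_divide_distrib) simp
    qed
    ultimately show ?thesis by (rule LIMSEQ_le)
  qed
  have bound': "partition_entropy shift \<mu> P + (t * \<pi> + (ln (1 - \<delta>) + \<delta> * ln (\<delta> / c)))
      \<le> ln 2 * limit_density B {0} + t * (limit_density B A / 2 ^ card A) + (t * real n)\<^sup>2"
    if \<delta>: "0 < \<delta>" "\<delta> < 1" for \<delta>
  proof (rule LIMSEQ_le_const)
    show "(\<lambda>K. ln 2 * sieve_density B K {0} + t * (sieve_density B K A / 2 ^ card A) + (t * real n)\<^sup>2)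
        \<longlonglongrightarrow> ln 2 * limit_density B {0} + t * (limit_density B A / 2 ^ card A) + (t * real n)\<^sup>2"
      by (intro tendsto_intros sieve_density_tendsto[OF B]) auto
  qed (use bound[OF \<delta>] in blast)
  \<comment> \<open>Take \<open>\<delta> = 1 / m\<close>.\<close>
  have "(\<lambda>m. ln (1 - 1 / real m) - ln (real m) / real m - ln c * (1 / real m)) \<longlonglongrightarrow> ln (1 - 0) - 0 - ln c * 0"
    by (intro tendsto_intros lim_1_over_n lim_ln_over_n) auto
  moreover have "\<forall>\<^sub>F m in sequentially. ln (1 - 1 / real m) - ln (real m) / real m - ln c * (1 / real m)
      = ln (1 - 1 / real m) + 1 / real m * ln (1 / real m / c)"
    using eventually_gt_at_top[of 0]
    by eventually_elim (use c in \<open>simp add: ln_div ln_mult field_simps\<close>)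
  ultimately have "(\<lambda>m. ln (1 - 1 / real m) + 1 / real m * ln (1 / real m / c)) \<longlonglongrightarrow> 0"
    by (simp add: Lim_transform_eventually)
  then have "(\<lambda>m. partition_entropy shift \<mu> P + (t * \<pi> + (ln (1 - 1 / real m) + 1 / real m * ln (1 / real m / c))))
      \<longlonglongrightarrow> partition_entropy shift \<mu> P + (t * \<pi> + 0)"
    by (intro tendsto_intros)
  then have "partition_entropy shift \<mu> P + (t * \<pi> + 0)
      \<le> ln 2 * limit_density B {0} + t * (limit_density B A / 2 ^ card A) + (t * real n)\<^sup>2"
    by (rule LIMSEQ_le_const2) (intro exI[of _ 2] allI impI bound', auto)
  then show ?thesis by (simp add: \<pi>_def algebra_simps)
qed

lemma kolmogorov_entropy_le_pressure:
  fixes t :: real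
  assumes "B \<subseteq> {1..}" "invariant_prob shift (X_tilde B) \<mu>"
    and "finite A" "\<And>i i'. i \<in> A \<Longrightarrow> i' \<in> A \<Longrightarrow> i' - i < int n" "n > 0" "\<bar>t\<bar> * real n \<le> 1"
  shows "kolmogorov_entropy shift \<mu> \<le> ereal (ln 2 * limit_density B {0}
    + t * (limit_density B A / 2 ^ card A - measure \<mu> {x\<in>X_tilde B. \<forall>i\<in>A. x i}) + (t * real n)\<^sup>2)"
  unfolding kolmogorov_entropy_def
  using partition_entropy_le_pressure[OF assms(1,2) _ assms(3-)] by (intro SUP_least) auto

lemma kolmogorov_entropy_le:
  assumes "B \<subseteq> {1..}" "invariant_prob shift (X_tilde B) \<mu>"
  shows "kolmogorov_entropy shift \<mu> \<le> ereal (ln 2 * limit_density B {0})"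
  using kolmogorov_entropy_le_pressure[OF assms, of "{}" 1 0] by simp

text \<open>
  If the entropy attains the bound at \<open>t = 0\<close>, then the linear term in \<open>t\<close> of the bound must vanish,
  because \<open>t\<close> may have either sign.
\<close>

lemma maximal_entropy_pattern:
  assumes B: "B \<subseteq> {1..}" and \<mu>: "invariant_prob shift (X_tilde B) \<mu>"
    and max: "kolmogorov_entropy shift \<mu> = ereal (ln 2 * limit_density B {0})" and A: "finite A"
  shows "measure \<mu> {x\<in>X_tilde B. \<forall>i\<in>A. x i} = limit_density B A / 2 ^ card A"
proof -
  define D where "D = limit_density B A / 2 ^ card A - measure \<mu> {x\<in>X_tilde B. \<forall>i\<in>A. x i}"
  \<comment> \<open>exceeds the diameter of \<open>A\<close>\<close>
  define n where "n = Suc (nat (Max (insert 0 ((\<lambda>(i, j). j - i) ` (A \<times> A)))))"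
  have n: "n > 0" by (simp add: n_def)
  have diff: "j - i < int n" if "i \<in> A" "j \<in> A" for i j
  proof -
    have "j - i \<le> Max (insert 0 ((\<lambda>(i, j). j - i) ` (A \<times> A)))"
      using A that by (intro Max_ge) auto
    then show ?thesis by (simp add: n_def)
  qed
  have le: "0 \<le> t * D + (t * real n)\<^sup>2" if "\<bar>t\<bar> * real n \<le> 1" for t
    using kolmogorov_entropy_le_pressure[OF B \<mu> A diff n that] unfolding max D_def[symmetric] by simp
  have "D = 0"
  proof (rule ccontr)
    assume D: "D \<noteq> 0"
    \<comment> \<open>small enough for \<open>s \<bar>D\<bar>\<close> to exceed the quadratic term; the sign of \<open>t\<close> is opposite to that of \<open>D\<close>\<close>
    define s where "s = min (1 / real n) (\<bar>D\<bar> / (2 * (real n)\<^sup>2))"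
    have s: "0 < s" using D n by (simp add: s_def)
    have "s * real n \<le> 1 / real n * real n" unfolding s_def using n by (intro mult_right_mono) auto
    then have s1: "s * real n \<le> 1" using n by simp
    have "s * (real n)\<^sup>2 \<le> \<bar>D\<bar> / (2 * (real n)\<^sup>2) * (real n)\<^sup>2" unfolding s_def by (intro mult_right_mono) auto
    then have s2: "s * (real n)\<^sup>2 \<le> \<bar>D\<bar> / 2" using n by simp
    have "0 \<le> (- sgn D * s) * D + (- sgn D * s * real n)\<^sup>2"
      using s s1 D by (intro le) (simp add: abs_mult abs_sgn_eq)
    also have "\<dots> = s * (s * (real n)\<^sup>2 - \<bar>D\<bar>)"
      using D by (simp add: power_mult_distrib power2_eq_square abs_sgn algebra_simps sgn_if)
    also have "\<dots> < 0" using s s2 D by (intro mult_pos_neg) auto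
    finally show False by simp
  qed
  then show ?thesis by (simp add: D_def)
qed

section \<open>Topological entropy\<close>

definition has_finite_subcover :: "'a set \<Rightarrow> 'a set set \<Rightarrow> bool" where
  "has_finite_subcover X C \<longleftrightarrow> (\<exists>D\<subseteq>C. finite D \<and> X \<subseteq> \<Union>D)"

lemma min_subcover_le:
  assumes "D \<subseteq> C" "finite D" "X \<subseteq> \<Union>D"
  shows "min_subcover X C \<le> card D"
  unfolding min_subcover_def by (rule Least_le) (use assms in blast)

lemma min_subcover_attained:
  assumes "has_finite_subcover X C"
  obtains D where "D \<subseteq> C" "finite D" "card D = min_subcover X C" "X \<subseteq> \<Union>D"
proof -
  have "\<exists>k. \<exists>D\<subseteq>C. finite D \<and> card D = k \<and> X \<subseteq> \<Union>D"
    using assms by (auto simp: has_finite_subcover_def)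
  from LeastI_ex[OF this] show thesis
    unfolding min_subcover_def[symmetric] using that by blast
qed

lemma min_subcover_pos:
  assumes "has_finite_subcover X C" "X \<noteq> {}"
  shows "0 < min_subcover X C"
proof -
  obtain D where D: "finite D" "card D = min_subcover X C" "X \<subseteq> \<Union>D"
    by (rule min_subcover_attained[OF assms(1)])
  then have "D \<noteq> {}" using assms(2) by auto
  then show ?thesis using D by (metis card_gt_0_iff)
qed

text \<open>
  Intersect the members of an optimal cover for the first \<open>m\<close> steps with the preimages under the
  \<open>m\<close>-th iterate of the members of an optimal cover for \<open>n\<close> steps.
\<close>

lemma min_subcover_iterated_join_add:
  assumes T: "\<And>x. x \<in> X \<Longrightarrow> T x \<in> X" and fin: "\<And>n. has_finite_subcover X (iterated_join T X C n)"
  shows "min_subcover X (iterated_join T X C (m + n))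
    \<le> min_subcover X (iterated_join T X C m) * min_subcover X (iterated_join T X C n)"
proof -
  obtain D where D: "D \<subseteq> iterated_join T X C m" "finite D" "card D = min_subcover X (iterated_join T X C m)" "X \<subseteq> \<Union>D"
    by (rule min_subcover_attained[OF fin])
  obtain E where E: "E \<subseteq> iterated_join T X C n" "finite E" "card E = min_subcover X (iterated_join T X C n)" "X \<subseteq> \<Union>E"
    by (rule min_subcover_attained[OF fin])
  define h where "h = (\<lambda>(S, R). S \<inter> {x\<in>X. (T ^^ m) x \<in> R})"
  have "h ` (D \<times> E) \<subseteq> iterated_join T X C (m + n)"
  proof
    fix Q assume "Q \<in> h ` (D \<times> E)"
    then obtain S R where SR: "S \<in> iterated_join T X C m" "R \<in> iterated_join T X C n" "Q = h (S, R)"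
      using D(1) E(1) by blast
    then obtain a b where a: "S = {x\<in>X. \<forall>i<m. (T ^^ i) x \<in> a i}" "\<forall>i<m. a i \<in> C"
      and b: "R = {x\<in>X. \<forall>i<n. (T ^^ i) x \<in> b i}" "\<forall>i<n. b i \<in> C"
      unfolding iterated_join_eq by blast
    define c where "c = (\<lambda>i. if i < m then a i else b (i - m))"
    have "Q = {x\<in>X. \<forall>i<m + n. (T ^^ i) x \<in> c i}"
    proof (intro set_eqI)
      fix x
      have split: "(\<forall>i<m + n. (T ^^ i) x \<in> c i) \<longleftrightarrow> (\<forall>i<m. (T ^^ i) x \<in> a i) \<and> (\<forall>i<n. (T ^^ i) ((T ^^ m) x) \<in> b i)"
      proof (intro iffI conjI allI impI)
        fix i assume h: "\<forall>i<m + n. (T ^^ i) x \<in> c i"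
        show "(T ^^ i) x \<in> a i" if "i < m" using h[rule_format, of i] that by (simp add: c_def)
        show "(T ^^ i) ((T ^^ m) x) \<in> b i" if "i < n"
          using h[rule_format, of "i + m"] that by (simp add: c_def funpow_add)
      next
        fix i assume h: "(\<forall>i<m. (T ^^ i) x \<in> a i) \<and> (\<forall>i<n. (T ^^ i) ((T ^^ m) x) \<in> b i)" and i: "i < m + n"
        show "(T ^^ i) x \<in> c i"
        proof (cases "i < m")
          case False
          have "(T ^^ (i - m)) ((T ^^ m) x) = (T ^^ i) x"
            using False by (metis add_diff_inverse_nat add.commute comp_apply funpow_add)
          moreover have "(T ^^ (i - m)) ((T ^^ m) x) \<in> b (i - m)" using h i False by auto
          ultimately show ?thesis using False by (simp add: c_def)
        qed (use h in \<open>auto simp: c_def\<close>)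
      qed
      show "x \<in> Q \<longleftrightarrow> x \<in> {x\<in>X. \<forall>i<m + n. (T ^^ i) x \<in> c i}"
        using funpow_in[where T = T and X = X, OF T, of x m] by (auto simp: SR(3) h_def a(1) b(1) split)
    qed
    moreover have "\<forall>i<m + n. c i \<in> C" using a(2) b(2) by (auto simp: c_def)
    ultimately show "Q \<in> iterated_join T X C (m + n)"
      unfolding iterated_join_eq by (intro CollectI exI[of _ c] conjI)
  qed
  moreover have "X \<subseteq> \<Union>(h ` (D \<times> E))"
  proof
    fix x assume x: "x \<in> X"
    have "(T ^^ m) x \<in> X" using T x by (rule funpow_in)
    then obtain S R where "S \<in> D" "x \<in> S" "R \<in> E" "(T ^^ m) x \<in> R" using x D(4) E(4) by blast
    then have "(S, R) \<in> D \<times> E" "x \<in> h (S, R)" using x by (auto simp: h_def)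
    then show "x \<in> \<Union>(h ` (D \<times> E))" by blast
  qed
  ultimately have "min_subcover X (iterated_join T X C (m + n)) \<le> card (h ` (D \<times> E))"
    using D(2) E(2) by (intro min_subcover_le) auto
  also have "\<dots> \<le> card (D \<times> E)" using D(2) E(2) by (intro card_image_le) auto
  finally show ?thesis using D(3) E(3) by (simp add: card_cartesian_product)
qed

lemma cover_entropy_tendsto:
  assumes T: "\<And>x. x \<in> X \<Longrightarrow> T x \<in> X" and fin: "\<And>n. has_finite_subcover X (iterated_join T X C n)" and X: "X \<noteq> {}"
  shows "(\<lambda>n. ln (real (min_subcover X (iterated_join T X C n))) / real n) \<longlonglongrightarrow> cover_entropy T X C"
proof -
  let ?N = "\<lambda>n. real (min_subcover X (iterated_join T X C n))"
  have pos: "1 \<le> ?N n" for n using min_subcover_pos[OF fin X, of n] by simp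
  have "convergent (\<lambda>n. ln (?N n) / real n)"
  proof (rule subadditive_convergent)
    fix m n
    have "?N (m + n) \<le> ?N m * ?N n"
      using min_subcover_iterated_join_add[OF T fin, of m n] by (simp flip: of_nat_mult)
    then have "ln (?N (m + n)) \<le> ln (?N m * ?N n)" using pos[of "m + n"] by (intro ln_mono) auto
    also have "\<dots> = ln (?N m) + ln (?N n)" using pos[of m] pos[of n] by (intro ln_mult_pos) auto
    finally show "ln (?N (m + n)) \<le> ln (?N m) + ln (?N n)" .
  qed (use pos in auto)
  then show ?thesis unfolding cover_entropy_def convergent_LIMSEQ_iff .
qed

text \<open>
  The Lebesgue number lemma, with windows in place of balls.
\<close>

lemma cover_lebesgue_window:
  assumes X: "compact X" and C: "open_cover X C"
  obtains M where "\<And>x. x \<in> X \<Longrightarrow> \<exists>U\<in>C. window M x \<inter> X \<subseteq> U"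
proof -
  have "\<exists>m. \<exists>U\<in>C. window m x \<inter> X \<subseteq> U" if x: "x \<in> X" for x
  proof -
    obtain U where U: "U \<in> C" "x \<in> U" "openin (top_of_set X) U" using C x by (auto simp: open_cover_def)
    then obtain V where V: "open V" "U = X \<inter> V" by (auto simp: openin_open)
    then obtain m where "window m x \<subseteq> V" using open_contains_window[of V x] U by blast
    then show ?thesis using U V by blast
  qed
  then obtain m where m: "\<And>x. x \<in> X \<Longrightarrow> \<exists>U\<in>C. window (m x) x \<inter> X \<subseteq> U" by metis
  obtain F where F: "F \<subseteq> X" "finite F" "X \<subseteq> (\<Union>x\<in>F. window (m x) x)"
    by (rule compactE_image[OF X, of X "\<lambda>x. window (m x) x"]) (use open_window window_refl in auto)
  define M where "M = Max (insert 0 (m ` F))"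
  show thesis
  proof (rule that)
    fix x assume "x \<in> X"
    then obtain y where y: "y \<in> F" "x \<in> window (m y) y" using F(3) by blast
    have "m y \<le> M" unfolding M_def using F(2) y(1) by (intro Max_ge) auto
    then have "window M x \<subseteq> window (m y) x" by (rule window_antimono)
    also have "\<dots> = window (m y) y" using y(2) by (auto simp: window_def)
    finally show "\<exists>U\<in>C. window M x \<inter> X \<subseteq> U" using m[of y] y(1) F(1) by blast
  qed
qed

lemma card_sieve_words_le:
  assumes B: "B \<subseteq> {1..}"
  shows "real (card (sieve_words B K (positions M N)))
    \<le> exp (ln (fact K) + ln 2 * (real (N + 2 * M + 1) * sieve_density B K {0} + fact K))"
  using sieve_words_pressure[where K = K and N = N and M = M and A = "{}" and n = 1 and t = 0, OF B] by simp

text \<open>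
  Points with the same word on \<open>positions M n\<close> share their windows of radius \<open>M\<close> at the times below
  \<open>n\<close>, so one member of the iterated cover contains all of them.
\<close>

lemma iterated_cover_subcover:
  assumes B: "B \<subseteq> {1..}" and X: "X = X_tilde B" and M: "\<And>x. x \<in> X \<Longrightarrow> \<exists>U\<in>C. window M x \<inter> X \<subseteq> U"
  shows "\<exists>D\<subseteq>iterated_join shift X C n. finite D \<and> X \<subseteq> \<Union>D \<and> card D \<le> card (sieve_words B K (positions M n))"
proof -
  obtain U where U: "\<And>x. x \<in> X \<Longrightarrow> U x \<in> C \<and> window M x \<inter> X \<subseteq> U x" using M by metis
  define word where "word = (\<lambda>x. {i\<in>positions M n. x i})"
  \<comment> \<open>one representative for each word that occurs\<close>
  define rep where "rep = (\<lambda>w. SOME x. x \<in> X \<and> word x = w)"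
  have rep: "rep (word x) \<in> X" "word (rep (word x)) = word x" if "x \<in> X" for x
    using someI[of "\<lambda>y. y \<in> X \<and> word y = word x" x] that by (auto simp: rep_def)
  define F where "F = (\<lambda>w. {y\<in>X. \<forall>i<n. (shift ^^ i) y \<in> U ((shift ^^ i) (rep w))})"
  have shift_X: "(shift ^^ i) x \<in> X" if "x \<in> X" for i x
    by (rule funpow_in[where X = X]) (use that X_tilde_shift in \<open>auto simp: X\<close>)
  have words: "word ` X \<subseteq> sieve_words B K (positions M n)"
    using word_in_sieve_words[OF B] by (auto simp: word_def X)
  have fin: "finite (sieve_words B K (positions M n))" by (intro finite_sieve_words finite_positions)
  have "F ` word ` X \<subseteq> iterated_join shift X C n"
  proof
    fix S assume "S \<in> F ` word ` X"
    then obtain x where x: "x \<in> X" "S = F (word x)" by blast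
    have "\<forall>i<n. U ((shift ^^ i) (rep (word x))) \<in> C" using U shift_X rep(1)[OF x(1)] by blast
    then show "S \<in> iterated_join shift X C n"
      unfolding iterated_join_eq x(2) F_def by (intro CollectI exI[of _ "\<lambda>i. U ((shift ^^ i) (rep (word x)))"] conjI refl)
  qed
  moreover have "X \<subseteq> \<Union>(F ` word ` X)"
  proof
    fix y assume y: "y \<in> X"
    have "(shift ^^ i) y \<in> U ((shift ^^ i) (rep (word y)))" if i: "i < n" for i
    proof -
      have eq: "j \<in> positions M n \<Longrightarrow> y j = rep (word y) j" for j
        using rep(2)[OF y] by (auto simp: word_def set_eq_iff)
      have "(shift ^^ i) y \<in> window M ((shift ^^ i) (rep (word y)))"
        unfolding window_def shift_funpow_apply
      proof (intro CollectI allI impI)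
        fix j assume "\<bar>j\<bar> \<le> int M"
        then show "y (j + int i) = rep (word y) (j + int i)" using i by (intro eq) (auto simp: positions_def)
      qed
      then show ?thesis using U[OF shift_X[OF rep(1)[OF y]]] shift_X[OF y] by blast
    qed
    then have "y \<in> F (word y)" using y by (simp add: F_def)
    then show "y \<in> \<Union>(F ` word ` X)" using y by blast
  qed
  moreover have "finite (word ` X)" by (rule finite_subset[OF words fin])
  moreover have "card (F ` word ` X) \<le> card (sieve_words B K (positions M n))"
    using card_image_le[OF \<open>finite (word ` X)\<close>, of F] card_mono[OF fin words] by linarith
  ultimately show ?thesis by (intro exI[of _ "F ` word ` X"] conjI) simp_all
qed

lemma X_tilde_nonempty: "X_tilde B \<noteq> {}"
  using shift_by_eta_in_X_tilde by blast

lemma iterated_cover_has_finite_subcover: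
  assumes "B \<subseteq> {1..}" "open_cover (X_tilde B) C"
  shows "has_finite_subcover (X_tilde B) (iterated_join shift (X_tilde B) C n)"
proof -
  obtain M where "\<And>x. x \<in> X_tilde B \<Longrightarrow> \<exists>U\<in>C. window M x \<inter> X_tilde B \<subseteq> U"
    using cover_lebesgue_window[OF X_tilde_compact assms(2)] by blast
  from iterated_cover_subcover[OF assms(1) refl this, of n 0] show ?thesis
    by (auto simp: has_finite_subcover_def)
qed

lemma cover_entropy_le:
  assumes B: "B \<subseteq> {1..}" and C: "open_cover (X_tilde B) C"
  shows "cover_entropy shift (X_tilde B) C \<le> ln 2 * limit_density B {0}"
proof -
  define X where "X = X_tilde B"
  obtain M where M: "\<And>x. x \<in> X \<Longrightarrow> \<exists>U\<in>C. window M x \<inter> X \<subseteq> U"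
    using cover_lebesgue_window[OF X_tilde_compact C] unfolding X_def by blast
  have fin: "has_finite_subcover X (iterated_join shift X C n)" for n
    unfolding X_def by (rule iterated_cover_has_finite_subcover[OF B C])
  let ?N = "\<lambda>n. real (min_subcover X (iterated_join shift X C n))"
  have lim: "(\<lambda>n. ln (?N n) / real n) \<longlonglongrightarrow> cover_entropy shift X C"
    by (rule cover_entropy_tendsto[OF _ fin]) (auto simp: X_def X_tilde_shift X_tilde_nonempty)
  have "cover_entropy shift X C \<le> ln 2 * sieve_density B K {0}" for K
  proof -
    define R where "R = (\<lambda>N. ln (fact K) + ln 2 * (real (N + 2 * M + 1) * sieve_density B K {0} + fact K)
        + 0 * (real N * 0) + \<bar>0 :: real\<bar> * fact K + 0 * real N)"
    have "ln (?N n) / real n \<le> R n / real n" for n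
    proof -
      obtain D where D: "D \<subseteq> iterated_join shift X C n" "finite D" "X \<subseteq> \<Union>D" "card D \<le> card (sieve_words B K (positions M n))"
        using iterated_cover_subcover[OF B X_def M, of n K] by blast
      have "?N n \<le> real (card (sieve_words B K (positions M n)))"
        using min_subcover_le[OF D(1-3)] D(4) by simp
      also have "\<dots> \<le> exp (R n)" using card_sieve_words_le[OF B, of K M n] by (simp add: R_def)
      finally have "?N n \<le> exp (R n)" .
      moreover have "0 < ?N n" using min_subcover_pos[OF fin, of n] X_tilde_nonempty by (simp add: X_def)
      ultimately have "ln (?N n) \<le> R n" by (metis ln_le_cancel_iff exp_gt_zero ln_exp)
      then show ?thesis by (simp add: divide_right_mono)
    qed
    moreover have "(\<lambda>N. R N / real N) \<longlonglongrightarrow> ln 2 * sieve_density B K {0} + 0 * 0 + 0"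
      unfolding R_def by (rule pressure_rate)
    ultimately have "cover_entropy shift X C \<le> ln 2 * sieve_density B K {0} + 0 * 0 + 0"
      using lim by (intro LIMSEQ_le[of _ _ "\<lambda>N. R N / real N"]) auto
    then show ?thesis by simp
  qed
  moreover have "(\<lambda>K. ln 2 * sieve_density B K {0}) \<longlonglongrightarrow> ln 2 * limit_density B {0}"
    by (intro tendsto_intros sieve_density_tendsto[OF B])
  ultimately show ?thesis unfolding X_def by (intro LIMSEQ_le_const[of "\<lambda>K. ln 2 * sieve_density B K {0}"]) blast+
qed

lemma topological_entropy_le:
  assumes "B \<subseteq> {1..}"
  shows "topological_entropy shift (X_tilde B) \<le> ereal (ln 2 * limit_density B {0})"
  unfolding topological_entropy_def using cover_entropy_le[OF assms] by (intro SUP_least) auto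

text \<open>
  No atom of a partition can be left out of a cover by atoms.
\<close>

lemma card_itineraries_le_min_subcover:
  assumes T: "\<And>x. x \<in> X \<Longrightarrow> T x \<in> X" and fin: "has_finite_subcover X (iterated_join T X (fibres X l) n)"
  shows "card (itinerary T l n ` X) \<le> min_subcover X (iterated_join T X (fibres X l) n)"
proof -
  obtain D where D: "D \<subseteq> iterated_join T X (fibres X l) n" "finite D"
    "card D = min_subcover X (iterated_join T X (fibres X l) n)" "X \<subseteq> \<Union>D"
    by (rule min_subcover_attained[OF fin])
  have nonempty: "iterated_join T X (fibres X l) n - {{}} = fibres X (itinerary T l n)"
    using T by (rule iterated_join_fibres)
  have "fibres X (itinerary T l n) \<subseteq> D"
  proof
    fix S assume "S \<in> fibres X (itinerary T l n)"
    then obtain x where x: "x \<in> X" "S = itinerary T l n -` {itinerary T l n x} \<inter> X" by (auto simp: fibres_def)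
    obtain R where R: "R \<in> D" "x \<in> R" using D(4) x(1) by blast
    then have "R \<in> iterated_join T X (fibres X l) n - {{}}" using D(1) by blast
    then have "R \<in> fibres X (itinerary T l n)" unfolding nonempty .
    then obtain z where "R = itinerary T l n -` {itinerary T l n z} \<inter> X" by (auto simp: fibres_def)
    then have "R = S" using R(2) x(2) by auto
    then show "S \<in> D" using R(1) by simp
  qed
  then have "card (fibres X (itinerary T l n)) \<le> card D" by (rule card_mono[OF D(2)])
  also have "card (fibres X (itinerary T l n)) = card (itinerary T l n ` X)"
    unfolding fibres_def by (rule card_image[OF inj_on_fibre])
  finally show ?thesis using D(3) by simp
qed

text \<open>
  The two cylinders at coordinate \<open>0\<close> are at the same time a partition and an open cover, and the
  entropy of the itinerary is at most the logarithm of the number of itineraries.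
\<close>

lemma partition_entropy_le_topological_entropy:
  assumes B: "B \<subseteq> {1..}" and \<mu>: "invariant_prob shift (X_tilde B) \<mu>"
  shows "ereal (partition_entropy shift \<mu> (fibres (X_tilde B) (\<lambda>x. x 0))) \<le> topological_entropy shift (X_tilde B)"
proof -
  define X where "X = X_tilde B"
  define l where "l = (\<lambda>x :: int \<Rightarrow> bool. x 0)"
  interpret measure_preserving \<mu> shift using invariant_probD(4)[OF \<mu>] .
  have sp: "space \<mu> = X" unfolding X_def by (rule invariant_probD(1)[OF \<mu>])
  have l: "simple_function \<mu> l"
  proof (rule simple_function_windowed[OF \<mu>])
    show "l y = l x" if "y \<in> window 0 x" for x y using that by (simp add: window_def l_def)
    show "finite (l ` X_tilde B)" by (rule finite_subset[of _ UNIV]) auto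
  qed
  have "openin (top_of_set X) U" if U: "U \<in> fibres X l" for U
  proof -
    obtain x where x: "U = l -` {l x} \<inter> X" using U unfolding fibres_def by blast
    have "U = X \<inter> {y. \<forall>i\<in>{0}. y i = l x}" unfolding x l_def by auto
    moreover have "open {y :: int \<Rightarrow> bool. \<forall>i\<in>{0}. y i = l x}" by (rule open_coordinates) simp
    ultimately show ?thesis unfolding openin_open by blast
  qed
  moreover have "\<Union>(fibres X l) = X" unfolding fibres_def by blast
  ultimately have C: "open_cover X (fibres X l)" by (simp add: open_cover_def)
  have fin: "has_finite_subcover X (iterated_join shift X (fibres X l) n)" for n
    using iterated_cover_has_finite_subcover[OF B] C unfolding X_def .
  have shift_X: "x \<in> X \<Longrightarrow> shift x \<in> X" for x by (simp add: X_def X_tilde_shift)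
  let ?N = "\<lambda>n. real (min_subcover X (iterated_join shift X (fibres X l) n))"
  have "rv_entropy \<mu> (itinerary shift l n) / real n \<le> ln (?N n) / real n" for n
  proof -
    have it: "simple_function \<mu> (itinerary shift l n)" by (rule simple_function_itinerary[OF l])
    have "0 < card (itinerary shift l n ` X)"
      using simple_functionD(1)[OF it] X_tilde_nonempty[of B] by (simp add: card_gt_0_iff sp X_def)
    moreover have "card (itinerary shift l n ` X) \<le> min_subcover X (iterated_join shift X (fibres X l) n)"
      by (rule card_itineraries_le_min_subcover[OF shift_X fin])
    ultimately have "ln (real (card (itinerary shift l n ` X))) \<le> ln (?N n)" by (intro ln_mono) auto
    then show ?thesis using rv_entropy_le_ln_card[OF it] by (intro divide_right_mono) (auto simp: sp)
  qed
  moreover have "(\<lambda>n. rv_entropy \<mu> (itinerary shift l n) / real n) \<longlonglongrightarrow> partition_entropy shift \<mu> (fibres X l)"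
    using partition_entropy_tendsto[OF l] by (simp add: sp)
  moreover have "(\<lambda>n. ln (?N n) / real n) \<longlonglongrightarrow> cover_entropy shift X (fibres X l)"
    using shift_X fin X_tilde_nonempty[of B, folded X_def] by (rule cover_entropy_tendsto)
  ultimately have "partition_entropy shift \<mu> (fibres X l) \<le> cover_entropy shift X (fibres X l)"
    by (intro LIMSEQ_le) auto
  also have "ereal (cover_entropy shift X (fibres X l)) \<le> topological_entropy shift X"
    unfolding topological_entropy_def using C by (intro SUP_upper) auto
  finally show ?thesis by (simp add: X_def l_def)
qed

section \<open>A random profinite integer\<close>

lemma product_pmf:
  fixes p :: "'i \<Rightarrow> 'b pmf"
  defines "N \<equiv> PiM UNIV (\<lambda>i. measure_pmf (p i))"
  shows "prob_space N" "space N = UNIV"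
    "finite J \<Longrightarrow> {x. \<forall>i\<in>J. x i \<in> X i} \<in> sets N"
    "finite J \<Longrightarrow> measure N {x. \<forall>i\<in>J. x i \<in> X i} = (\<Prod>i\<in>J. measure (measure_pmf (p i)) (X i))"
proof -
  interpret product_prob_space "\<lambda>i. measure_pmf (p i)" UNIV
    by (rule product_prob_spaceI) (rule prob_space_measure_pmf)
  show "prob_space N" unfolding N_def by (rule prob_space_axioms)
  show sp: "space N = UNIV" by (simp add: N_def space_PiM)
  assume J: "finite J"
  have eq: "{x. \<forall>i\<in>J. x i \<in> X i} = prod_emb UNIV (\<lambda>i. measure_pmf (p i)) J (Pi\<^sub>E J X)"
    by (auto simp: prod_emb_def Pi_iff PiE_iff)
  show "{x. \<forall>i\<in>J. x i \<in> X i} \<in> sets N"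
    unfolding eq N_def using J by (intro sets_PiM_I) auto
  show "measure N {x. \<forall>i\<in>J. x i \<in> X i} = (\<Prod>i\<in>J. measure (measure_pmf (p i)) (X i))"
    unfolding eq N_def using J by (intro measure_PiM_emb) auto
qed

text \<open>
  Independent uniform digits in the factorial number system. They are the digits of a random
  profinite integer, since the first \<open>K\<close> digits determine the residue modulo \<open>K!\<close>.
\<close>

definition digit_space :: "(nat \<Rightarrow> nat) measure" where
  "digit_space = PiM UNIV (\<lambda>i. measure_pmf (pmf_of_set {..i}))"

definition factorial_sum :: "(nat \<Rightarrow> nat) \<Rightarrow> nat \<Rightarrow> nat" where
  "factorial_sum a K = (\<Sum>i<K. a i * fact i)"

lemmas digit_space_props = product_pmf[where p = "\<lambda>i :: nat. pmf_of_set {..i}", folded digit_space_def]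

lemma factorial_digits: "(\<Sum>i<K. (r div fact i mod Suc i) * fact i) = r mod fact K" for r :: nat
proof (induction K)
  case (Suc K)
  have "r mod fact (Suc K) = r mod (fact K * Suc K)" by (simp add: mult.commute)
  also have "\<dots> = fact K * (r div fact K mod Suc K) + r mod fact K" by (rule mod_mult2_eq)
  finally show ?case using Suc by (simp add: mult.commute)
qed simp

lemma factorial_sum_level_sets: "{a. factorial_sum a K = r} \<in> sets digit_space"
proof (induction K arbitrary: r)
  case 0
  have "space digit_space \<in> sets digit_space" by simp
  then show ?case by (cases "r = 0") (simp_all add: factorial_sum_def digit_space_props(2))
next
  case (Suc K)
  have "{a. factorial_sum a (Suc K) = r}
      = (\<Union>s\<in>{..r}. {a. factorial_sum a K = s} \<inter> {a. \<forall>i\<in>{K}. a i \<in> {c. s + c * fact K = r}})"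
    by (auto simp: factorial_sum_def)
  also have "\<dots> \<in> sets digit_space"
    by (intro sets.finite_UN sets.Int Suc digit_space_props(3)) auto
  finally show ?case .
qed

lemma factorial_sum_sets: "{a. Q (factorial_sum a K)} \<in> sets digit_space"
proof -
  have "{a. Q (factorial_sum a K)} = (\<Union>r\<in>{r. Q r}. {a. factorial_sum a K = r})" by auto
  also have "\<dots> \<in> sets digit_space"
    using factorial_sum_level_sets by (intro sets.countable_UN') auto
  finally show ?thesis .
qed

text \<open>
  Every residue \<open>r\<close> below \<open>K!\<close> has a digit expansion, which occurs with probability \<open>1/K!\<close>.
\<close>

lemma factorial_sum_uniform_le:
  "(\<Sum>r<fact K. of_bool (Q r)) / fact K \<le> measure digit_space {a. Q (factorial_sum a K)}"
proof -
  interpret prob_space digit_space by (rule digit_space_props(1))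
  let ?E = "\<lambda>r. {a. factorial_sum a K = r}"
  have atom: "1 / fact K \<le> measure digit_space (?E r)" if r: "r < fact K" for r
  proof -
    let ?D = "{a. \<forall>i\<in>{..<K}. a i \<in> {r div fact i mod Suc i}}"
    have "measure digit_space ?D = (\<Prod>i<K. measure (measure_pmf (pmf_of_set {..i})) {r div fact i mod Suc i})"
      by (rule digit_space_props(4)) simp
    also have "\<dots> = (\<Prod>i<K. 1 / real (Suc i))"
    proof (rule prod.cong[OF refl])
      fix i
      have "r div fact i mod Suc i \<le> i" using mod_less_divisor[of "Suc i" "r div fact i"] by linarith
      then show "measure (measure_pmf (pmf_of_set {..i})) {r div fact i mod Suc i} = 1 / real (Suc i)"
        by (simp add: measure_pmf_single pmf_of_set)
    qed
    also have "\<dots> = 1 / fact K"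
      by (induction K) (simp_all add: mult.commute)
    finally have "measure digit_space ?D = 1 / fact K" .
    moreover have "?D \<subseteq> ?E r"
    proof
      fix a assume "a \<in> ?D"
      then have "factorial_sum a K = (\<Sum>i<K. (r div fact i mod Suc i) * fact i)"
        unfolding factorial_sum_def by (intro sum.cong) auto
      then show "a \<in> ?E r" using factorial_digits[of r K] r by simp
    qed
    then have "measure digit_space ?D \<le> measure digit_space (?E r)"
      by (rule finite_measure_mono) (rule factorial_sum_level_sets)
    ultimately show ?thesis by simp
  qed
  let ?R = "{r\<in>{..<fact K}. Q r}"
  have "(\<Sum>r<fact K. of_bool (Q r)) / fact K = (\<Sum>r\<in>?R. 1 / fact K :: real)"
    by (simp add: Int_def)
  also have "\<dots> \<le> (\<Sum>r\<in>?R. measure digit_space (?E r))"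
    using atom by (intro sum_mono) auto
  also have "\<dots> = measure digit_space (\<Union>r\<in>?R. ?E r)"
    using factorial_sum_level_sets
    by (intro finite_measure_finite_Union[symmetric]) (auto simp: disjoint_family_on_def)
  also have "\<dots> \<le> measure digit_space {a. Q (factorial_sum a K)}"
    by (intro finite_measure_mono factorial_sum_sets) auto
  finally show ?thesis .
qed

text \<open>
  The lower bounds for \<open>Q\<close> and for its negation add up to \<open>1\<close>, so both are sharp.
\<close>

lemma factorial_sum_uniform:
  "measure digit_space {a. Q (factorial_sum a K)} = (\<Sum>r<fact K. of_bool (Q r)) / fact K"
proof -
  interpret prob_space digit_space by (rule digit_space_props(1))
  have "{a. \<not> Q (factorial_sum a K)} = space digit_space - {a. Q (factorial_sum a K)}"
    by (auto simp: digit_space_props(2))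
  then have "measure digit_space {a. \<not> Q (factorial_sum a K)} = 1 - measure digit_space {a. Q (factorial_sum a K)}"
    using prob_compl[OF factorial_sum_sets[of Q K]] by simp
  moreover have "(\<Sum>r<fact K. of_bool (Q r)) / fact K + (\<Sum>r<fact K. of_bool (\<not> Q r)) / fact K = (1 :: real)"
  proof -
    have "(\<Sum>r<fact K. of_bool (Q r)) + (\<Sum>r<fact K. of_bool (\<not> Q r)) = (\<Sum>r<(fact K :: nat). 1 :: real)"
      by (subst sum.distrib[symmetric]) (intro sum.cong, auto)
    then show ?thesis by (simp flip: add_divide_distrib)
  qed
  ultimately show ?thesis
    using factorial_sum_uniform_le[where K = K and Q = Q]
      factorial_sum_uniform_le[where K = K and Q = "\<lambda>r. \<not> Q r"] by linarith
qed

text \<open>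
  The translate by a random profinite integer of the profinite integers that are divisible by no
  \<open>b \<in> B\<close>, intersected with the integers. Level \<open>K\<close> of the sieve needs only the first \<open>K\<close> digits.
\<close>

definition random_sieve :: "nat set \<Rightarrow> (nat \<Rightarrow> nat) \<Rightarrow> int \<Rightarrow> bool" where
  "random_sieve B a n \<longleftrightarrow> (\<forall>K. sieve B K (n + int (factorial_sum a K)))"

section \<open>Windows of the random sieve\<close>

text \<open>
  No translate of \<open>eta B\<close> covers the ones of \<open>x\<close> in \<open>[-M, M]\<close>. By \<open>X_tilde_memI\<close> a sequence that is
  unfit for no \<open>M\<close> lies in \<open>X_tilde B\<close>. Enlarging \<open>x\<close> keeps it unfit, so the random sieve can be
  replaced by its periodic approximations.
\<close>

definition unfit :: "nat set \<Rightarrow> nat \<Rightarrow> (int \<Rightarrow> bool) \<Rightarrow> bool" where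
  "unfit B M x \<longleftrightarrow> \<not> (\<exists>m. \<forall>i. \<bar>i\<bar> \<le> int M \<longrightarrow> x i \<longrightarrow> eta B (i + m))"

lemma unfit_mono: "unfit B M x \<Longrightarrow> (\<And>i. x i \<Longrightarrow> y i) \<Longrightarrow> unfit B M y"
  by (auto simp: unfit_def)

lemma measurable_patterns:
  assumes "\<And>A. finite A \<Longrightarrow> {x\<in>space N. \<forall>i\<in>A. f x i} \<in> sets N"
  shows "f \<in> measurable N (borel :: (int \<Rightarrow> bool) measure)"
proof (rule measurable_sigma_sets[OF sets_borel_patterns])
  fix S :: "(int \<Rightarrow> bool) set" assume "S \<in> {{x. \<forall>i\<in>A. x i} | A. finite A}"
  then obtain A where A: "finite A" "S = {x. \<forall>i\<in>A. x i}" by blast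
  have "f -` S \<inter> space N = {x\<in>space N. \<forall>i\<in>A. f x i}" by (auto simp: A(2))
  then show "f -` S \<inter> space N \<in> sets N" using assms[OF A(1)] by simp
qed auto

context
  fixes B :: "nat set"
  assumes B: "B \<subseteq> {1..}"
begin

lemma sieve_factorial_sum_add:
  "sieve B K (n + int (factorial_sum a (K + d))) \<longleftrightarrow> sieve B K (n + int (factorial_sum a K))"
proof (induction d)
  case (Suc d)
  have "(fact K :: nat) dvd fact (K + d)" by (rule fact_dvd) simp
  then obtain q :: nat where q: "fact (K + d) = fact K * q" by (auto simp: dvd_def)
  have "n + int (factorial_sum a (K + Suc d)) = n + int (factorial_sum a (K + d)) + fact K * int (q * a (K + d))"
    using q by (simp add: factorial_sum_def)
  then have "(n + int (factorial_sum a (K + Suc d))) mod fact K = (n + int (factorial_sum a (K + d))) mod fact K"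
    by (simp only: mod_mult_self2)
  then show ?case using Suc sieve_cong_mod[OF B] by blast
qed simp

lemma sieve_factorial_sum_antimono:
  assumes "K \<le> K'" "sieve B K' (n + int (factorial_sum a K'))"
  shows "sieve B K (n + int (factorial_sum a K))"
  using sieve_factorial_sum_add[of K n a "K' - K"] sieve_antimono[OF assms] assms(1) by simp

text \<open>
  The events at the levels \<open>K\<close> decrease to the event in question, and by uniformity of the
  residues they have the probabilities \<open>sieve_density B K A\<close>.
\<close>

lemma random_sieve_pattern:
  "{a. \<forall>i\<in>A. random_sieve B a i} \<in> sets digit_space"
  "measure digit_space {a. \<forall>i\<in>A. random_sieve B a i} = limit_density B A"
proof -
  interpret prob_space digit_space by (rule digit_space_props(1))
  define E where "E = (\<lambda>K. {a. \<forall>i\<in>A. sieve B K (i + int (factorial_sum a K))})"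
  have eq: "{a. \<forall>i\<in>A. random_sieve B a i} = (\<Inter>K. E K)" by (auto simp: E_def random_sieve_def)
  have sets: "E K \<in> sets digit_space" for K
    unfolding E_def by (rule factorial_sum_sets)
  then show "{a. \<forall>i\<in>A. random_sieve B a i} \<in> sets digit_space"
    unfolding eq by (intro sets.countable_INT) auto
  have "decseq E"
    unfolding decseq_def E_def using sieve_factorial_sum_antimono by blast
  then have "(\<lambda>K. measure digit_space (E K)) \<longlonglongrightarrow> measure digit_space (\<Inter>K. E K)"
    using sets by (intro finite_Lim_measure_decseq) auto
  moreover have "measure digit_space (E K) = sieve_density B K A" for K
    unfolding E_def sieve_density_def by (rule factorial_sum_uniform)
  ultimately have "(\<lambda>K. sieve_density B K A) \<longlonglongrightarrow> measure digit_space (\<Inter>K. E K)" by simp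
  then show "measure digit_space {a. \<forall>i\<in>A. random_sieve B a i} = limit_density B A"
    unfolding eq using sieve_density_tendsto[OF B] by (rule LIMSEQ_unique)
qed

text \<open>
  If the window of the sieve at \<open>j\<close> is unfit, then the translate of \<open>eta B\<close> by \<open>j\<close> does not cover it,
  so some place in this window belongs to the sieve but not to the \<open>B\<close>-free set. Each such place
  is in at most \<open>2M + 1\<close> windows. Apart from the boundary, the number of these places up to \<open>N\<close> is the
  difference of two counts.
\<close>

lemma unfit_count_le:
  assumes N: "c * real N \<le> (\<Sum>n=1..N. of_bool (eta B (int n)))"
  shows "real (\<Sum>j<N. of_bool (unfit B M (\<lambda>i. sieve B K (i + int j))))
    \<le> real (2 * M + 1) * (real N * (sieve_density B K {0} - c) + fact K + 2 * real M + 2)"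
proof -
  define g where "g = (\<lambda>n. of_bool (sieve B K n \<and> \<not> eta B n) :: real)"
  have g: "0 \<le> g n" "g n \<le> 1" for n by (auto simp: g_def)
  define I where "I = {- int M..int M}"
  have I: "finite I" "card I = 2 * M + 1" by (auto simp: I_def)
  have "real (\<Sum>j<N. of_bool (unfit B M (\<lambda>i. sieve B K (i + int j)))) \<le> (\<Sum>j<N. \<Sum>i\<in>I. g (i + int j))"
    unfolding of_nat_sum
  proof (rule sum_mono)
    fix j
    show "real (of_bool (unfit B M (\<lambda>i. sieve B K (i + int j)))) \<le> (\<Sum>i\<in>I. g (i + int j))"
    proof (cases "unfit B M (\<lambda>i. sieve B K (i + int j))")
      case True
      then obtain i where i: "\<bar>i\<bar> \<le> int M" "sieve B K (i + int j)" "\<not> eta B (i + int j)"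
        by (auto simp: unfit_def)
      then have "i \<in> I" by (auto simp: I_def)
      have "1 = g (i + int j)" using i by (simp add: g_def)
      also have "\<dots> \<le> (\<Sum>i\<in>I. g (i + int j))" using \<open>i \<in> I\<close> I(1) g by (intro member_le_sum) auto
      finally show ?thesis using True by simp
    qed (auto intro: sum_nonneg g)
  qed
  also have "\<dots> = (\<Sum>i\<in>I. \<Sum>j<N. g (i + int j))" by (rule sum.swap)
  also have "\<dots> \<le> (\<Sum>i\<in>I. real N * (sieve_density B K {0} - c) + fact K + 2 * real M + 2)"
  proof (rule sum_mono)
    fix i assume i: "i \<in> I"
    \<comment> \<open>The interval \<open>[i, i + N)\<close> sticks out of \<open>[1, N]\<close> by at most \<open>2M + 1\<close> places.\<close>
    have "(\<Sum>j<N. g (i + int j)) = (\<Sum>n\<in>{i..<i + int N}. g n)"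
      by (rule sum.reindex_bij_witness[of _ "\<lambda>n. nat (n - i)" "\<lambda>j. i + int j"]) auto
    also have "\<dots> \<le> (\<Sum>n\<in>{1..int N} \<union> {- int M..0} \<union> {int N + 1..int N + int M}. g n)"
      using i g by (intro sum_mono2) (auto simp: I_def)
    also have "\<dots> = (\<Sum>n\<in>{1..int N}. g n) + (\<Sum>n\<in>{- int M..0}. g n) + (\<Sum>n\<in>{int N + 1..int N + int M}. g n)"
      by (subst sum.union_disjoint, simp, simp, force, subst sum.union_disjoint) auto
    also have "(\<Sum>n\<in>{- int M..0}. g n) \<le> real (M + 1)"
      using sum_bounded_above[of "{- int M..0}" g 1] g by simp
    also have "(\<Sum>n\<in>{int N + 1..int N + int M}. g n) \<le> real M"
      using sum_bounded_above[of "{int N + 1..int N + int M}" g 1] g by simp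
    also have "(\<Sum>n\<in>{1..int N}. g n) = (\<Sum>j<N. of_bool (\<forall>i\<in>{0}. sieve B K (i + (1 + int j)))) - (\<Sum>n=1..N. of_bool (eta B (int n)))"
    proof -
      have "(\<Sum>n\<in>{1..int N}. g n) = (\<Sum>n=1..N. g (int n))"
        by (rule sum.reindex_bij_witness[of _ int nat]) auto
      also have "\<dots> = (\<Sum>n=1..N. of_bool (sieve B K (int n)) - of_bool (eta B (int n)))"
        by (intro sum.cong) (auto simp: g_def dest: eta_imp_sieve)
      also have "\<dots> = (\<Sum>n=1..N. of_bool (sieve B K (int n))) - (\<Sum>n=1..N. of_bool (eta B (int n)))"
        by (rule sum_subtractf)
      also have "(\<Sum>n=1..N. of_bool (sieve B K (int n))) = (\<Sum>j<N. of_bool (\<forall>i\<in>{0}. sieve B K (i + (1 + int j))))"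
        by (rule sum.reindex_bij_witness[of _ Suc "\<lambda>n. n - 1"]) auto
      finally show ?thesis .
    qed
    also have "(\<Sum>j<N. of_bool (\<forall>i\<in>{0}. sieve B K (i + (1 + int j)))) \<le> real N * sieve_density B K {0} + fact K"
      using sieve_count[OF B, of "{0}" K 1 N] by linarith
    finally show "(\<Sum>j<N. g (i + int j)) \<le> real N * (sieve_density B K {0} - c) + fact K + 2 * real M + 2"
      using N by (simp add: algebra_simps)
  qed
  also have "\<dots> = real (2 * M + 1) * (real N * (sieve_density B K {0} - c) + fact K + 2 * real M + 2)"
    using I(2) by simp
  finally show ?thesis .
qed

text \<open>
  The frequency of unfit windows is computed along the intervals \<open>[1, N]\<close> on which the Davenport--Erdos
  theorem provides many \<open>B\<close>-free numbers.
\<close>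

lemma unfit_density_le:
  "(\<Sum>r<fact K. of_bool (unfit B M (\<lambda>i. sieve B K (i + int r)))) / fact K
    \<le> real (2 * M + 1) * (sieve_density B K {0} - limit_density B {0})"
    (is "?\<beta> \<le> _")
proof -
  define m where "m = real (2 * M + 1)"
  have "?\<beta> \<le> m * (sieve_density B K {0} - c)" if c: "c < limit_density B {0}" for c
  proof (rule ccontr)
    assume "\<not> ?thesis"
    then have gap: "0 < ?\<beta> - m * (sieve_density B K {0} - c)" by simp
    define C where "C = fact K + m * (fact K + 2 * real M + 2)"
    define N0 where "N0 = Suc (nat \<lceil>C / (?\<beta> - m * (sieve_density B K {0} - c))\<rceil>)"
    obtain N where N: "N \<ge> N0" "c * real N \<le> (\<Sum>n=1..N. of_bool (eta B (int n)))"
      using davenport_erdos[OF B c] by blast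
    let ?f = "\<lambda>n. of_bool (unfit B M (\<lambda>i. sieve B K (i + n))) :: real"
    have "\<bar>(\<Sum>j<N. ?f (0 + int j)) - real N * ((\<Sum>j<fact K. ?f (int j)) / real (fact K))\<bar> \<le> real (fact K)"
    proof (rule periodic_sum_bounds)
      show "?f (n + int (fact K)) = ?f n" for n
        using sieve_periodic[OF B, of K] by (simp add: add.assoc[symmetric])
    qed auto
    then have "real N * ?\<beta> - fact K \<le> (\<Sum>j<N. ?f (int j))" by simp
    also have "\<dots> \<le> m * (real N * (sieve_density B K {0} - c) + fact K + 2 * real M + 2)"
      using unfit_count_le[OF N(2), of M K] by (simp add: m_def)
    finally have "real N * (?\<beta> - m * (sieve_density B K {0} - c)) \<le> C"
      by (simp add: C_def algebra_simps)
    then have "real N \<le> C / (?\<beta> - m * (sieve_density B K {0} - c))"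
      using gap by (simp add: le_divide_eq)
    then show False using N(1) unfolding N0_def by linarith
  qed
  moreover have "0 \<le> m" by (simp add: m_def)
  moreover have "(\<lambda>j. m * (sieve_density B K {0} - (limit_density B {0} - 1 / real (Suc j))))
      \<longlonglongrightarrow> m * (sieve_density B K {0} - (limit_density B {0} - 0))"
    by (intro tendsto_intros LIMSEQ_inverse_real_of_nat[unfolded inverse_eq_divide])
  ultimately show ?thesis unfolding m_def
    by (intro LIMSEQ_le_const[of "\<lambda>j. m * (sieve_density B K {0} - (limit_density B {0} - 1 / real (Suc j)))", unfolded m_def]) auto
qed

lemma measurable_random_sieve: "random_sieve B \<in> measurable digit_space borel"
  by (rule measurable_patterns) (simp add: digit_space_props(2) random_sieve_pattern(1))

text \<open>
  The random sieve is contained in each of its periodic approximations, and the frequency of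
  unfit windows in these tends to \<open>0\<close>.
\<close>

lemma unfit_null: "measure digit_space {a. unfit B M (random_sieve B a)} = 0" "{a. unfit B M (random_sieve B a)} \<in> sets digit_space"
proof -
  interpret prob_space digit_space by (rule digit_space_props(1))
  have "windowed M {x. unfit B M x}"
    unfolding windowed_def mem_Collect_eq
  proof (intro allI impI)
    fix x y assume "y \<in> window M x"
    then have "y i = x i" if "\<bar>i\<bar> \<le> int M" for i using that by (simp add: window_def)
    then have "(\<forall>i. \<bar>i\<bar> \<le> int M \<longrightarrow> x i \<longrightarrow> eta B (i + m)) \<longleftrightarrow> (\<forall>i. \<bar>i\<bar> \<le> int M \<longrightarrow> y i \<longrightarrow> eta B (i + m))" for m
      by simp
    then show "unfit B M x \<longleftrightarrow> unfit B M y" by (simp only: unfit_def)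
  qed
  then have "{x. unfit B M x} \<in> sets borel" using windowed_open by simp
  from measurable_sets[OF measurable_random_sieve this]
  show sets: "{a. unfit B M (random_sieve B a)} \<in> sets digit_space"
    by (simp add: vimage_def digit_space_props(2))
  have "measure digit_space {a. unfit B M (random_sieve B a)}
      \<le> real (2 * M + 1) * (sieve_density B K {0} - limit_density B {0})" for K
  proof -
    have "measure digit_space {a. unfit B M (random_sieve B a)}
        \<le> measure digit_space {a. unfit B M (\<lambda>i. sieve B K (i + int (factorial_sum a K)))}"
      by (intro finite_measure_mono factorial_sum_sets) (auto intro: unfit_mono simp: random_sieve_def)
    also have "\<dots> = (\<Sum>r<fact K. of_bool (unfit B M (\<lambda>i. sieve B K (i + int r)))) / fact K"
      by (rule factorial_sum_uniform)
    also have "\<dots> \<le> real (2 * M + 1) * (sieve_density B K {0} - limit_density B {0})"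
      by (rule unfit_density_le)
    finally show ?thesis .
  qed
  moreover have "(\<lambda>K. real (2 * M + 1) * (sieve_density B K {0} - limit_density B {0}))
      \<longlonglongrightarrow> real (2 * M + 1) * (limit_density B {0} - limit_density B {0})"
    by (intro tendsto_intros sieve_density_tendsto[OF B])
  ultimately have "measure digit_space {a. unfit B M (random_sieve B a)}
      \<le> real (2 * M + 1) * (limit_density B {0} - limit_density B {0})"
    by (intro LIMSEQ_le_const) blast+
  then show "measure digit_space {a. unfit B M (random_sieve B a)} = 0"
    using measure_nonneg[of digit_space "{a. unfit B M (random_sieve B a)}"] by simp
qed

end

section \<open>The measure of maximal entropy\<close>

definition coin_space :: "(int \<Rightarrow> bool) measure" where
  "coin_space = PiM UNIV (\<lambda>_. measure_pmf (bernoulli_pmf (1 / 2)))"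

lemmas coin_space_props = product_pmf[where p = "\<lambda>_ :: int. bernoulli_pmf (1 / 2)", folded coin_space_def]

lemma coin_pattern:
  assumes "finite J"
  shows "{e. \<forall>i\<in>J. e i = c i} \<in> sets coin_space"
    "measure coin_space {e. \<forall>i\<in>J. e i = c i} = 1 / 2 ^ card J"
proof -
  have eq: "{e. \<forall>i\<in>J. e i = c i} = {e. \<forall>i\<in>J. e i \<in> {c i}}" by simp
  show "{e. \<forall>i\<in>J. e i = c i} \<in> sets coin_space"
    unfolding eq by (rule coin_space_props(3)[OF assms])
  have "measure coin_space {e. \<forall>i\<in>J. e i = c i} = (\<Prod>i\<in>J. measure (measure_pmf (bernoulli_pmf (1 / 2))) {c i})"
    unfolding eq by (rule coin_space_props(4)[OF assms])
  also have "\<dots> = (\<Prod>i\<in>J. 1 / 2)"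
  proof (rule prod.cong[OF refl])
    fix i
    show "measure (measure_pmf (bernoulli_pmf (1 / 2))) {c i} = 1 / 2"
      by (cases "c i") (simp_all add: measure_pmf_single)
  qed
  finally show "measure coin_space {e. \<forall>i\<in>J. e i = c i} = 1 / 2 ^ card J"
    by (simp add: power_divide)
qed

definition joint_space :: "((nat \<Rightarrow> nat) \<times> (int \<Rightarrow> bool)) measure" where
  "joint_space = digit_space \<Otimes>\<^sub>M coin_space"

lemma joint_space_props:
  "prob_space joint_space" "space joint_space = UNIV"
  "S \<in> sets digit_space \<Longrightarrow> R \<in> sets coin_space \<Longrightarrow> S \<times> R \<in> sets joint_space"
  "S \<in> sets digit_space \<Longrightarrow> R \<in> sets coin_space \<Longrightarrow>
    measure joint_space (S \<times> R) = measure digit_space S * measure coin_space R"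
proof -
  interpret D: prob_space digit_space by (rule digit_space_props(1))
  interpret C: prob_space coin_space by (rule coin_space_props(1))
  interpret pair_prob_space digit_space coin_space ..
  show "prob_space joint_space" unfolding joint_space_def by (rule prob_space_axioms)
  show "space joint_space = UNIV"
    by (simp add: joint_space_def space_pair_measure digit_space_props(2) coin_space_props(2))
  assume "S \<in> sets digit_space" "R \<in> sets coin_space"
  then show "S \<times> R \<in> sets joint_space"
    "measure joint_space (S \<times> R) = measure digit_space S * measure coin_space R"
    unfolding joint_space_def measure_def
    by (simp_all add: C.emeasure_pair_measure_Times enn2real_mult)
qed

text \<open>
  Each element of the random sieve survives if its coin shows \<open>True\<close>.
\<close>

definition thinned :: "nat set \<Rightarrow> (nat \<Rightarrow> nat) \<times> (int \<Rightarrow> bool) \<Rightarrow> int \<Rightarrow> bool" where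
  "thinned B = (\<lambda>(a, e) i. random_sieve B a i \<and> e i)"

definition max_measure :: "nat set \<Rightarrow> (int \<Rightarrow> bool) measure" where
  "max_measure B = restrict_space (distr joint_space borel (thinned B)) (X_tilde B)"

context
  fixes B :: "nat set"
  assumes B: "B \<subseteq> {1..}"
begin

lemma thinned_pattern_eq:
  "{\<omega>. \<forall>i\<in>A. thinned B \<omega> i} = {a. \<forall>i\<in>A. random_sieve B a i} \<times> {e. \<forall>i\<in>A. e i = True}"
  by (auto simp: thinned_def)

lemma measurable_thinned: "thinned B \<in> measurable joint_space borel"
proof (rule measurable_patterns)
  fix A :: "int set" assume A: "finite A"
  have "{\<omega>. \<forall>i\<in>A. thinned B \<omega> i} \<in> sets joint_space"
    unfolding thinned_pattern_eq by (intro joint_space_props(3) random_sieve_pattern(1)[OF B] coin_pattern(1) A)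
  then show "{\<omega>\<in>space joint_space. \<forall>i\<in>A. thinned B \<omega> i} \<in> sets joint_space"
    by (simp add: joint_space_props(2))
qed

lemma thinned_in_X_tilde: "AE \<omega> in joint_space. thinned B \<omega> \<in> X_tilde B"
proof -
  interpret prob_space joint_space by (rule joint_space_props(1))
  interpret D: prob_space digit_space by (rule digit_space_props(1))
  have "AE \<omega> in joint_space. \<not> unfit B M (random_sieve B (fst \<omega>))" for M
  proof (rule AE_I)
    let ?N = "{a. unfit B M (random_sieve B a)} \<times> (UNIV :: (int \<Rightarrow> bool) set)"
    have U: "UNIV \<in> sets coin_space" using sets.top[of coin_space] by (simp add: coin_space_props(2))
    show "?N \<in> sets joint_space" by (intro joint_space_props(3) unfit_null(2)[OF B] U)
    have "measure joint_space ?N = 0"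
      by (simp add: joint_space_props(4)[OF unfit_null(2)[OF B] U] unfit_null(1)[OF B])
    then show "emeasure joint_space ?N = 0" by (simp add: emeasure_eq_measure)
  qed auto
  then have "AE \<omega> in joint_space. \<forall>M. \<not> unfit B M (random_sieve B (fst \<omega>))"
    by (simp add: AE_all_countable)
  then show ?thesis
  proof (rule AE_mp, intro AE_I2 impI)
    fix \<omega> :: "(nat \<Rightarrow> nat) \<times> (int \<Rightarrow> bool)" assume \<omega>: "\<forall>M. \<not> unfit B M (random_sieve B (fst \<omega>))"
    show "thinned B \<omega> \<in> X_tilde B"
    proof (rule X_tilde_memI)
      fix M
      have "\<not> unfit B M (random_sieve B (fst \<omega>))" using \<omega> by blast
      then obtain m where "\<forall>i. \<bar>i\<bar> \<le> int M \<longrightarrow> random_sieve B (fst \<omega>) i \<longrightarrow> eta B (i + m)"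
        unfolding unfit_def by blast
      then show "\<exists>m. \<forall>i. \<bar>i\<bar> \<le> int M \<longrightarrow> thinned B \<omega> i \<longrightarrow> eta B (i + m)"
        by (intro exI[of _ m]) (auto simp: thinned_def split_beta)
    qed
  qed
qed

lemma max_measure_space: "sets (max_measure B) = sets (restrict_space borel (X_tilde B))"
  "space (max_measure B) = X_tilde B" "prob_space (max_measure B)"
proof -
  interpret prob_space joint_space by (rule joint_space_props(1))
  interpret N: prob_space "distr joint_space borel (thinned B)"
    by (rule prob_space_distr[OF measurable_thinned])
  show "sets (max_measure B) = sets (restrict_space borel (X_tilde B))"
    unfolding max_measure_def by (rule sets_restrict_space_cong) simp
  show "space (max_measure B) = X_tilde B"
    by (simp add: max_measure_def space_restrict_space)
  have "AE x in distr joint_space borel (thinned B). x \<in> X_tilde B"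
    using thinned_in_X_tilde X_tilde_borel by (subst AE_distr_iff[OF measurable_thinned]) auto
  then have "emeasure (distr joint_space borel (thinned B)) (X_tilde B) = 1"
    using X_tilde_borel by (intro N.emeasure_eq_1_AE) auto
  then show "prob_space (max_measure B)"
    unfolding max_measure_def using X_tilde_borel by (intro prob_space_restrict_space) auto
qed

lemma max_measure_eq:
  assumes S: "S \<in> sets borel"
  shows "measure (max_measure B) (S \<inter> X_tilde B) = measure joint_space {\<omega>. thinned B \<omega> \<in> S}"
proof -
  interpret prob_space joint_space by (rule joint_space_props(1))
  have "measure (max_measure B) (S \<inter> X_tilde B) = measure (distr joint_space borel (thinned B)) (S \<inter> X_tilde B)"
    unfolding max_measure_def using X_tilde_borel by (intro measure_restrict_space) auto
  also have "\<dots> = measure joint_space {\<omega>. thinned B \<omega> \<in> S \<inter> X_tilde B}"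
    using S X_tilde_borel by (subst measure_distr[OF measurable_thinned]) (auto simp: vimage_def joint_space_props(2))
  also have "\<dots> = measure joint_space {\<omega>. thinned B \<omega> \<in> S}"
  proof (rule finite_measure_eq_AE)
    show "AE \<omega> in joint_space. \<omega> \<in> {\<omega>. thinned B \<omega> \<in> S \<inter> X_tilde B} \<longleftrightarrow> \<omega> \<in> {\<omega>. thinned B \<omega> \<in> S}"
      using thinned_in_X_tilde by eventually_elim auto
    show "{\<omega>. thinned B \<omega> \<in> S \<inter> X_tilde B} \<in> sets joint_space" "{\<omega>. thinned B \<omega> \<in> S} \<in> sets joint_space"
      using measurable_sets[OF measurable_thinned, of S] measurable_sets[OF measurable_thinned, of "S \<inter> X_tilde B"] S X_tilde_borel
      by (auto simp: vimage_def joint_space_props(2))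
  qed
  finally show ?thesis .
qed

lemma max_measure_pattern:
  assumes A: "finite A"
  shows "measure (max_measure B) {x\<in>X_tilde B. \<forall>i\<in>A. x i} = limit_density B A / 2 ^ card A"
proof -
  have S: "{x :: int \<Rightarrow> bool. \<forall>i\<in>A. x i} \<in> sets borel"
    using open_coordinates[OF A, of "\<lambda>_. True"] by simp
  have "{x\<in>X_tilde B. \<forall>i\<in>A. x i} = {x. \<forall>i\<in>A. x i} \<inter> X_tilde B" by auto
  then have "measure (max_measure B) {x\<in>X_tilde B. \<forall>i\<in>A. x i} = measure joint_space {\<omega>. \<forall>i\<in>A. thinned B \<omega> i}"
    using max_measure_eq[OF S] by simp
  also have "\<dots> = limit_density B A / 2 ^ card A"
    unfolding thinned_pattern_eq
    by (simp add: joint_space_props(4)[OF random_sieve_pattern(1)[OF B] coin_pattern(1)[OF A]]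
        random_sieve_pattern(2)[OF B] coin_pattern(2)[OF A] del: eq_True)
  finally show ?thesis .
qed

text \<open>
  Translating a pattern changes neither its density nor its size, hence not its probability, and
  the probabilities of patterns determine the measure.
\<close>

lemma invariant_max_measure: "invariant_prob shift (X_tilde B) (max_measure B)"
proof -
  define X where "X = X_tilde B"
  define \<mu> where "\<mu> = max_measure B"
  have \<mu>: "sets \<mu> = sets (restrict_space borel X)" "space \<mu> = X" "prob_space \<mu>"
    using max_measure_space by (simp_all add: \<mu>_def X_def)
  have "shift \<in> measurable (borel :: (int \<Rightarrow> bool) measure) borel"
    by (rule borel_measurable_continuous_onI[OF continuous_shift])
  then have "shift \<in> measurable (restrict_space borel X) (restrict_space borel X)"
    by (intro measurable_restrict_space3) (auto simp: X_def X_tilde_shift)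
  then have shift: "shift \<in> measurable \<mu> \<mu>"
    by (simp cong: measurable_cong_sets add: \<mu>(1))
  have "distr \<mu> \<mu> shift = \<mu>"
  proof (rule patterns_determine_measure)
    show "sets (distr \<mu> \<mu> shift) = sets (restrict_space borel X)" by (simp add: \<mu>(1))
    show "prob_space (distr \<mu> \<mu> shift)" by (rule prob_space.prob_space_distr[OF \<mu>(3) shift])
    fix A :: "int set" assume A: "finite A"
    let ?P = "\<lambda>A. {x\<in>X. \<forall>i\<in>A. x i}"
    have "{x :: int \<Rightarrow> bool. \<forall>i\<in>A. x i} \<in> sets borel"
      using open_coordinates[OF A, of "\<lambda>_. True"] by simp
    moreover have "?P A = X \<inter> {x. \<forall>i\<in>A. x i}" by auto
    ultimately have P: "?P A \<in> sets \<mu>" unfolding \<mu>(1) sets_restrict_space by auto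
    have "measure (distr \<mu> \<mu> shift) (?P A) = measure \<mu> (shift -` ?P A \<inter> space \<mu>)"
      by (rule measure_distr[OF shift P])
    also have "shift -` ?P A \<inter> space \<mu> = ?P ((\<lambda>i. i + 1) ` A)"
      using X_tilde_shift[unfolded shift_def shift_by_def] by (auto simp: \<mu>(2) X_def shift_def shift_by_def)
    also have "measure \<mu> \<dots> = limit_density B ((\<lambda>i. i + 1) ` A) / 2 ^ card ((\<lambda>i. i + 1) ` A)"
      using A unfolding \<mu>_def X_def by (intro max_measure_pattern) auto
    also have "\<dots> = limit_density B A / 2 ^ card A"
      by (simp add: limit_density_translate[OF B] card_image inj_on_def)
    also have "\<dots> = measure \<mu> (?P A)"
      unfolding \<mu>_def X_def by (rule max_measure_pattern[OF A, symmetric])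
    finally show "measure (distr \<mu> \<mu> shift) (?P A) = measure \<mu> (?P A)" .
  qed (use \<mu> in auto)
  then show ?thesis
    using \<mu> shift by (simp add: invariant_prob_def \<mu>_def X_def)
qed

text \<open>
  Given the trace \<open>v\<close> of the random sieve on \<open>W\<close>, the word is a uniformly random subset of \<open>v\<close>, with
  entropy \<open>|v| ln 2\<close>. The law of the word is the mixture of these laws, and the entropy of a mixture
  is at least the mean of the entropies: apply Gibbs' inequality to each component, with the
  mixture as weights. The mean of \<open>|v|\<close> is \<open>|W|\<close> times the density.
\<close>

lemma max_measure_word_entropy:
  assumes W: "finite W"
  shows "ln 2 * (real (card W) * limit_density B {0}) \<le> rv_entropy (max_measure B) (\<lambda>x. {i\<in>W. x i})"
proof -
  interpret D: prob_space digit_space by (rule digit_space_props(1))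
  interpret J: prob_space joint_space by (rule joint_space_props(1))
  interpret prob_space "max_measure B" by (rule max_measure_space(3))
  define word where "word = (\<lambda>x :: int \<Rightarrow> bool. {i\<in>W. x i})"
  define V where "V = (\<lambda>a. word (random_sieve B a))"
  have word_sets: "word -` {w} \<in> sets borel" for w
  proof (cases "w \<subseteq> W")
    case True
    have "word -` {w} = {x. \<forall>i\<in>W. x i = (i \<in> w)}" using True by (auto simp: word_def)
    then show ?thesis using open_coordinates[OF W, of "\<lambda>i. i \<in> w"] by simp
  next
    case False
    then have "word -` {w} = {}" by (auto simp: word_def)
    then show ?thesis by simp
  qed
  have word: "simple_function (max_measure B) word"
    unfolding simple_function_def
  proof (intro conjI ballI)
    show "finite (word ` space (max_measure B))"
      by (rule finite_subset[of _ "Pow W"]) (use W in \<open>auto simp: word_def\<close>)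
    show "word -` {w} \<inter> space (max_measure B) \<in> sets (max_measure B)" for w
      unfolding max_measure_space(2) by (rule invariant_probD(2)[OF invariant_max_measure word_sets])
  qed
  have V_sets: "V -` {v} \<in> sets digit_space" for v
    using measurable_sets[OF measurable_random_sieve[OF B] word_sets[of v]]
    by (simp add: V_def vimage_def digit_space_props(2))
  have V: "simple_function digit_space V"
    unfolding simple_function_def
  proof (intro conjI ballI)
    show "finite (V ` space digit_space)"
      by (rule finite_subset[of _ "Pow W"]) (use W in \<open>auto simp: V_def word_def\<close>)
  qed (use V_sets in \<open>simp add: digit_space_props(2)\<close>)
  define I where "I = Pow W"
  have I: "finite I" "word ` space (max_measure B) \<subseteq> I" "V ` space digit_space \<subseteq> I"
    using W by (auto simp: I_def V_def word_def)
  define p where "p = point_prob (max_measure B) word"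
  define q where "q = point_prob digit_space V"
  have p_eq: "p w = (\<Sum>v\<in>I. q v * (of_bool (w \<subseteq> v) / 2 ^ card v))" if w: "w \<in> I" for w
  proof -
    define F where "F = (\<lambda>v. (V -` {v}) \<times> (if w \<subseteq> v then {e. \<forall>i\<in>v. e i = (i \<in> w)} else {}))"
    have fin: "finite v" if "v \<in> I" for v using that W by (auto simp: I_def intro: finite_subset)
    have coin: "(if w \<subseteq> v then {e. \<forall>i\<in>v. e i = (i \<in> w)} else {}) \<in> sets coin_space" if "v \<in> I" for v
      using coin_pattern(1)[OF fin[OF that]] by auto
    have "p w = measure joint_space {\<omega>. thinned B \<omega> \<in> word -` {w}}"
      unfolding p_def point_prob_def max_measure_space(2) by (rule max_measure_eq[OF word_sets])
    also have "{\<omega>. thinned B \<omega> \<in> word -` {w}} = (\<Union>v\<in>I. F v)"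
    proof (intro set_eqI)
      fix \<omega> :: "(nat \<Rightarrow> nat) \<times> (int \<Rightarrow> bool)"
      obtain a e where \<omega>: "\<omega> = (a, e)" by (cases \<omega>)
      have "word (thinned B \<omega>) = {i\<in>V a. e i}" by (auto simp: \<omega> thinned_def V_def word_def)
      moreover have "{i\<in>V a. e i} = w \<longleftrightarrow> w \<subseteq> V a \<and> (\<forall>i\<in>V a. e i = (i \<in> w))" by auto
      moreover have "V a \<in> I" by (auto simp: V_def word_def I_def)
      ultimately show "\<omega> \<in> {\<omega>. thinned B \<omega> \<in> word -` {w}} \<longleftrightarrow> \<omega> \<in> (\<Union>v\<in>I. F v)"
        by (auto simp: F_def \<omega>)
    qed
    also have "measure joint_space \<dots> = (\<Sum>v\<in>I. measure joint_space (F v))"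
    proof (rule J.finite_measure_finite_Union[OF I(1)])
      show "F ` I \<subseteq> sets joint_space"
        unfolding F_def using coin by (intro image_subsetI joint_space_props(3) V_sets)
      show "disjoint_family_on F I" by (auto simp: F_def disjoint_family_on_def)
    qed
    also have "\<dots> = (\<Sum>v\<in>I. q v * (of_bool (w \<subseteq> v) / 2 ^ card v))"
    proof (rule sum.cong[OF refl])
      fix v assume v: "v \<in> I"
      show "measure joint_space (F v) = q v * (of_bool (w \<subseteq> v) / 2 ^ card v)"
        unfolding F_def joint_space_props(4)[OF V_sets coin[OF v]]
        using coin_pattern(2)[OF fin[OF v]] by (simp add: q_def point_prob_def digit_space_props(2))
    qed
    finally show ?thesis .
  qed
  have q0: "0 \<le> q v" for v by (simp add: q_def point_prob_nonneg)
  have p0: "0 \<le> p w" for w by (simp add: p_def point_prob_nonneg)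
  have component: "q v * (\<Sum>w\<in>Pow v. 1 / 2 ^ card v * ln (p w)) \<le> - (q v * (ln 2 * real (card v)))" if v: "v \<in> I" for v
  proof (cases "q v = 0")
    case False
    have vW: "v \<subseteq> W" "finite v" using v W by (auto simp: I_def intro: finite_subset)
    have "(\<Sum>w\<in>Pow v. 1 / 2 ^ card v * ln (p w)) - (\<Sum>w\<in>Pow v. 1 / 2 ^ card v * ln (1 / 2 ^ card v)) \<le> ln 1"
    proof (rule gibbs_inequality)
      show "finite (Pow v)" using vW by simp
      show "(\<Sum>w\<in>Pow v. 1 / 2 ^ card v :: real) = 1" using vW by (simp add: card_Pow)
      show "0 < p w" if "w \<in> Pow v" for w
      proof -
        have "0 < q v * (of_bool (w \<subseteq> v) / 2 ^ card v)" using that False q0[of v] by simp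
        also have "\<dots> \<le> (\<Sum>v\<in>I. q v * (of_bool (w \<subseteq> v) / 2 ^ card v))"
          by (rule member_le_sum[OF v]) (auto simp: q0 I)
        also have "\<dots> = p w" using that v by (intro p_eq[symmetric]) (auto simp: I_def)
        finally show ?thesis .
      qed
      have "(\<Sum>w\<in>Pow v. p w) \<le> (\<Sum>w\<in>I. p w)" using I p0 vW by (intro sum_mono2) (auto simp: I_def)
      also have "\<dots> = 1" unfolding p_def by (rule sum_point_prob[OF word I(1,2)])
      finally show "(\<Sum>w\<in>Pow v. p w) \<le> 1" .
    qed (auto simp: p0)
    moreover have "(\<Sum>w\<in>Pow v. 1 / 2 ^ card v * ln (1 / 2 ^ card v :: real)) = - (ln 2 * real (card v))"
      using vW by (simp add: card_Pow ln_div ln_realpow)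
    ultimately have "(\<Sum>w\<in>Pow v. 1 / 2 ^ card v * ln (p w)) \<le> - (ln 2 * real (card v))" by simp
    then have "q v * (\<Sum>w\<in>Pow v. 1 / 2 ^ card v * ln (p w)) \<le> q v * - (ln 2 * real (card v))"
      by (rule mult_left_mono[OF _ q0])
    then show ?thesis by simp
  qed simp
  have "(\<Sum>w\<in>I. p w * ln (p w)) = (\<Sum>w\<in>I. \<Sum>v\<in>I. q v * (of_bool (w \<subseteq> v) / 2 ^ card v) * ln (p w))"
  proof (rule sum.cong[OF refl])
    fix w assume w: "w \<in> I"
    show "p w * ln (p w) = (\<Sum>v\<in>I. q v * (of_bool (w \<subseteq> v) / 2 ^ card v) * ln (p w))"
      by (subst (1) p_eq[OF w]) (rule sum_distrib_right)
  qed
  also have "\<dots> = (\<Sum>v\<in>I. q v * (\<Sum>w\<in>I. of_bool (w \<subseteq> v) / 2 ^ card v * ln (p w)))"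
    by (subst sum.swap) (simp add: sum_distrib_left mult.assoc)
  also have "\<dots> = (\<Sum>v\<in>I. q v * (\<Sum>w\<in>Pow v. 1 / 2 ^ card v * ln (p w)))"
    using I(1) by (intro sum.cong refl arg_cong2[where f = "(*)"] sum.mono_neutral_cong_right) (auto simp: I_def)
  also have "\<dots> \<le> (\<Sum>v\<in>I. - (q v * (ln 2 * real (card v))))"
    by (intro sum_mono component)
  also have "\<dots> = - (ln 2 * (\<Sum>v\<in>I. q v * real (card v)))"
    by (simp add: sum_negf sum_distrib_left mult.left_commute)
  also have "(\<Sum>v\<in>I. q v * real (card v)) = D.expectation (\<lambda>a. real (card (V a)))"
    unfolding q_def by (rule D.expectation_simple(1)[OF V I(1,3), of "\<lambda>v. real (card v)", symmetric])
  also have "\<dots> = D.expectation (\<lambda>a. \<Sum>i\<in>W. indicator {a. \<forall>i\<in>{i}. random_sieve B a i} a)"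
    using W by (intro Bochner_Integration.integral_cong) (auto simp: V_def word_def indicator_def Int_def)
  also have "\<dots> = (\<Sum>i\<in>W. D.expectation (indicator {a. \<forall>i\<in>{i}. random_sieve B a i}))"
  proof (rule Bochner_Integration.integral_sum)
    show "integrable digit_space (indicat_real {a. \<forall>i\<in>{i}. random_sieve B a i})" for i
      by (rule integrable_real_indicator) (simp_all only: random_sieve_pattern(1)[OF B] D.emeasure_eq_measure infinity_ennreal_def ennreal_less_top)
  qed
  also have "\<dots> = (\<Sum>i\<in>W. limit_density B {i})"
    using random_sieve_pattern[OF B, of "{_}"] by (intro sum.cong) (auto simp: digit_space_props(2))
  also have "\<dots> = (\<Sum>i\<in>W. limit_density B {0})"
    using limit_density_translate[OF B, of _ "{0}"] by (intro sum.cong) auto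
  finally have "(\<Sum>w\<in>I. p w * ln (p w)) \<le> - (ln 2 * (real (card W) * limit_density B {0}))" by simp
  then show ?thesis
    using rv_entropy_eq_sum[OF I(1,2)] by (simp add: p_def word_def)
qed

lemma max_measure_partition_entropy:
  "ln 2 * limit_density B {0} \<le> partition_entropy shift (max_measure B) (fibres (X_tilde B) (\<lambda>x. x 0))"
proof -
  interpret measure_preserving "max_measure B" shift
    by (rule invariant_probD(4)[OF invariant_max_measure])
  define l where "l = (\<lambda>x :: int \<Rightarrow> bool. x 0)"
  have l: "simple_function (max_measure B) l"
  proof (rule simple_function_windowed[OF invariant_max_measure])
    show "l y = l x" if "y \<in> window 0 x" for x y using that by (simp add: window_def l_def)
    show "finite (l ` X_tilde B)" by (rule finite_subset[of _ UNIV]) auto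
  qed
  have "ln 2 * (real N * limit_density B {0}) \<le> rv_entropy (max_measure B) (itinerary shift l N)" for N
  proof -
    define h where "h = (\<lambda>u :: nat \<Rightarrow> bool. {i\<in>{0..<int N}. u (nat i)})"
    have "{i\<in>{0..<int N}. x i} = h (itinerary shift l N x)" for x
      by (auto simp: h_def itinerary_def l_def shift_funpow_apply)
    then have "rv_entropy (max_measure B) (\<lambda>x. {i\<in>{0..<int N}. x i}) = rv_entropy (max_measure B) (\<lambda>x. h (itinerary shift l N x))"
      by presburger
    also have "\<dots> \<le> rv_entropy (max_measure B) (itinerary shift l N)"
      by (intro rv_entropy_mono simple_function_itinerary l)
    finally show ?thesis using max_measure_word_entropy[of "{0..<int N}"] by simp
  qed
  then have "ln 2 * limit_density B {0} \<le> rv_entropy (max_measure B) (itinerary shift l N) / real N" if "N \<ge> 1" for N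
    using that by (simp add: le_divide_eq ac_simps)
  then have "ln 2 * limit_density B {0} \<le> partition_entropy shift (max_measure B) (fibres (space (max_measure B)) l)"
    by (intro LIMSEQ_le_const[OF partition_entropy_tendsto[OF l]]) blast
  then show ?thesis by (simp add: l_def max_measure_space(2))
qed

lemma topological_entropy_X_tilde:
  "topological_entropy shift (X_tilde B) = ereal (ln 2 * limit_density B {0})"
proof (rule antisym)
  have "ereal (ln 2 * limit_density B {0})
      \<le> ereal (partition_entropy shift (max_measure B) (fibres (X_tilde B) (\<lambda>x. x 0)))"
    using max_measure_partition_entropy by simp
  also have "\<dots> \<le> topological_entropy shift (X_tilde B)"
    by (rule partition_entropy_le_topological_entropy[OF B invariant_max_measure])
  finally show "ereal (ln 2 * limit_density B {0}) \<le> topological_entropy shift (X_tilde B)" .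
qed (rule topological_entropy_le[OF B])

lemma kolmogorov_entropy_max_measure:
  "kolmogorov_entropy shift (max_measure B) = ereal (ln 2 * limit_density B {0})"
proof (rule antisym)
  interpret measure_preserving "max_measure B" shift
    by (rule invariant_probD(4)[OF invariant_max_measure])
  have "simple_function (max_measure B) (\<lambda>x :: int \<Rightarrow> bool. x 0)"
  proof (rule simple_function_windowed[OF invariant_max_measure])
    show "y 0 = x 0" if "y \<in> window 0 x" for x y using that by (simp add: window_def)
    show "finite ((\<lambda>x. x 0) ` X_tilde B)" by (rule finite_subset[of _ UNIV]) auto
  qed
  then have "measurable_partition (max_measure B) (fibres (X_tilde B) (\<lambda>x. x 0))"
    using simple_measurable_partition by (simp add: max_measure_space(2))
  then have "ereal (partition_entropy shift (max_measure B) (fibres (X_tilde B) (\<lambda>x. x 0)))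
      \<le> kolmogorov_entropy shift (max_measure B)"
    unfolding kolmogorov_entropy_def by (intro SUP_upper) simp
  moreover have "ereal (ln 2 * limit_density B {0})
      \<le> ereal (partition_entropy shift (max_measure B) (fibres (X_tilde B) (\<lambda>x. x 0)))"
    using max_measure_partition_entropy by simp
  ultimately show "ereal (ln 2 * limit_density B {0}) \<le> kolmogorov_entropy shift (max_measure B)"
    by (rule order.trans[rotated])
qed (rule kolmogorov_entropy_le[OF B invariant_max_measure])

end

theorem theorem10:
  fixes B :: "nat set"
  assumes "B \<subseteq> {1..}"
  shows "intrinsically_ergodic shift (X_tilde B)"
  unfolding intrinsically_ergodic_def topological_entropy_X_tilde[OF assms]
proof (rule ex1I[of _ "max_measure B"])
  show "invariant_prob shift (X_tilde B) (max_measure B) \<and>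
      kolmogorov_entropy shift (max_measure B) = ereal (ln 2 * limit_density B {0})"
    using invariant_max_measure[OF assms] kolmogorov_entropy_max_measure[OF assms] by blast
next
  fix \<mu>
  assume \<mu>: "invariant_prob shift (X_tilde B) \<mu> \<and> kolmogorov_entropy shift \<mu> = ereal (ln 2 * limit_density B {0})"
  show "\<mu> = max_measure B"
  proof (rule patterns_determine_measure)
    show "sets \<mu> = sets (restrict_space borel (X_tilde B))" "prob_space \<mu>"
      using \<mu> by (auto simp: invariant_prob_def)
    show "sets (max_measure B) = sets (restrict_space borel (X_tilde B))" "prob_space (max_measure B)"
      by (rule max_measure_space[OF assms])+
    show "measure \<mu> {x\<in>X_tilde B. \<forall>i\<in>A. x i} = measure (max_measure B) {x\<in>X_tilde B. \<forall>i\<in>A. x i}" if "finite A" for A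
      using maximal_entropy_pattern[OF assms _ _ that] max_measure_pattern[OF assms that] \<mu> by simp
  qed
qed

end
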